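(* There is a fully polynomial-time randomised approximation scheme (FPRAS) for counting the bases of a bicircular matroid, with time complexity $O(n^3(\log n)^2\varepsilon^{-2})$, where the input is a connected simple graph $G$ with $n$ vertices and at least $n$ edges and $\varepsilon\in(0,1)$ is the accuracy parameter.
   Context: The bicircular matroid of a connected graph $G=(V,E)$ with $|E|\ge|V|$ has ground set $E$; its bases are the sets $R\subseteq E$ such that every connected component of $(V,R)$ contains exactly one cycle. An FPRAS for the number $N(G)$ of bases is a randomised algorithm that, given $G$ and $\varepsilon\in(0,1)$, outputs an estimate $\hat N$ with $\Pr[(1-\varepsilon)N(G)\le\hat N\le(1+\varepsilon)N(G)]\ge3/4$, in time polynomial in the size of $G$ and $\varepsilon^{-1}$. The stated time bound is expected running time. *)

theory Defs
  imports "HOL-Probability.Probability"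
begin

section \<open>Simple graphs and bases of the bicircular matroid\<close>

definition simple_graph :: "'a set \<Rightarrow> 'a set set \<Rightarrow> bool" where
  "simple_graph V E \<longleftrightarrow> finite V \<and> (\<forall>e\<in>E. e \<subseteq> V \<and> card e = 2)"

definition reach :: "'a set \<Rightarrow> 'a set set \<Rightarrow> ('a \<times> 'a) set" where
  "reach V R = {(u, v). u \<in> V \<and> v \<in> V \<and> (u, v) \<in> {(x, y). {x, y} \<in> R}\<^sup>*}"

definition connected_graph :: "'a set \<Rightarrow> 'a set set \<Rightarrow> bool" where
  "connected_graph V E \<longleftrightarrow> V \<noteq> {} \<and> (\<forall>u\<in>V. \<forall>v\<in>V. (u, v) \<in> reach V E)"

definition components :: "'a set \<Rightarrow> 'a set set \<Rightarrow> 'a set set" where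
  "components V R = V // reach V R"

text \<open>A cycle is identified with its edge set, so that rotations and reversals of a
  vertex sequence give the same cycle.\<close>

definition is_cycle :: "'a set set \<Rightarrow> bool" where
  "is_cycle C \<longleftrightarrow> (\<exists>vs. distinct vs \<and> 3 \<le> length vs \<and>
     C = {{vs ! i, vs ! (Suc i mod length vs)} | i. i < length vs})"

definition bicircular_bases :: "'a set \<Rightarrow> 'a set set \<Rightarrow> 'a set set set" where
  "bicircular_bases V E =
     {R. R \<subseteq> E \<and> (\<forall>K\<in>components V R. \<exists>!C. is_cycle C \<and> C \<subseteq> R \<and> \<Union>C \<subseteq> K)}"


section \<open>A randomised word RAM\<close>

text \<open>
  Programs are finite texts of a structured language over a word RAM with word length \<open>w\<close>.
  The memory consists of arrays named by constants of the program (hence finitely many are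
  used), each indexed by words. Arithmetic is on words: addition and multiplication wrap around
  modulo \<open>2 ^ w\<close>, subtraction is truncated at \<open>0\<close>, and division by \<open>0\<close> follows the library
  convention for \<^typ>\<open>nat\<close>. The word length is not known to the program.
\<close>

type_synonym mem = "nat \<Rightarrow> nat \<Rightarrow> nat"

datatype exp =
    Const nat
  | Get nat exp
  | Add exp exp
  | Sub exp exp
  | Mul exp exp
  | Div exp exp
  | Mod exp exp
  | Less exp exp
  | Equal exp exp

primrec eval :: "nat \<Rightarrow> mem \<Rightarrow> exp \<Rightarrow> nat" where
  "eval w s (Const k) = k mod 2 ^ w"
| "eval w s (Get a e) = s a (eval w s e)"
| "eval w s (Add e1 e2) = (eval w s e1 + eval w s e2) mod 2 ^ w"
| "eval w s (Sub e1 e2) = eval w s e1 - eval w s e2"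
| "eval w s (Mul e1 e2) = (eval w s e1 * eval w s e2) mod 2 ^ w"
| "eval w s (Div e1 e2) = eval w s e1 div eval w s e2"
| "eval w s (Mod e1 e2) = eval w s e1 mod eval w s e2"
| "eval w s (Less e1 e2) = of_bool (eval w s e1 < eval w s e2) mod 2 ^ w"
| "eval w s (Equal e1 e2) = of_bool (eval w s e1 = eval w s e2) mod 2 ^ w"

text \<open>\<open>Rand a i e\<close> stores a uniformly random element of \<open>{0..<k}\<close>, where \<open>k\<close> is the value
  of \<open>e\<close>, at index \<open>i\<close> of array \<open>a\<close> (and \<open>0\<close> if \<open>k = 0\<close>).\<close>

datatype com =
    Skip
  | Store nat exp exp
  | Rand nat exp exp
  | Seq com com
  | If exp com com
  | While exp com

definition update :: "mem \<Rightarrow> nat \<Rightarrow> nat \<Rightarrow> nat \<Rightarrow> mem" where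
  "update s a i x = s(a := (s a)(i := x))"

text \<open>The semantics returns the final memory together with the number of steps; the mass missing
  from the subprobability distribution is the probability of divergence. Every command except
  \<open>Seq\<close> costs one step, a loop one step per test. The expressions belong to the fixed program text, so charging for
  their individual operations would change the running time by a constant factor only.\<close>

partial_function (spmf) while_spmf ::
  "('s \<Rightarrow> bool) \<Rightarrow> ('s \<Rightarrow> ('s \<times> nat) spmf) \<Rightarrow> 's \<Rightarrow> ('s \<times> nat) spmf" where
  "while_spmf b f s =
     (if b s then
        bind_spmf (f s) (\<lambda>r. map_spmf (\<lambda>r'. (fst r', Suc (snd r + snd r'))) (while_spmf b f (fst r)))
      else return_spmf (s, 1))"

primrec exec :: "nat \<Rightarrow> com \<Rightarrow> mem \<Rightarrow> (mem \<times> nat) spmf" where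
  "exec w Skip s = return_spmf (s, 1)"
| "exec w (Store a i e) s = return_spmf (update s a (eval w s i) (eval w s e), 1)"
| "exec w (Rand a i e) s =
     map_spmf (\<lambda>x. (update s a (eval w s i) x, 1))
       (if eval w s e = 0 then return_spmf 0 else spmf_of_set {0..<eval w s e})"
| "exec w (Seq c1 c2) s =
     bind_spmf (exec w c1 s) (\<lambda>r. map_spmf (\<lambda>r'. (fst r', snd r + snd r')) (exec w c2 (fst r)))"
| "exec w (If e c1 c2) s =
     map_spmf (\<lambda>r. (fst r, Suc (snd r))) (if eval w s e \<noteq> 0 then exec w c1 s else exec w c2 s)"
| "exec w (While e c) s = while_spmf (\<lambda>s. eval w s e \<noteq> 0) (exec w c) s"

definition expected_time :: "(mem \<times> nat) spmf \<Rightarrow> ennreal" where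
  "expected_time d =
     (if lossless_spmf d then \<integral>\<^sup>+ r. of_nat (snd r) \<partial>measure_spmf d else \<infinity>)"


section \<open>Input and output conventions\<close>

definition zero_padded :: "nat list \<Rightarrow> nat \<Rightarrow> nat" where
  "zero_padded xs i = (if i < length xs then xs ! i else 0)"

text \<open>Array \<open>0\<close> holds the number of vertices, the number of edges, and the numerator and
  denominator of the accuracy parameter; arrays \<open>1\<close> and \<open>2\<close> hold the end points of the edges.\<close>

definition input_mem :: "nat \<Rightarrow> (nat \<times> nat) list \<Rightarrow> nat \<Rightarrow> nat \<Rightarrow> mem" where
  "input_mem n es p q = (\<lambda>a. zero_padded
     (if a = 0 then [n, length es, p, q]
      else if a = 1 then map fst es
      else if a = 2 then map snd es
      else []))"

text \<open>The number being estimated has far more than \<open>w\<close> bits in general, so the estimate is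
  returned in floating point, its signed exponent being a difference of two words.\<close>

definition estimate :: "mem \<Rightarrow> real" where
  "estimate s = real (s 3 0) * 2 powi (int (s 3 1) - int (s 3 2))"

definition edge_list :: "nat set set \<Rightarrow> (nat \<times> nat) list \<Rightarrow> bool" where
  "edge_list E es \<longleftrightarrow>
     distinct (map (\<lambda>(u, v). {u, v}) es) \<and> set (map (\<lambda>(u, v). {u, v}) es) = E"

text \<open>The real accuracy parameter \<open>\<epsilon>\<close> is presented to the machine as a fraction \<open>p / q\<close> which is
  \<open>\<epsilon>\<close> itself or approximates it from below within a factor of two; the edges are
  listed in any order and with any orientation. The word length is arbitrary subject to the
  input numbers fitting into words and to \<open>w \<ge> c * log 2 (n / \<epsilon>)\<close>.\<close>

definition represents ::
  "nat \<Rightarrow> nat \<Rightarrow> nat \<Rightarrow> nat set set \<Rightarrow> real \<Rightarrow> mem \<Rightarrow> bool" where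
  "represents c w n E \<epsilon> s \<longleftrightarrow>
     (\<exists>es p q. s = input_mem n es p q \<and> edge_list E es \<and>
        0 < q \<and> real p / real q \<le> \<epsilon> \<and> \<epsilon> \<le> 2 * (real p / real q) \<and>
        n < 2 ^ w \<and> length es < 2 ^ w \<and> q < 2 ^ w \<and> (real n / \<epsilon>) ^ c \<le> 2 ^ w)"


section \<open>Fully polynomial-time randomised approximation schemes\<close>

text \<open>Graphs have vertex set \<open>{0..<n}\<close>; \<open>\<G>\<close> is the class of admissible inputs and \<open>N\<close> the
  function to be approximated. Time is expected time, and the same program and the same constant
  \<open>c\<close> in the word length serve all inputs.\<close>

definition runs_in_expected_time ::
  "nat \<Rightarrow> com \<Rightarrow> (nat \<Rightarrow> nat set set \<Rightarrow> bool) \<Rightarrow> (nat \<Rightarrow> nat set set \<Rightarrow> real \<Rightarrow> real) \<Rightarrow> bool" where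
  "runs_in_expected_time c P \<G> T \<longleftrightarrow>
     (\<forall>n E \<epsilon> w s. \<G> n E \<longrightarrow> 0 < \<epsilon> \<longrightarrow> \<epsilon> < 1 \<longrightarrow> represents c w n E \<epsilon> s \<longrightarrow>
        expected_time (exec w P s) \<le> ennreal (T n E \<epsilon>))"

definition fpras ::
  "nat \<Rightarrow> com \<Rightarrow> (nat \<Rightarrow> nat set set \<Rightarrow> bool) \<Rightarrow> (nat \<Rightarrow> nat set set \<Rightarrow> nat) \<Rightarrow> bool" where
  "fpras c P \<G> N \<longleftrightarrow>
     (\<forall>n E \<epsilon> w s. \<G> n E \<longrightarrow> 0 < \<epsilon> \<longrightarrow> \<epsilon> < 1 \<longrightarrow> represents c w n E \<epsilon> s \<longrightarrow>
        measure (measure_spmf (exec w P s))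
          {r. (1 - \<epsilon>) * real (N n E) \<le> estimate (fst r) \<and>
              estimate (fst r) \<le> (1 + \<epsilon>) * real (N n E)} \<ge> 3 / 4) \<and>
     (\<exists>k. runs_in_expected_time c P \<G> (\<lambda>n E \<epsilon>. (real n + real (card E) + 1 / \<epsilon>) ^ k))"

definition bicircular_input :: "nat \<Rightarrow> nat set set \<Rightarrow> bool" where
  "bicircular_input n E \<longleftrightarrow>
     simple_graph {0..<n} E \<and> connected_graph {0..<n} E \<and> n \<le> card E"

end

(*
  Fix one of the two orientations of every cycle. A basis of the bicircular matroid is the edge set of
  exactly one map f with v adjacent to f v all of whose cycles have length at least three and the fixed
  orientation. For a set S of vertices let N(S) be the number of such maps on S, where leaving S is
  allowed and final. A loop-erased random walk from v in S, in which a closed cycle of length at least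
  three is kept with probability 1/2 and every other cycle is erased, finds out of v a path that leaves S
  or ends in a kept cycle, before it returns to v, with probability r = N(S) / (deg v * N(S - {v})).
  Multiplying these ratios along an order of the vertices telescopes to N(V).

  Each r is estimated by counting the excursions up to the M-th success, capped at L. The relative second
  moment of the product of the n estimates is at most (1 + 1/M)^n, so M of order n / eps^2 suffices by
  Chebyshev's inequality. Choosing v next to a vertex that has already been removed makes the expected
  length of an excursion O(n), and it is O(n^2) for the first vertex; hence O(n^3 / eps^2) steps in total.
*)

theory Submission
  imports Defs "HOL-Combinatorics.Orbits" "HOL-Library.Discrete_Functions"
begin

section \<open>Expected cost and almost sure termination of programs\<close>

section \<open>Expectation transformers for the randomised word RAM\<close>

text \<open>A basis carries no orientation, whereas a walk finds a long cycle in either direction.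
  Fixing one orientation makes maps and bases correspond one to one, and reversal of cycles shows
  that a fair coin discards exactly the right share (\<open>balance\<close>). The obstacle is cycles
  of length two: they belong to no basis, reversal does not repair them, and the walk may spend its
  time erasing them. They are controlled by rerooting: a path leading into the two-cycle is reversed
  and its first vertex sent along another edge, which breaks the two-cycle. With an edge leaving S
  this costs a factor n. What is estimated without bias is 1/r, by the number of excursions divided
  by M; so the error analysis follows N(V) divided by the estimate and passes to the estimate itself
  only at the end. Time and error come out of the same transformer: its parameter \<open>a\<close>
  is the price of a step, 1 for time and 0 for probabilities.\<close>

primrec wp :: "ennreal \<Rightarrow> nat \<Rightarrow> com \<Rightarrow> (mem \<Rightarrow> ennreal) \<Rightarrow> mem \<Rightarrow> ennreal" where
  "wp a w Skip F s = a + F s"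
| "wp a w (Store b i e) F s = a + F (update s b (eval w s i) (eval w s e))"
| "wp a w (Rand b i e) F s =
     a + (if eval w s e = 0 then F (update s b (eval w s i) 0)
          else (\<Sum>x<eval w s e. F (update s b (eval w s i) x)) / of_nat (eval w s e))"
| "wp a w (Seq c1 c2) F s = wp a w c1 (wp a w c2 F) s"
| "wp a w (If e c1 c2) F s = a + (if eval w s e \<noteq> 0 then wp a w c1 F s else wp a w c2 F s)"
| "wp a w (While e c) F s = lfp (\<lambda>\<Phi> s. a + (if eval w s e \<noteq> 0 then wp a w c \<Phi> s else F s)) s"

lemma wp_mono: "(\<And>s. F s \<le> G s) \<Longrightarrow> wp a w c F s \<le> wp a w c G s"
proof (induction c arbitrary: F G s)
  case (Seq c1 c2)
  then show ?case by simp
next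
  case (Rand b i e)
  then show ?case
    by (auto intro!: add_left_mono divide_right_mono_ennreal sum_mono)
next
  case (While e c)
  have "lfp (\<lambda>\<Phi> s. a + (if eval w s e \<noteq> 0 then wp a w c \<Phi> s else F s))
      \<le> lfp (\<lambda>\<Phi> s. a + (if eval w s e \<noteq> 0 then wp a w c \<Phi> s else G s))"
    using While by (intro lfp_mono) (auto simp: le_fun_def intro!: add_left_mono)
  then show ?case by (simp add: le_fun_def)
qed (auto intro!: add_left_mono)

lemma mono_wp_while:
  "mono (\<lambda>\<Phi> s. a + (if eval w s e \<noteq> 0 then wp a w c \<Phi> s else F s))"
  by (auto simp: mono_def le_fun_def intro!: add_left_mono wp_mono)

lemma wp_while_unfold:
  "wp a w (While e c) F s =
     a + (if eval w s e \<noteq> 0 then wp a w c (wp a w (While e c) F) s else F s)"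
proof -
  have eq: "wp a w (While e c) F = lfp (\<lambda>\<Phi> s. a + (if eval w s e \<noteq> 0 then wp a w c \<Phi> s else F s))"
    by (rule ext) simp
  show ?thesis
    unfolding eq by (subst lfp_unfold[OF mono_wp_while]) simp
qed

text \<open>Park induction: a least fixed point lies below every pre-fixed point. Bounding a loop
  thus takes only a function of the memory that one round does not increase in expectation, without
  a separate termination proof.\<close>

lemma wp_while_le:
  assumes "\<And>s. a + (if eval w s e \<noteq> 0 then wp a w c \<Phi> s else F s) \<le> \<Phi> s"
  shows "wp a w (While e c) F s \<le> \<Phi> s"
proof -
  have "lfp (\<lambda>\<Phi> s. a + (if eval w s e \<noteq> 0 then wp a w c \<Phi> s else F s)) \<le> \<Phi>"
    using assms by (intro lfp_lowerbound) (simp add: le_fun_def)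
  then show ?thesis by (simp add: le_fun_def)
qed

text \<open>Monotone convergence along a chain of subdistributions. It supplies the admissibility
  condition for the fixpoint induction over \<open>while_spmf\<close> in
  \<open>wp_sound\<close>.\<close>

lemma nn_integral_lub_spmf_le:
  assumes chain: "Complete_Partial_Order.chain (ord_spmf (=)) Y" and "Y \<noteq> {}"
    and le: "\<And>p. p \<in> Y \<Longrightarrow> (\<integral>\<^sup>+ x. f x \<partial>measure_spmf p) \<le> B"
  shows "(\<integral>\<^sup>+ x. f x \<partial>measure_spmf (lub_spmf Y)) \<le> B"
proof -
  let ?C = "count_space (set_spmf (lub_spmf Y))"
  have "(\<integral>\<^sup>+ x. f x \<partial>measure_spmf (lub_spmf Y)) = (\<integral>\<^sup>+ x. ennreal (spmf (lub_spmf Y) x) * f x \<partial>?C)"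
    by (rule nn_integral_measure_spmf')
  also have "\<dots> = (\<integral>\<^sup>+ x. (SUP p\<in>Y. ennreal (spmf p x) * f x) \<partial>?C)"
    using assms by (simp add: ennreal_spmf_lub_spmf SUP_mult_right_ennreal)
  also have "\<dots> = (SUP p\<in>Y. \<integral>\<^sup>+ x. ennreal (spmf p x) * f x \<partial>?C)"
  proof (rule nn_integral_monotone_convergence_SUP_countable)
    show "Complete_Partial_Order.chain (\<le>) ((\<lambda>i x. ennreal (spmf i x) * f x) ` Y)"
      by (rule chain_imageI[OF chain])
         (auto simp: le_fun_def intro!: mult_right_mono ennreal_leI dest: ord_spmf_eq_leD)
  qed (use assms in auto)
  also have "\<dots> \<le> B"
  proof (rule SUP_least)
    fix p assume p: "p \<in> Y"
    \<comment> \<open>The weights of \<open>p\<close> vanish outside its own support, so integrating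
      over the larger support of the supremum changes nothing.\<close>
    have sub: "set_spmf p \<subseteq> set_spmf (lub_spmf Y)"
      using p by (auto simp: set_lub_spmf[OF chain])
    have "(\<integral>\<^sup>+ x. ennreal (spmf p x) * f x \<partial>?C) = (\<integral>\<^sup>+ x. f x \<partial>measure_spmf p)"
      unfolding nn_integral_measure_spmf
      by (auto simp: nn_integral_count_space_indicator spmf_eq_0_set_spmf intro!: nn_integral_cong
          split: split_indicator) (use sub in \<open>auto simp: spmf_eq_0_set_spmf\<close>)
    with le[OF p] show "(\<integral>\<^sup>+ x. ennreal (spmf p x) * f x \<partial>?C) \<le> B" by simp
  qed
  finally show ?thesis .
qed

lemma nn_integral_bind_spmf:
  "(\<integral>\<^sup>+ x. f x \<partial>measure_spmf (bind_spmf p g)) = (\<integral>\<^sup>+ x. \<integral>\<^sup>+ y. f y \<partial>measure_spmf (g x) \<partial>measure_spmf p)"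
  unfolding measure_spmf_bind
  by (subst nn_integral_bind[where B = "count_space UNIV"]) (auto simp: o_def)

lemma nn_integral_spmf_of_lessThan:
  fixes k :: nat
  assumes "0 < k"
  shows "(\<integral>\<^sup>+ x. f x \<partial>measure_spmf (spmf_of_set {0..<k})) = (\<Sum>x<k. f x) / of_nat k"
proof -
  have "(\<integral>\<^sup>+ x. f x \<partial>measure_spmf (spmf_of_set {0..<k})) = (\<integral>\<^sup>+ x. f x \<partial>measure_pmf (pmf_of_set {0..<k}))"
    using assms by (simp flip: spmf_of_pmf_pmf_of_set)
  also have "\<dots> = (\<Sum>x<k. f x) / of_nat k"
    using assms by (subst nn_integral_pmf_of_set) (auto simp: atLeast0LessThan)
  finally show ?thesis .
qed

text \<open>Only an inequality: the constant is weighted with the mass of \<open>p\<close>, which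
  may be below 1.\<close>

lemma nn_integral_shift_le:
  "(\<integral>\<^sup>+ r. a * of_nat (t + snd r) + F (fst r) \<partial>measure_spmf p)
    \<le> a * of_nat t + (\<integral>\<^sup>+ r. a * of_nat (snd r) + F (fst r) \<partial>measure_spmf p)"
proof -
  have "(\<integral>\<^sup>+ r. a * of_nat (t + snd r) + F (fst r) \<partial>measure_spmf p)
      = (\<integral>\<^sup>+ r. a * of_nat t + (a * of_nat (snd r) + F (fst r)) \<partial>measure_spmf p)"
    by (simp add: distrib_left add.assoc)
  also have "\<dots> = (\<integral>\<^sup>+ r. a * of_nat t \<partial>measure_spmf p) + (\<integral>\<^sup>+ r. a * of_nat (snd r) + F (fst r) \<partial>measure_spmf p)"
    by (rule nn_integral_add) auto
  also have "(\<integral>\<^sup>+ r. a * of_nat t \<partial>measure_spmf p) \<le> a * of_nat t * 1"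
    by (simp del: mult_1_right) (intro mult_left_mono measure_spmf.subprob_emeasure_le_1, simp)
  finally show ?thesis by (simp add: add_right_mono)
qed

text \<open>The integral sees terminating runs only, while the transformer also charges diverging
  ones. With \<open>a = 1\<close> and \<open>F = 0\<close> this bounds the time, with
  \<open>a = 0\<close> and an indicator it bounds a probability.\<close>

lemma wp_sound:
  "(\<integral>\<^sup>+ r. a * of_nat (snd r) + F (fst r) \<partial>measure_spmf (exec w c s)) \<le> wp a w c F s"
proof (induction c arbitrary: F s)
  case Skip
  then show ?case by (simp add: measure_spmf_return_spmf nn_integral_return)
next
  case (Store b i e)
  then show ?case by (simp add: measure_spmf_return_spmf nn_integral_return)
next
  case (Rand b i e)
  show ?case
  proof (cases "eval w s e = 0")
    case True
    then show ?thesis by (simp add: measure_spmf_return_spmf nn_integral_return)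
  next
    case False
    have fin: "(of_nat (eval w s e) :: ennreal) \<noteq> \<top>" "(of_nat (eval w s e) :: ennreal) \<noteq> 0"
      using False by (auto simp: ennreal_of_nat_eq_real_of_nat)
    have "(of_nat (eval w s e) * a) / of_nat (eval w s e) = a"
      using fin by (metis ennreal_mult_divide_eq mult.commute)
    with False show ?thesis
      by (simp add: o_def nn_integral_spmf_of_lessThan sum.distrib add_divide_distrib_ennreal)
  qed
next
  case (Seq c1 c2)
  have "(\<integral>\<^sup>+ r. a * of_nat (snd r) + F (fst r) \<partial>measure_spmf (exec w (Seq c1 c2) s))
      = (\<integral>\<^sup>+ r. \<integral>\<^sup>+ r'. a * of_nat (snd r + snd r') + F (fst r') \<partial>measure_spmf (exec w c2 (fst r))
            \<partial>measure_spmf (exec w c1 s))"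
    by (simp add: nn_integral_bind_spmf o_def del: of_nat_add)
  also have "\<dots> \<le> (\<integral>\<^sup>+ r. a * of_nat (snd r) + wp a w c2 F (fst r) \<partial>measure_spmf (exec w c1 s))"
    by (intro nn_integral_mono order.trans[OF nn_integral_shift_le] add_left_mono Seq)
  also have "\<dots> \<le> wp a w (Seq c1 c2) F s"
    using Seq by simp
  finally show ?case .
next
  case (If e c1 c2)
  have *: "(\<integral>\<^sup>+ r. a * of_nat (Suc (snd r)) + F (fst r) \<partial>measure_spmf p)
      \<le> a + (\<integral>\<^sup>+ r. a * of_nat (snd r) + F (fst r) \<partial>measure_spmf p)" for p :: "(mem \<times> nat) spmf"
    using nn_integral_shift_le[where a = a and t = 1 and F = F and p = p] by simp
  show ?case
    using If by (auto simp: o_def simp del: of_nat_Suc intro!: order.trans[OF *] add_left_mono)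
next
  case (While e c)
  let ?\<Phi> = "wp a w (While e c) F"
  let ?b = "\<lambda>s. eval w s e \<noteq> 0"
  let ?I = "\<lambda>p. \<integral>\<^sup>+ r. a * of_nat (snd r) + F (fst r) \<partial>measure_spmf p"
  have "\<forall>s. b = ?b \<longrightarrow> f = exec w c \<longrightarrow> ?I (while_spmf b f s) \<le> ?\<Phi> s" for b f
  proof (induction arbitrary: b f rule: while_spmf.fixp_induct)
    case 1
    show ?case
    proof (intro ccpo.admissibleI allI impI, goal_cases)
      case (1 A b f s)
      show ?case
        unfolding curry_def fun_lub_def
      proof (rule nn_integral_lub_spmf_le)
        show "Complete_Partial_Order.chain (ord_spmf (=)) {y. \<exists>g\<in>A. y = g ((b, f), s)}"
          using 1(1) by (rule chain_fun)
      qed (use 1 in \<open>auto simp: curry_def\<close>)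
    qed
  next
    case 2
    show ?case by simp
  next
    case (3 g)
    show ?case
    proof (intro allI impI)
      fix s assume bf: "b = ?b" "f = exec w c"
      show "?I (if b s then bind_spmf (f s) (\<lambda>r. map_spmf (\<lambda>r'. (fst r', Suc (snd r + snd r'))) (g b f (fst r)))
                else return_spmf (s, 1)) \<le> ?\<Phi> s"
      proof (cases "?b s")
        case True
        have "(\<integral>\<^sup>+ r. \<integral>\<^sup>+ r'. a * of_nat (Suc (snd r) + snd r') + F (fst r') \<partial>measure_spmf (g b f (fst r))
                \<partial>measure_spmf (exec w c s))
            \<le> (\<integral>\<^sup>+ r. a * of_nat (1 + snd r) + ?\<Phi> (fst r) \<partial>measure_spmf (exec w c s))"
          using 3 bf by (intro nn_integral_mono order.trans[OF nn_integral_shift_le] add_mono) auto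
        also have "\<dots> \<le> a * of_nat 1 + wp a w c ?\<Phi> s"
          by (rule order.trans[OF nn_integral_shift_le]) (intro add_left_mono While)
        also have "\<dots> = a + wp a w c ?\<Phi> s" by simp
        finally show ?thesis
          using True bf
          by (subst wp_while_unfold) (simp add: nn_integral_bind_spmf o_def del: of_nat_add of_nat_Suc wp.simps)
      next
        case False
        then show ?thesis
          using bf by (subst wp_while_unfold) (simp add: measure_spmf_return_spmf nn_integral_return del: wp.simps)
      qed
    qed
  qed
  then show ?case by simp
qed

text \<open>For a loop, the probability \<open>d\<close> of divergence is preserved on average by a
  round, and every test costs 1. Hence \<open>k * d\<close> is below the expected cost for every
  \<open>k\<close>, and a finite cost forces \<open>d = 0\<close>.\<close>

lemma wp_lossless: "wp 1 w c F s < \<infinity> \<Longrightarrow> lossless_spmf (exec w c s)"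
proof (induction c arbitrary: F s)
  case (Rand b i e)
  then show ?case by (auto simp: lossless_spmf_of_set)
next
  case (Seq c1 c2)
  have l1: "lossless_spmf (exec w c1 s)"
    using Seq by simp
  have "lossless_spmf (exec w c2 (fst r))" if r: "r \<in> set_spmf (exec w c1 s)" for r
  proof (rule Seq.IH(2))
    have "AE r in measure_spmf (exec w c1 s). 1 * of_nat (snd r) + wp 1 w c2 F (fst r) \<noteq> \<infinity>"
      using Seq.prems order.strict_trans1[OF wp_sound[where a = 1 and F = "wp 1 w c2 F" and w = w and c = c1 and s = s]]
      by (intro nn_integral_PInf_AE) (auto simp: less_top)
    with r show "wp 1 w c2 F (fst r) < \<infinity>"
      by (auto simp: less_top)
  qed
  with l1 show ?case by simp
next
  case (If e c1 c2)
  then show ?case by (auto split: if_splits simp: ennreal_add_less_top)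
next
  case (While e c)
  let ?\<Phi> = "wp 1 w (While e c) F"
  let ?b = "\<lambda>s. eval w s e \<noteq> 0"
  let ?W = "exec w (While e c)"
  let ?d = "\<lambda>s. ennreal (1 - weight_spmf (?W s))"
  have le1: "weight_spmf p \<le> 1" for p :: "(mem \<times> nat) spmf" by (rule weight_spmf_le_1)
  have "of_nat k * ?d s \<le> ?\<Phi> s" for k s
  proof (induction k arbitrary: s)
    case (Suc k)
    show ?case
    proof (cases "?\<Phi> s < \<infinity>")
      case fin: True
      show ?thesis
      proof (cases "?b s")
        case True
        have \<Phi>: "?\<Phi> s = 1 + wp 1 w c ?\<Phi> s"
          using True by (subst wp_while_unfold) (simp del: wp.simps)
        with fin have ll: "lossless_spmf (exec w c s)"
          by (intro While.IH) (auto simp: ennreal_add_less_top simp del: wp.simps)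
        have W: "?W s = bind_spmf (exec w c s) (\<lambda>r. map_spmf (\<lambda>r'. (fst r', Suc (snd r + snd r'))) (?W (fst r)))"
          using True by (simp, subst while_spmf.simps, simp)
        have int: "integrable (measure_spmf (exec w c s)) (\<lambda>r. weight_spmf (?W (fst r)))"
          by (rule measure_spmf.integrable_const_bound[where B = 1]) (auto simp: weight_spmf_le_1)
        have wm: "measure (measure_spmf (map_spmf g p)) UNIV = measure (measure_spmf p) UNIV"
          for g and p :: "(mem \<times> nat) spmf"
          using weight_map_spmf[of g p] by (simp add: space_measure_spmf)
        \<comment> \<open>The body is lossless, so all mass missing from the loop is missing from
          its remaining rounds.\<close>
        have "1 - weight_spmf (?W s) = (\<integral> r. 1 - weight_spmf (?W (fst r)) \<partial>measure_spmf (exec w c s))"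
          unfolding W weight_bind_spmf using ll int
          by (simp add: o_def lossless_spmf_def weight_spmf_def wm space_measure_spmf)
        then have "?d s = (\<integral>\<^sup>+ r. ?d (fst r) \<partial>measure_spmf (exec w c s))"
          using int by (subst nn_integral_eq_integral) (auto simp: le1 simp del: exec.simps)
        then have "of_nat k * ?d s = (\<integral>\<^sup>+ r. of_nat k * ?d (fst r) \<partial>measure_spmf (exec w c s))"
          by (simp add: nn_integral_cmult del: exec.simps)
        also have "\<dots> \<le> (\<integral>\<^sup>+ r. 1 * of_nat (snd r) + ?\<Phi> (fst r) \<partial>measure_spmf (exec w c s))"
          by (intro nn_integral_mono order.trans[OF Suc]) (auto intro: add_increasing)
        also have "\<dots> \<le> wp 1 w c ?\<Phi> s" by (rule wp_sound)
        finally have "?d s + of_nat k * ?d s \<le> 1 + wp 1 w c ?\<Phi> s"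
          by (intro add_mono) auto
        then show ?thesis unfolding \<Phi> by (simp add: distrib_right del: exec.simps wp.simps)
      next
        case False
        then have "?W s = return_spmf (s, 1)" by (simp, subst while_spmf.simps, simp)
        then have "?d s = 0" by (simp del: exec.simps)
        then show ?thesis by (simp del: exec.simps)
      qed
    qed (auto simp: less_top[symmetric] simp del: wp.simps)
  qed simp
  then have le: "of_nat k * ?d s \<le> ?\<Phi> s" for k .
  have "?d s = 0"
  proof (rule ccontr)
    assume ne: "?d s \<noteq> 0"
    obtain B where B: "?\<Phi> s = ennreal B" "B \<ge> 0"
      using While.prems by (cases "?\<Phi> s") auto
    have pos: "1 - weight_spmf (?W s) > 0"
      using ne by (metis ennreal_eq_0_iff linorder_not_less)
    then obtain k :: nat where "B < of_nat k * (1 - weight_spmf (?W s))"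
      using reals_Archimedean3[OF pos] by auto
    moreover have "real k * (1 - weight_spmf (?W s)) \<le> B"
      using le[of k] pos B by (simp add: ennreal_of_nat_eq_real_of_nat ennreal_mult'[symmetric] del: exec.simps wp.simps)
    ultimately show False by linarith
  qed
  then show ?case
    using le1[of "?W s"] by (simp add: lossless_spmf_def ennreal_eq_0_iff del: exec.simps)
qed auto

lemma expected_time_le_wp:
  assumes "wp 1 w c (\<lambda>_. 0) s \<le> ennreal T"
  shows "expected_time (exec w c s) \<le> ennreal T"
proof -
  have "lossless_spmf (exec w c s)"
    using assms by (intro wp_lossless[where F = "\<lambda>_. 0"]) (auto simp: less_top[symmetric] top_unique)
  moreover have "(\<integral>\<^sup>+ r. of_nat (snd r) \<partial>measure_spmf (exec w c s)) \<le> ennreal T"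
    using order.trans[OF wp_sound[where a = 1 and F = "\<lambda>_. 0" and w = w and c = c and s = s] assms] by simp
  ultimately show ?thesis by (simp add: expected_time_def)
qed

text \<open>A diverging run belongs neither to the good nor to the bad event; losslessness lets a
  bound on the one become a bound on the other.\<close>

lemma prob_ge_wp:
  assumes "lossless_spmf (exec w c s)"
    and "wp 0 w c (\<lambda>s. of_bool (\<not> Q s)) s \<le> ennreal p" and "0 \<le> p"
  shows "1 - p \<le> measure (measure_spmf (exec w c s)) {r. Q (fst r)}"
proof -
  let ?M = "measure_spmf (exec w c s)"
  have "emeasure ?M {r. \<not> Q (fst r)} = (\<integral>\<^sup>+ r. of_bool (\<not> Q (fst r)) \<partial>?M)"
    using nn_integral_indicator[of "{r. \<not> Q (fst r)}" ?M]
    by (simp add: indicator_def of_bool_def)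
  also have "\<dots> \<le> ennreal p"
    using order.trans[OF wp_sound[where a = 0 and F = "\<lambda>s. of_bool (\<not> Q s)" and w = w and c = c and s = s] assms(2)] by simp
  finally have "measure ?M {r. \<not> Q (fst r)} \<le> p"
    using assms(3) by (simp add: measure_spmf.emeasure_eq_measure)
  moreover have "measure ?M {r. Q (fst r)} + measure ?M {r. \<not> Q (fst r)} = measure ?M (space ?M)"
    by (subst measure_spmf.finite_measure_Union[symmetric]) (auto intro!: arg_cong[where f = "measure ?M"] simp: space_measure_spmf)
  moreover have "measure ?M (space ?M) = 1"
    using assms(1) by (simp add: lossless_spmf_def weight_spmf_def)
  ultimately show ?thesis by linarith
qed

section \<open>Paths and cycles of a self-map, and orientations of cycles\<close>

section \<open>Functional graphs and their cycles\<close>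

lemma orbit_subset_closed:
  assumes "f x \<in> A" "\<And>y. y \<in> A \<Longrightarrow> f y \<in> A"
  shows "orbit f x \<subseteq> A"
proof
  fix z assume "z \<in> orbit f x"
  then show "z \<in> A" by induction (use assms in auto)
qed

lemma orbit_cong_closed:
  assumes "x \<in> A" "\<And>y. y \<in> A \<Longrightarrow> f y \<in> A" "\<And>y. y \<in> A \<Longrightarrow> f y = g y"
  shows "orbit f x = orbit g x"
  using assms by (intro orbit_cong0[where A = A]) auto

lemma orbit_fixpoint: "f x = x \<Longrightarrow> orbit f x = {x}"
  by (simp add: orbit_eq_singleton_iff)

text \<open>\<open>orbit f x\<close> consists of the iterates with positive exponent, so
  \<open>x \<in> orbit f x\<close> says that \<open>x\<close> lies on a cycle. The orbit is then
  this cycle, whichever of its vertices one starts from.\<close>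

lemma orbit_periodic_eq:
  assumes "x \<in> orbit f x" "y \<in> orbit f x"
  shows "orbit f y = orbit f x"
proof -
  have "x \<in> orbit f y"
    using assms by (rule orbit_swap)
  then show ?thesis
    using orbit_trans[OF _ assms(2)] orbit_trans[OF _ \<open>x \<in> orbit f y\<close>] by blast
qed

definition follows :: "('a \<Rightarrow> 'a) \<Rightarrow> 'a list \<Rightarrow> bool" where
  "follows h xs \<longleftrightarrow> successively (\<lambda>x y. h x = y) xs"

lemma follows_simps [simp]:
  "follows h []" "follows h [x]" "follows h (x # y # xs) \<longleftrightarrow> h x = y \<and> follows h (y # xs)"
  by (auto simp: follows_def)

lemma follows_Cons: "follows h (x # xs) \<longleftrightarrow> xs = [] \<or> h x = hd xs \<and> follows h xs"
  by (auto simp: follows_def successively_Cons)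

lemma follows_append:
  "follows h (xs @ ys) \<longleftrightarrow> follows h xs \<and> follows h ys \<and> (xs = [] \<or> ys = [] \<or> h (last xs) = hd ys)"
  by (auto simp: follows_def successively_append_iff)

lemma follows_map: "follows h xs \<Longrightarrow> xs \<noteq> [] \<Longrightarrow> map h xs = tl xs @ [h (last xs)]"
proof (induction xs)
  case (Cons x xs)
  then show ?case by (cases xs) auto
qed simp

lemma follows_flow_last:
  assumes "follows h xs" "u \<in> set xs" "u \<noteq> last xs"
  shows "last xs \<in> orbit h u"
  using assms
proof (induction xs arbitrary: u)
  case (Cons x xs)
  show ?case
  proof (cases "u = x")
    case True
    with Cons have ne: "xs \<noteq> []" "h x = hd xs" "follows h xs" by (auto simp: follows_Cons)
    show ?thesis
    proof (cases "hd xs = last xs")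
      case True
      then show ?thesis using ne \<open>u = x\<close> by (metis last.simps orbit.base)
    next
      case False
      then have "last xs \<in> orbit h (hd xs)" using Cons.IH[of "hd xs"] ne by auto
      moreover have "hd xs \<in> orbit h x" using ne(2) orbit.base[of h x] by simp
      ultimately have "last xs \<in> orbit h x" by (rule orbit_trans)
      then show ?thesis using ne \<open>u = x\<close> by auto
    qed
  next
    case False
    with Cons show ?thesis by (auto simp: follows_Cons split: if_splits)
  qed
qed simp

lemma follows_flow_hd:
  assumes "follows h xs" "u \<in> set (tl xs)"
  shows "u \<in> orbit h (hd xs)"
  using assms
proof (induction xs arbitrary: u rule: rev_induct)
  case (snoc x xs)
  show ?case
  proof (cases "xs = []")
    case False
    have "x \<in> orbit h (hd xs)"
    proof (cases "tl xs = []")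
      case True
      with False obtain a where "xs = [a]" by (cases xs) auto
      then show ?thesis using snoc.prems orbit.base[of h a]
        by auto
    next
      case tl: False
      then have "last xs \<in> set (tl xs)" by (metis last_in_set last_tl)
      then have "last xs \<in> orbit h (hd xs)"
        using snoc by (auto simp: follows_append)
      then show ?thesis
        using snoc.prems False by (auto simp: follows_append intro: orbit.step)
    qed
    with snoc False show ?thesis by (auto simp: follows_append)
  qed (use snoc in auto)
qed simp

text \<open>Both lists start at the same vertex and move deterministically; being distinct, neither
  can run past the common last vertex and come back to it. This is what lets a path be read off from
  a map in the injectivity proofs.\<close>

lemma follows_unique:
  assumes "follows h xs" "follows h ys" "distinct xs" "distinct ys" "xs \<noteq> []" "ys \<noteq> []"
    and "hd xs = hd ys" "last xs = last ys"
  shows "xs = ys"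
  using assms
proof (induction xs arbitrary: ys)
  case (Cons x xs)
  from Cons.prems obtain ys' where ys: "ys = x # ys'" by (cases ys) auto
  show ?case
  proof (cases "xs = []")
    case True
    then show ?thesis using Cons.prems ys by (auto split: if_splits)
  next
    case False
    then have "ys' \<noteq> []" using Cons.prems ys by (auto split: if_splits)
    then show ?thesis using Cons False ys by (auto simp: follows_Cons)
  qed
qed simp

lemma follows_exists:
  assumes "t = (h ^^ k) u"
  shows "\<exists>xs. xs \<noteq> [] \<and> hd xs = u \<and> last xs = t \<and> distinct xs \<and> follows h xs
           \<and> set xs \<subseteq> insert u (orbit h u)"
  using assms
proof (induction k arbitrary: u)
  case 0
  then show ?case by (intro exI[of _ "[u]"]) auto
next
  case (Suc k)
  then obtain xs where xs: "xs \<noteq> []" "hd xs = h u" "last xs = t" "distinct xs" "follows h xs"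
    "set xs \<subseteq> insert (h u) (orbit h (h u))"
    by (metis comp_apply funpow_Suc_right)
  have sub: "insert (h u) (orbit h (h u)) \<subseteq> orbit h u"
    using orbit.base[of h u] orbit_trans[OF _ orbit.base[of h u]] by blast
  show ?case
  proof (cases "u \<in> set xs")
    case False
    then show ?thesis
      using xs sub by (intro exI[of _ "u # xs"]) (auto simp: follows_Cons)
  next
    \<comment> \<open>A return to \<open>u\<close> is cut off, which keeps the path
      distinct.\<close>
    case True
    then obtain as bs where "xs = as @ u # bs" by (auto simp: in_set_conv_decomp)
    then show ?thesis
      using xs sub by (intro exI[of _ "u # bs"]) (auto simp: follows_append split: if_splits)
  qed
qed

lemma follows_exists_orbit:
  assumes "t \<in> insert u (orbit h u)"
  shows "\<exists>xs. xs \<noteq> [] \<and> hd xs = u \<and> last xs = t \<and> distinct xs \<and> follows h xs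
           \<and> set xs \<subseteq> insert u (orbit h u)"
proof -
  obtain k where "t = (h ^^ k) u"
    using assms by (auto simp: orbit_altdef) (metis funpow_0)
  then show ?thesis by (rule follows_exists)
qed

lemma follows_exists_cycle:
  assumes "x \<in> orbit h x" "h x \<noteq> x"
  shows "\<exists>ys. ys \<noteq> [] \<and> distinct (x # ys) \<and> follows h (x # ys) \<and> h (last ys) = x \<and> set ys \<subseteq> orbit h x"
proof -
  have x: "x \<in> insert (h x) (orbit h (h x))"
    using assms by (metis insertI2 orbit.base orbit_periodic_eq)
  then obtain xs where xs: "xs \<noteq> []" "hd xs = h x" "last xs = x" "distinct xs" "follows h xs"
    "set xs \<subseteq> insert (h x) (orbit h (h x))"
    using follows_exists_orbit[OF x] by blast
  then obtain ys where ys: "xs = ys @ [x]" by (metis append_butlast_last_id)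
  have ne: "ys \<noteq> []"
  proof
    assume "ys = []"
    with ys xs(2) assms(2) show False by simp
  qed
  have fol: "follows h ys" "h (last ys) = x"
    using xs(5)[unfolded ys follows_append] ne by simp_all
  have "distinct (x # ys)" using xs(4) ys by simp
  moreover have "follows h (x # ys)"
    using xs(2) ys ne fol unfolding follows_Cons by simp
  moreover note fol(2)
  moreover have "set ys \<subseteq> orbit h x"
    using xs(6) ys orbit_periodic_eq[OF assms(1) orbit.base] orbit.base[of h x] by auto
  ultimately show ?thesis using ne by blast
qed

text \<open>\<open>asg\<close> lays a path, continued to \<open>b\<close>, into a functional graph;
  \<open>restr\<close> cuts it out again by turning its vertices into fixed points. The counting
  maps of the next two sections are built from this pair.\<close>

fun asg :: "('a \<Rightarrow> 'a) \<Rightarrow> 'a list \<Rightarrow> 'a \<Rightarrow> 'a \<Rightarrow> 'a" where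
  "asg f [] b = f"
| "asg f (x # xs) b = (asg f xs b)(x := hd (xs @ [b]))"

definition restr :: "('a \<Rightarrow> 'a) \<Rightarrow> 'a set \<Rightarrow> 'a \<Rightarrow> 'a" where
  "restr f U = (\<lambda>u. if u \<in> U then f u else u)"

lemma asg_notin: "u \<notin> set xs \<Longrightarrow> asg f xs b u = f u"
  by (induction xs) auto

lemma asg_last: "distinct xs \<Longrightarrow> xs \<noteq> [] \<Longrightarrow> asg f xs b (last xs) = b"
  by (induction xs) auto

lemma follows_cong: "(\<And>x. x \<in> set xs \<Longrightarrow> f x = g x) \<Longrightarrow> follows f xs = follows g xs"
proof (induction xs)
  case (Cons x xs)
  then show ?case by (cases xs) auto
qed simp

lemma follows_asg: "distinct xs \<Longrightarrow> follows (asg f xs b) xs"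
proof (induction xs)
  case (Cons x xs)
  have "follows (asg f (x # xs) b) xs = follows (asg f xs b) xs"
    using Cons.prems by (intro follows_cong) auto
  with Cons have "follows (asg f (x # xs) b) xs" by simp
  moreover have "asg f (x # xs) b x = hd (xs @ [b])" by simp
  ultimately show ?case by (cases xs) (simp_all add: follows_Cons del: asg.simps)
qed simp

lemma asg_reconstruct:
  assumes "follows h xs" "distinct xs" "xs \<noteq> [] \<Longrightarrow> h (last xs) = b" "\<And>u. u \<notin> set xs \<Longrightarrow> f u = h u"
  shows "asg f xs b = h"
  using assms
proof (induction xs arbitrary: f)
  case (Cons x xs)
  have "asg (f(x := h x)) xs b = h"
    using Cons by (intro Cons.IH) (auto simp: follows_Cons)
  moreover have "asg f (x # xs) b = (asg (f(x := h x)) xs b)(x := hd (xs @ [b]))"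
  proof
    fix u
    have "u \<noteq> x \<Longrightarrow> asg f xs b u = asg (f(x := h x)) xs b u" for xs
      by (induction xs) auto
    then show "asg f (x # xs) b u = ((asg (f(x := h x)) xs b)(x := hd (xs @ [b]))) u" by auto
  qed
  moreover have "hd (xs @ [b]) = h x"
    using Cons.prems by (cases xs) auto
  ultimately show ?case by (simp add: fun_eq_iff)
qed auto

text \<open>A directed cycle is given by its set of arcs. Of the two orientations of a cycle of length at least
  three exactly one is selected, whereas cycles of length two are never selected.\<close>

definition arcs :: "('a \<Rightarrow> 'a) \<Rightarrow> 'a \<Rightarrow> ('a \<times> 'a) set" where
  "arcs f x = {(u, f u) | u. u \<in> orbit f x}"

definition sel :: "('a \<times> 'a) set \<Rightarrow> bool" where
  "sel D \<longleftrightarrow> D \<noteq> D\<inverse> \<and> (SOME X. X = D \<or> X = D\<inverse>) = D"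

lemma sel_converse:
  assumes "D \<noteq> D\<inverse>"
  shows "sel (D\<inverse>) \<longleftrightarrow> \<not> sel D"
proof -
  \<comment> \<open>The choice depends on the predicate only, and this is the same for
    \<open>D\<close> and its converse.\<close>
  have eq: "(\<lambda>X. X = D\<inverse> \<or> X = (D\<inverse>)\<inverse>) = (\<lambda>X. X = D \<or> X = D\<inverse>)"
    by auto
  have "(SOME X. X = D \<or> X = D\<inverse>) = D \<or> (SOME X. X = D \<or> X = D\<inverse>) = D\<inverse>"
    by (rule someI[of "\<lambda>X. X = D \<or> X = D\<inverse>" D]) simp
  then show ?thesis
    unfolding sel_def eq using assms by auto
qed

lemma arcs_periodic_eq: "x \<in> orbit f x \<Longrightarrow> y \<in> orbit f x \<Longrightarrow> arcs f y = arcs f x"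
  unfolding arcs_def by (simp only: orbit_periodic_eq[of x f y])

definition carcs :: "'a list \<Rightarrow> ('a \<times> 'a) set" where
  "carcs xs = set (zip xs (rotate1 xs))"

lemma orbit_cycle_list:
  assumes "follows h (x # ys)" "h (last (x # ys)) = x"
  shows "orbit h x = set (x # ys)"
proof
  have map: "map h (x # ys) = ys @ [x]"
    using follows_map[OF assms(1)] assms(2) by simp
  have "h u \<in> set (x # ys)" if "u \<in> set (x # ys)" for u
  proof -
    have "h u \<in> set (map h (x # ys))" using that by auto
    then show ?thesis unfolding map by auto
  qed
  then show "orbit h x \<subseteq> set (x # ys)"
    by (intro orbit_subset_closed) auto
  have "x \<in> orbit h x"
  proof (cases "x = last (x # ys)")
    case True
    then show ?thesis using assms(2) by (metis orbit.base)
  next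
    case False
    then have "last (x # ys) \<in> orbit h x"
      using follows_flow_last[OF assms(1), of x] by auto
    then show ?thesis using assms(2) by (metis orbit.step)
  qed
  moreover have "set ys \<subseteq> orbit h x"
    using follows_flow_hd[OF assms(1)] by auto
  ultimately show "set (x # ys) \<subseteq> orbit h x" by auto
qed

lemma arcs_cycle_list:
  assumes "follows h (x # ys)" "h (last (x # ys)) = x"
  shows "arcs h x = carcs (x # ys)"
proof -
  have "rotate1 (x # ys) = map h (x # ys)"
    using follows_map[OF assms(1)] assms(2) by simp
  then have "carcs (x # ys) = (\<lambda>u. (u, h u)) ` set (x # ys)"
    by (simp only: carcs_def zip_map2 zip_same_conv_map map_map set_map image_image) (auto simp: o_def)
  then show ?thesis
    unfolding arcs_def orbit_cycle_list[OF assms] by auto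
qed

lemma set_zip_swap: "set (zip xs ys) = (set (zip ys xs))\<inverse>"
proof (intro equalityI subrelI)
  fix a b
  show "(a, b) \<in> set (zip xs ys) \<Longrightarrow> (a, b) \<in> (set (zip ys xs))\<inverse>"
    and "(a, b) \<in> (set (zip ys xs))\<inverse> \<Longrightarrow> (a, b) \<in> set (zip xs ys)"
    unfolding converse_iff in_set_zip by auto
qed

text \<open>Keeping \<open>x\<close> in front makes reversal an involution on the lists that
  describe cycles through a fixed vertex.\<close>

lemma carcs_rev: "carcs (x # rev ys) = (carcs (x # ys))\<inverse>"
proof -
  have "zip (x # rev ys) (rotate1 (x # rev ys)) = zip (rev (ys @ [x])) (rev (x # ys))"
    by simp
  also have "\<dots> = rev (zip (ys @ [x]) (x # ys))"
    by (rule zip_rev) simp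
  finally have "carcs (x # rev ys) = set (zip (ys @ [x]) (x # ys))"
    by (simp add: carcs_def)
  also have "\<dots> = (carcs (x # ys))\<inverse>"
    unfolding carcs_def rotate1.simps by (rule set_zip_swap)
  finally show ?thesis .
qed

lemma sel_carcs_2: "\<not> sel (carcs [x, y])"
  by (auto simp: carcs_def sel_def)

lemma sel_carcs_rev:
  assumes "distinct (x # ys)" "2 \<le> length ys"
  shows "sel (carcs (x # rev ys)) \<longleftrightarrow> \<not> sel (carcs (x # ys))"
proof -
  obtain y z zs where ys: "ys = y # z # zs"
    using assms(2) by (metis One_nat_def Suc_1 Suc_le_length_iff)
  have "(x, y) \<in> carcs (x # ys)"
    by (simp add: ys carcs_def)
  \<comment> \<open>The only arc out of \<open>y\<close> leads to \<open>z\<close>, which differs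
    from \<open>x\<close>; this is where at least three vertices are used.\<close>
  moreover have "(y, x) \<notin> carcs (x # ys)"
    using assms(1) by (auto simp: ys carcs_def dest: set_zip_leftD)
  ultimately have "carcs (x # ys) \<noteq> (carcs (x # ys))\<inverse>"
    by (metis converse_iff)
  then show ?thesis unfolding carcs_rev by (rule sel_converse)
qed

section \<open>Counting maps by cutting out paths and cycles\<close>

section \<open>Good functional graphs\<close>

locale ugraph =
  fixes V :: "'a set" and E :: "'a set set"
  assumes simple: "simple_graph V E"
begin

definition nb :: "'a \<Rightarrow> 'a set" where
  "nb x = {y. {x, y} \<in> E}"

text \<open>Fixed points outside \<open>S\<close> make leaving \<open>S\<close> final and give every
  map on \<open>S\<close> exactly one extension to the whole type, so that counting functions counts
  maps.\<close>

definition choices :: "'a set \<Rightarrow> ('a \<Rightarrow> 'a) set" where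
  "choices S = {f. (\<forall>v\<in>S. f v \<in> nb v) \<and> (\<forall>v. v \<notin> S \<longrightarrow> f v = v)}"

definition goods :: "'a set \<Rightarrow> ('a \<Rightarrow> 'a) set" where
  "goods S = {f \<in> choices S. \<forall>x\<in>S. x \<in> orbit f x \<longrightarrow> sel (arcs f x)}"

definition num :: "'a set \<Rightarrow> nat" where
  "num S = card (goods S)"

text \<open>Waiving the condition for the cycle through \<open>x\<close> leaves the value at
  \<open>x\<close> free, so these maps number \<open>card (nb x) * num (S - {x})\<close>. Their
  excess over \<open>num S\<close> is a sum over cycles through \<open>x\<close>.\<close>

definition goods_except :: "'a set \<Rightarrow> 'a \<Rightarrow> ('a \<Rightarrow> 'a) set" where
  "goods_except S x = {f \<in> choices S. \<forall>z\<in>S. z \<in> orbit f z \<longrightarrow> x \<notin> orbit f z \<longrightarrow> sel (arcs f z)}"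

definition walk :: "'a list \<Rightarrow> bool" where
  "walk xs \<longleftrightarrow> successively (\<lambda>x y. y \<in> nb x) xs"

lemma finite_V: "finite V" and edge_card: "e \<in> E \<Longrightarrow> card e = 2" and edge_subset: "e \<in> E \<Longrightarrow> e \<subseteq> V"
  using simple by (auto simp: simple_graph_def)

lemma nb_sym: "y \<in> nb x \<longleftrightarrow> x \<in> nb y"
  by (auto simp: nb_def insert_commute)

lemma nb_irrefl: "x \<notin> nb x"
  using edge_card by (fastforce simp: nb_def)

lemma nb_subset: "nb x \<subseteq> V"
  using edge_subset by (auto simp: nb_def)

lemma finite_nb [simp]: "finite (nb x)"
  using nb_subset finite_V finite_subset by blast

lemma walk_simps [simp]: "walk []" "walk [x]" "walk (x # y # xs) \<longleftrightarrow> y \<in> nb x \<and> walk (y # xs)"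
  by (auto simp: walk_def)

lemma walk_Cons: "walk (x # xs) \<longleftrightarrow> xs = [] \<or> hd xs \<in> nb x \<and> walk xs"
  by (auto simp: walk_def successively_Cons)

lemma walk_append:
  "walk (xs @ ys) \<longleftrightarrow> walk xs \<and> walk ys \<and> (xs = [] \<or> ys = [] \<or> hd ys \<in> nb (last xs))"
  by (auto simp: walk_def successively_append_iff)

lemma walk_rev: "walk (rev xs) \<longleftrightarrow> walk xs"
  by (simp add: walk_def nb_sym)

lemma choicesD: "f \<in> choices S \<Longrightarrow> v \<in> S \<Longrightarrow> f v \<in> nb v" "f \<in> choices S \<Longrightarrow> v \<notin> S \<Longrightarrow> f v = v"
  by (auto simp: choices_def)

lemma finite_choices:
  assumes "S \<subseteq> V" shows "finite (choices S)"
proof -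
  have "choices S \<subseteq> (\<lambda>g x. if x \<in> S then g x else x) ` (S \<rightarrow>\<^sub>E V)"
  proof
    fix f assume f: "f \<in> choices S"
    then have "restrict f S \<in> S \<rightarrow>\<^sub>E V" using nb_subset by (auto simp: choices_def)
    moreover have "f = (\<lambda>x. if x \<in> S then restrict f S x else x)" using f by (auto simp: choices_def)
    ultimately show "f \<in> (\<lambda>g x. if x \<in> S then g x else x) ` (S \<rightarrow>\<^sub>E V)" by blast
  qed
  moreover have "finite (S \<rightarrow>\<^sub>E V)"
    using assms finite_V by (intro finite_PiE) (auto intro: finite_subset)
  ultimately show ?thesis by (rule finite_surj[rotated])
qed

lemma finite_goods: "S \<subseteq> V \<Longrightarrow> finite (goods S)"
  and finite_goods_except: "S \<subseteq> V \<Longrightarrow> finite (goods_except S x)"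
  using finite_choices by (auto simp: goods_def goods_except_def)

lemma orbit_choices_subset:
  assumes "f \<in> choices S" "x \<in> S" "x \<in> orbit f x"
  shows "orbit f x \<subseteq> S"
proof
  fix z assume z: "z \<in> orbit f x"
  show "z \<in> S"
  proof (rule ccontr)
    assume "z \<notin> S"
    then have "orbit f z = {z}"
      using assms(1) by (intro orbit_fixpoint) (auto simp: choices_def)
    moreover have "orbit f z = orbit f x"
      using assms(3) z by (rule orbit_periodic_eq)
    ultimately show False using assms \<open>z \<notin> S\<close> by auto
  qed
qed

lemma goods_eq: "goods S = {f \<in> goods_except S x. x \<in> S \<longrightarrow> x \<in> orbit f x \<longrightarrow> sel (arcs f x)}"
proof -
  have "sel (arcs f z)" if "f \<in> choices S" "x \<in> S \<longrightarrow> x \<in> orbit f x \<longrightarrow> sel (arcs f x)"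
    "z \<in> S" "z \<in> orbit f z" "x \<in> orbit f z" for f z
    using that arcs_periodic_eq[of z f x] orbit_periodic_eq[of z f x] orbit_choices_subset[of f S z] by auto
  then show ?thesis by (auto simp: goods_def goods_except_def)
qed

lemma asg_choices:
  assumes "f \<in> choices U" "distinct xs" "walk xs" "set xs \<inter> U = {}" "xs \<noteq> [] \<Longrightarrow> b \<in> nb (last xs)"
  shows "asg f xs b \<in> choices (U \<union> set xs)"
  using assms
proof (induction xs)
  case (Cons x xs)
  have "asg f xs b \<in> choices (U \<union> set xs)"
    using Cons by (cases "xs = []") (auto simp: walk_Cons)
  moreover have "hd (xs @ [b]) \<in> nb x"
    using Cons.prems by (cases xs) auto
  ultimately show ?case by (auto simp: choices_def)
qed simp

lemma restr_asg:
  assumes "f \<in> choices U" "set xs \<inter> U = {}"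
  shows "restr (asg f xs b) U = f"
proof
  fix u show "restr (asg f xs b) U u = f u"
    using assms asg_notin[of u xs f b] by (auto simp: restr_def choices_def)
qed

lemma asg_restr:
  assumes "h \<in> choices S" "follows h xs" "distinct xs" "xs \<noteq> []" "h (last xs) = b"
  shows "asg (restr h (S - set xs)) xs b = h"
  using assms by (intro asg_reconstruct) (auto simp: restr_def choices_def)

lemma follows_walk:
  assumes "h \<in> choices S" "follows h xs" "set xs \<subseteq> S"
  shows "walk xs"
  using assms(2,3)
proof (induction xs)
  case (Cons x xs)
  then show ?case using assms(1) by (cases xs) (auto simp: choices_def)
qed simp

text \<open>Every vertex of the path flows to its last vertex, so a cycle of the extended map which
  meets the path passes through its last vertex.\<close>

lemma asg_goods_except:
  assumes f: "f \<in> goods U" and xs: "distinct xs" "walk xs" "set xs \<inter> U = {}" "xs \<noteq> []"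
    and b: "b \<in> nb (last xs)"
  shows "asg f xs b \<in> goods_except (U \<union> set xs) (last xs)"
proof -
  let ?h = "asg f xs b"
  have ch: "?h \<in> choices (U \<union> set xs)"
    using assms by (intro asg_choices) (auto simp: goods_def)
  have "sel (arcs ?h z)"
    if z: "z \<in> U \<union> set xs" "z \<in> orbit ?h z" "last xs \<notin> orbit ?h z" for z
  proof -
    have disj: "orbit ?h z \<inter> set xs = {}"
    proof (rule ccontr)
      assume "orbit ?h z \<inter> set xs \<noteq> {}"
      then obtain u where u: "u \<in> orbit ?h z" "u \<in> set xs" by auto
      then have "last xs \<in> orbit ?h u"
        using z(3) follows_flow_last[OF follows_asg[OF xs(1)]] by blast
      then show False using u z(3) orbit_trans by metis
    qed
    have eq: "f y = ?h y" if "y \<in> orbit ?h z" for y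
    proof -
      have "y \<notin> set xs" using that disj by blast
      then show ?thesis by (simp add: asg_notin)
    qed
    have orb: "orbit ?h z = orbit f z"
      using z(2) by (intro orbit_cong_closed[where A = "orbit ?h z"] orbit.step) (auto simp: eq)
    have "arcs ?h z = arcs f z"
      using eq by (auto simp: arcs_def orb)
    moreover have "z \<in> U" using z disj by auto
    ultimately show ?thesis using f z(2) by (auto simp: goods_def orb)
  qed
  with ch show ?thesis by (auto simp: goods_except_def)
qed

text \<open>A cycle of the restriction stays inside \<open>S - W\<close>; it is therefore a cycle of
  \<open>h\<close> that avoids \<open>x\<close>, the only place where \<open>h\<close> may
  fail.\<close>

lemma restr_goods:
  assumes h: "h \<in> goods_except S x" and x: "x \<in> W"
  shows "restr h (S - W) \<in> goods (S - W)"
proof -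
  let ?f = "restr h (S - W)"
  have ch: "?f \<in> choices (S - W)"
    using h by (auto simp: goods_except_def choices_def restr_def)
  have "sel (arcs ?f z)" if z: "z \<in> S - W" "z \<in> orbit ?f z" for z
  proof -
    have sub: "orbit ?f z \<subseteq> S - W"
      using ch z by (rule orbit_choices_subset)
    have eq: "?f y = h y" if "y \<in> orbit ?f z" for y
      using that sub by (auto simp: restr_def)
    have orb: "orbit ?f z = orbit h z"
      using z(2) eq by (intro orbit_cong_closed[where A = "orbit ?f z"] orbit.step)
    have "arcs ?f z = arcs h z"
      using eq by (auto simp: arcs_def orb)
    moreover have "x \<notin> orbit h z" using sub x by (auto simp: orb)
    ultimately show ?thesis
      using h z orb by (auto simp: goods_except_def)
  qed
  with ch show ?thesis by (auto simp: goods_def)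
qed

text \<open>Cut along \<open>xs\<close> and record the free value at its end. The exception has to
  sit at \<open>last xs\<close>, because every cycle that meets the path runs to its end.\<close>

lemma bij_asg:
  assumes "distinct xs" "walk xs" "xs \<noteq> []" "set xs \<subseteq> S"
  shows "bij_betw (\<lambda>(f, y). asg f xs y) (goods (S - set xs) \<times> nb (last xs))
           {h \<in> goods_except S (last xs). follows h xs}"
proof (rule bij_betw_byWitness[where f' = "\<lambda>h. (restr h (S - set xs), h (last xs))"])
  have S: "S - set xs \<union> set xs = S" using assms by auto
  show "\<forall>a\<in>goods (S - set xs) \<times> nb (last xs).
      (restr (case a of (f, y) \<Rightarrow> asg f xs y) (S - set xs), (case a of (f, y) \<Rightarrow> asg f xs y) (last xs)) = a"
    using assms by (auto simp: restr_asg goods_def asg_last)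
  show "\<forall>h\<in>{h \<in> goods_except S (last xs). follows h xs}.
      (case (restr h (S - set xs), h (last xs)) of (f, y) \<Rightarrow> asg f xs y) = h"
    using assms by (auto simp: goods_except_def intro!: asg_restr)
  show "(\<lambda>(f, y). asg f xs y) ` (goods (S - set xs) \<times> nb (last xs))
      \<subseteq> {h \<in> goods_except S (last xs). follows h xs}"
    using assms S asg_goods_except[of _ "S - set xs" xs] by (auto simp: follows_asg)
  show "(\<lambda>h. (restr h (S - set xs), h (last xs))) ` {h \<in> goods_except S (last xs). follows h xs}
      \<subseteq> goods (S - set xs) \<times> nb (last xs)"
    using assms restr_goods[of _ S "last xs" "set xs"] last_in_set[of xs]
    by (auto simp: goods_except_def choices_def subset_iff)
qed

lemma card_goods_except:
  assumes "x \<in> S"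
  shows "card (goods_except S x) = card (nb x) * num (S - {x})"
  using bij_betw_same_card[OF bij_asg[of "[x]" S]] assms
  by (simp add: card_cartesian_product num_def mult.commute)

definition cyc :: "'a set \<Rightarrow> 'a \<Rightarrow> 'a list set" where
  "cyc S x = {ys. ys \<noteq> [] \<and> distinct (x # ys) \<and> set ys \<subseteq> S \<and> walk (x # ys) \<and> x \<in> nb (last ys)}"

lemma finite_cyc: "S \<subseteq> V \<Longrightarrow> finite (cyc S x)"
  using finite_subset_distinct[of S] finite_V
  by (auto simp: cyc_def dest: finite_subset intro: finite_subset[OF _ finite_subset_distinct[of S]])

lemma follows_asg_cyc:
  assumes "ys \<in> cyc (S - {x}) x"
  shows "follows (asg f (x # ys) x) (x # ys)" "asg f (x # ys) x (last (x # ys)) = x"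
  using assms follows_asg[of "x # ys" f x] asg_last[of "x # ys" f x]
  by (auto simp: cyc_def simp del: asg.simps)

lemma bij_cyc:
  assumes x: "x \<in> S"
  shows "bij_betw (\<lambda>(ys, f). asg f (x # ys) x) (SIGMA ys:cyc (S - {x}) x. goods (S - {x} - set ys))
           {h \<in> goods_except S x. x \<in> orbit h x}"
    (is "bij_betw ?m ?A ?B")
proof -
  note fol = follows_asg_cyc[where S = S and x = x]
  have inj: "inj_on ?m ?A"
  proof (rule inj_onI, clarify)
    fix ys f ys' f'
    assume ys: "ys \<in> cyc (S - {x}) x" "ys' \<in> cyc (S - {x}) x"
      and f: "f \<in> goods (S - {x} - set ys)" "f' \<in> goods (S - {x} - set ys')"
      and eq: "asg f (x # ys) x = asg f' (x # ys') x"
    let ?h = "asg f (x # ys) x"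
    \<comment> \<open>Continuing up to the second visit of \<open>x\<close> turns the cycle into a
      path from \<open>?h x\<close> to \<open>x\<close>, and such a path is unique.\<close>
    have "follows ?h (x # ys @ [x])" "follows ?h (x # ys' @ [x])"
      using fol[OF ys(1), of f] fol[OF ys(2), of f'] ys unfolding eq
      by (auto simp: follows_Cons follows_append cyc_def simp del: asg.simps)
    then have "follows ?h (ys @ [x])" "follows ?h (ys' @ [x])" "hd (ys @ [x]) = hd (ys' @ [x])"
      by (auto simp: follows_Cons simp del: asg.simps)
    then have "ys @ [x] = ys' @ [x]"
      using ys by (intro follows_unique[of ?h]) (auto simp: cyc_def simp del: asg.simps)
    then have "ys = ys'" by simp
    moreover have "f = f'"
    proof -
      have 1: "f = restr ?h (S - {x} - set ys)"
        using f by (intro restr_asg[symmetric]) (auto simp: goods_def)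
      have 2: "f' = restr (asg f' (x # ys') x) (S - {x} - set ys')"
        using f by (intro restr_asg[symmetric]) (auto simp: goods_def)
      have "f = restr (asg f' (x # ys') x) (S - {x} - set ys)"
        using 1 unfolding eq .
      also have "\<dots> = f'" using 2 unfolding \<open>ys = ys'\<close> by (rule sym)
      finally show ?thesis .
    qed
    ultimately show "ys = ys' \<and> f = f'" by simp
  qed
  have "?m ` ?A \<subseteq> ?B"
  proof clarify
    fix ys f assume ys: "ys \<in> cyc (S - {x}) x" and f: "f \<in> goods (S - {x} - set ys)"
    let ?h = "asg f (x # ys) x"
    have S: "S - {x} - set ys \<union> set (x # ys) = S" using ys x by (auto simp: cyc_def)
    have 1: "?h \<in> goods_except S (last (x # ys))"
      using asg_goods_except[OF f, of "x # ys" x] ys S by (auto simp: cyc_def simp del: asg.simps)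
    have orb: "orbit ?h x = set (x # ys)"
      using orbit_cycle_list[OF fol[OF ys, of f]] .
    \<comment> \<open>\<open>x\<close> and the last vertex lie on the same cycle, so the exception
      may be moved from one to the other.\<close>
    have "last (x # ys) \<in> orbit ?h z \<Longrightarrow> x \<in> orbit ?h z" for z
      using orbit.step[of "last (x # ys)" ?h z] fol(2)[OF ys, of f] by (simp del: asg.simps)
    then have "?h \<in> goods_except S x"
      using 1 by (auto simp: goods_except_def simp del: asg.simps)
    with orb show "?h \<in> goods_except S x \<and> x \<in> orbit ?h x" by (simp del: asg.simps)
  qed
  moreover have "?B \<subseteq> ?m ` ?A"
  proof clarify
    fix h assume h: "h \<in> goods_except S x" "x \<in> orbit h x"
    then have ch: "h \<in> choices S" by (auto simp: goods_except_def)
    have "h x \<noteq> x" using ch x nb_irrefl by (auto simp: choices_def)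
    then obtain ys where ys: "ys \<noteq> []" "distinct (x # ys)" "follows h (x # ys)" "h (last ys) = x"
      "set ys \<subseteq> orbit h x"
      using follows_exists_cycle[OF h(2)] by blast
    have sub: "set ys \<subseteq> S" using ys(5) orbit_choices_subset[OF ch x h(2)] by auto
    have "walk (x # ys)" using sub x by (intro follows_walk[OF ch ys(3)]) auto
    moreover have "h (last ys) \<in> nb (last ys)"
      using sub ys(1) ch last_in_set[of ys] unfolding choices_def by blast
    ultimately have "ys \<in> cyc (S - {x}) x" using ys sub by (auto simp: cyc_def)
    moreover have D: "S - set (x # ys) = S - {x} - set ys" by auto
    have "restr h (S - {x} - set ys) \<in> goods (S - {x} - set ys)"
      using restr_goods[OF h(1), of "set (x # ys)"] unfolding D by simp
    moreover have "asg (restr h (S - {x} - set ys)) (x # ys) x = h"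
      using asg_restr[OF ch ys(3,2), of x] ys(1,4) unfolding D by (simp del: asg.simps)
    ultimately show "h \<in> ?m ` ?A"
      by (intro image_eqI[where x = "(ys, restr h (S - {x} - set ys))"]) simp_all
  qed
  ultimately show ?thesis using inj by (auto simp: bij_betw_def)
qed

lemma arcs_asg_cyc:
  assumes "ys \<in> cyc (S - {x}) x"
  shows "arcs (asg f (x # ys) x) x = carcs (x # ys)"
  using follows_asg_cyc[OF assms] by (intro arcs_cycle_list)

text \<open>\<open>bij_cyc\<close> sorted by the cycle through \<open>x\<close>. As \<open>P\<close>
  is an arbitrary property of the arc set, the same sum serves for selected, unselected and long
  cycles.\<close>

lemma card_cyc_filter:
  assumes x: "x \<in> S" and S: "S \<subseteq> V"
  shows "card {h \<in> goods_except S x. x \<in> orbit h x \<and> P (arcs h x)}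
    = (\<Sum>ys | ys \<in> cyc (S - {x}) x \<and> P (carcs (x # ys)). num (S - {x} - set ys))"
proof -
  let ?C = "{ys \<in> cyc (S - {x}) x. P (carcs (x # ys))}"
  let ?A = "SIGMA ys:cyc (S - {x}) x. goods (S - {x} - set ys)"
  let ?A' = "SIGMA ys:?C. goods (S - {x} - set ys)"
  let ?m = "\<lambda>(ys, f). asg f (x # ys) x"
  have "?m ` ?A' = {h \<in> goods_except S x. x \<in> orbit h x \<and> P (arcs h x)}"
  proof -
    have "?A' = {a \<in> ?A. P (arcs (?m a) x)}"
      by (auto simp: arcs_asg_cyc[of _ S] simp del: asg.simps)
    then have "?m ` ?A' = {h \<in> ?m ` ?A. P (arcs h x)}" by auto
    then show ?thesis using bij_cyc[OF x] by (auto simp: bij_betw_def)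
  qed
  moreover have "inj_on ?m ?A'"
    using bij_cyc[OF x] by (auto simp: bij_betw_def intro: inj_on_subset)
  then have "card (?m ` ?A') = card ?A'" by (rule card_image)
  ultimately have "card {h \<in> goods_except S x. x \<in> orbit h x \<and> P (arcs h x)} = card ?A'"
    by (simp only:)
  also have "\<dots> = (\<Sum>ys\<in>?C. num (S - {x} - set ys))"
  proof (subst card_SigmaI)
    show "finite ?C" using finite_cyc[OF subset_trans[OF Diff_subset S], of "{x}" x] by simp
  qed (use S in \<open>auto simp: num_def intro!: finite_goods\<close>)
  finally show ?thesis by simp
qed

text \<open>Reversal keeps the vertex set, hence the number of good maps on the rest, and exchanges
  selected and unselected cycles.\<close>

lemma long_cycles_rev:
  assumes "S \<subseteq> V"
  shows "(\<Sum>ys | ys \<in> cyc S x \<and> 2 \<le> length ys \<and> sel (carcs (x # ys)). num (S - set ys))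
    = (\<Sum>ys | ys \<in> cyc S x \<and> 2 \<le> length ys \<and> \<not> sel (carcs (x # ys)). num (S - set ys))"
proof (rule sum.reindex_bij_witness[where i = rev and j = rev])
  have rev_cyc: "rev ys \<in> cyc S x" if "ys \<in> cyc S x" for ys
  proof -
    have "walk (rev ys)" using that walk_rev[of ys] by (auto simp: cyc_def walk_Cons)
    with that show ?thesis by (auto simp: cyc_def walk_Cons hd_rev last_rev nb_sym)
  qed
  fix ys
  assume "ys \<in> {ys. ys \<in> cyc S x \<and> 2 \<le> length ys \<and> sel (carcs (x # ys))}"
  then show "rev ys \<in> {ys. ys \<in> cyc S x \<and> 2 \<le> length ys \<and> \<not> sel (carcs (x # ys))}"
    using rev_cyc sel_carcs_rev[of x ys] by (auto simp: cyc_def)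
next
  have rev_cyc: "rev ys \<in> cyc S x" if "ys \<in> cyc S x" for ys
  proof -
    have "walk (rev ys)" using that walk_rev[of ys] by (auto simp: cyc_def walk_Cons)
    with that show ?thesis by (auto simp: cyc_def walk_Cons hd_rev last_rev nb_sym)
  qed
  fix ys
  assume "ys \<in> {ys. ys \<in> cyc S x \<and> 2 \<le> length ys \<and> \<not> sel (carcs (x # ys))}"
  then show "rev ys \<in> {ys. ys \<in> cyc S x \<and> 2 \<le> length ys \<and> sel (carcs (x # ys))}"
    using rev_cyc sel_carcs_rev[of x ys] by (auto simp: cyc_def)
qed auto

lemma carcs_asym:
  assumes "distinct (x # ys)" "2 \<le> length ys"
  shows "carcs (x # ys) \<noteq> (carcs (x # ys))\<inverse>"
proof
  assume eq: "carcs (x # ys) = (carcs (x # ys))\<inverse>"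
  have "carcs (x # rev ys) = carcs (x # ys)" using eq by (simp add: carcs_rev)
  with sel_carcs_rev[OF assms] show False by simp
qed

lemma cyc_length: "ys \<in> cyc S x \<Longrightarrow> length ys = 1 \<or> 2 \<le> length ys"
  by (cases ys) (auto simp: cyc_def Suc_le_eq)

lemma sel_carcs_1: "length ys = 1 \<Longrightarrow> \<not> sel (carcs (x # ys)) \<and> carcs (x # ys) = (carcs (x # ys))\<inverse>"
  using carcs_rev[of x ys] by (cases ys) (auto simp: sel_carcs_2)

text \<open>The maps that fail exactly at \<open>x\<close> have through \<open>x\<close> a two-cycle
  or an unselected long cycle. By reversal the latter are half of all long cycles, whence the weight
  1/2. The coin of the walk reproduces this weight, and the identity becomes its flow equation in
  \<open>walk_step_inflow\<close>.\<close>

lemma balance: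
  assumes x: "x \<in> S" and S: "S \<subseteq> V"
  shows "real (card (nb x)) * num (S - {x}) = num S
    + (\<Sum>ys\<in>cyc (S - {x}) x. (if 2 \<le> length ys then 1/2 else 1) * real (num (S - {x} - set ys)))"
proof -
  let ?n = "\<lambda>ys. num (S - {x} - set ys)"
  let ?C = "cyc (S - {x}) x"
  let ?s = "\<lambda>ys. sel (carcs (x # ys))"
  have fin: "finite ?C" using S by (intro finite_cyc) auto
  have "goods_except S x = goods S \<union> {h \<in> goods_except S x. x \<in> orbit h x \<and> \<not> sel (arcs h x)}"
    unfolding goods_eq[of S x] using x by auto
  moreover have "goods S \<inter> {h \<in> goods_except S x. x \<in> orbit h x \<and> \<not> sel (arcs h x)} = {}"
    unfolding goods_eq[of S x] using x by auto
  ultimately have "card (goods_except S x)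
      = num S + card {h \<in> goods_except S x. x \<in> orbit h x \<and> \<not> sel (arcs h x)}"
    unfolding num_def using S finite_goods finite_goods_except
    by (metis (no_types, lifting) card_Un_disjoint finite_Un)
  then have 1: "card (nb x) * num (S - {x}) = num S + (\<Sum>ys | ys \<in> ?C \<and> \<not> ?s ys. ?n ys)"
    unfolding card_goods_except[OF x] card_cyc_filter[OF x S, of "\<lambda>D. \<not> sel D"] .
  have "(\<Sum>ys\<in>?C. (if 2 \<le> length ys then 1/2 else 1) * real (?n ys))
      = (\<Sum>ys\<in>?C. (if 2 \<le> length ys \<and> ?s ys then real (?n ys) else 0) / 2
        + (if 2 \<le> length ys \<and> \<not> ?s ys then real (?n ys) else 0) / 2
        + (if length ys = 1 then real (?n ys) else 0))"
    by (rule sum.cong) (auto dest!: cyc_length)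
  also have "\<dots> = (\<Sum>ys | ys \<in> ?C \<and> 2 \<le> length ys \<and> ?s ys. real (?n ys)) / 2
        + (\<Sum>ys | ys \<in> ?C \<and> 2 \<le> length ys \<and> \<not> ?s ys. real (?n ys)) / 2
        + (\<Sum>ys | ys \<in> ?C \<and> length ys = 1. real (?n ys))"
    using fin by (simp add: sum.distrib sum.inter_filter sum_divide_distrib)
  also have "(\<Sum>ys | ys \<in> ?C \<and> 2 \<le> length ys \<and> ?s ys. real (?n ys))
      = (\<Sum>ys | ys \<in> ?C \<and> 2 \<le> length ys \<and> \<not> ?s ys. real (?n ys))"
    using long_cycles_rev[OF subset_trans[OF Diff_subset S], of "{x}" x] by (simp only: of_nat_sum[symmetric])
  finally have 2: "(\<Sum>ys\<in>?C. (if 2 \<le> length ys then 1/2 else 1) * real (?n ys))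
      = (\<Sum>ys | ys \<in> ?C \<and> 2 \<le> length ys \<and> \<not> ?s ys. real (?n ys))
      + (\<Sum>ys | ys \<in> ?C \<and> length ys = 1. real (?n ys))"
    by simp
  have "(\<Sum>ys | ys \<in> ?C \<and> \<not> ?s ys. real (?n ys))
      = (\<Sum>ys\<in>{ys. ys \<in> ?C \<and> 2 \<le> length ys \<and> \<not> ?s ys} \<union> {ys. ys \<in> ?C \<and> length ys = 1}. real (?n ys))"
    by (rule sum.cong) (auto dest: cyc_length simp: sel_carcs_1[THEN conjunct1])
  also have "\<dots> = (\<Sum>ys | ys \<in> ?C \<and> 2 \<le> length ys \<and> \<not> ?s ys. real (?n ys))
      + (\<Sum>ys | ys \<in> ?C \<and> length ys = 1. real (?n ys))"
    using fin by (intro sum.union_disjoint) auto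
  finally show ?thesis using arg_cong[OF 1, of real] 2 by simp
qed

text \<open>Reversing the unselected cycle through \<open>x\<close> makes the map good. The
  condition \<open>h (h x) \<noteq> x\<close> excludes two-cycles, which reversal leaves as they
  are.\<close>

lemma card_long_bad_le:
  assumes x: "x \<in> S" and S: "S \<subseteq> V"
  shows "card {h \<in> goods_except S x. x \<in> orbit h x \<and> \<not> sel (arcs h x) \<and> h (h x) \<noteq> x} \<le> num S"
proof -
  let ?C = "cyc (S - {x}) x"
  let ?n = "\<lambda>ys. num (S - {x} - set ys)"
  \<comment> \<open>Long cycles are recognised by the asymmetry of their arc set, which makes them
    accessible to \<open>card_cyc_filter\<close>.\<close>
  have asym: "ys \<in> ?C \<and> carcs (x # ys) \<noteq> (carcs (x # ys))\<inverse> \<longleftrightarrow> ys \<in> ?C \<and> 2 \<le> length ys" for ys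
  proof (cases "ys \<in> ?C")
    case True
    then have "distinct (x # ys)" by (auto simp: cyc_def)
    with True show ?thesis
      using carcs_asym[of x ys] sel_carcs_1[of ys x] cyc_length[OF True] by linarith
  qed simp
  have "{h \<in> goods_except S x. x \<in> orbit h x \<and> \<not> sel (arcs h x) \<and> h (h x) \<noteq> x}
      \<subseteq> {h \<in> goods_except S x. x \<in> orbit h x \<and> (arcs h x \<noteq> (arcs h x)\<inverse> \<and> \<not> sel (arcs h x))}"
  proof clarify
    fix h assume "x \<in> orbit h x" "h (h x) \<noteq> x" and eq: "arcs h x = (arcs h x)\<inverse>"
    then have "(x, h x) \<in> arcs h x" by (auto simp: arcs_def)
    then have "(h x, x) \<in> arcs h x" using eq by (metis converse_iff)
    then show False using \<open>h (h x) \<noteq> x\<close> by (auto simp: arcs_def)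
  qed
  then have "card {h \<in> goods_except S x. x \<in> orbit h x \<and> \<not> sel (arcs h x) \<and> h (h x) \<noteq> x}
      \<le> card {h \<in> goods_except S x. x \<in> orbit h x \<and> (arcs h x \<noteq> (arcs h x)\<inverse> \<and> \<not> sel (arcs h x))}"
    by (rule card_mono[rotated]) (use finite_goods_except[OF S] in auto)
  also have "\<dots> = (\<Sum>ys | ys \<in> ?C \<and> 2 \<le> length ys \<and> \<not> sel (carcs (x # ys)). ?n ys)"
    unfolding card_cyc_filter[OF x S, of "\<lambda>D. D \<noteq> D\<inverse> \<and> \<not> sel D"]
    by (rule sum.cong[OF _ refl]) (use asym in blast)
  also have "\<dots> = (\<Sum>ys | ys \<in> ?C \<and> 2 \<le> length ys \<and> sel (carcs (x # ys)). ?n ys)"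
    by (rule long_cycles_rev[OF subset_trans[OF Diff_subset S], symmetric])
  also have "\<dots> = card {h \<in> goods_except S x. x \<in> orbit h x \<and> (arcs h x \<noteq> (arcs h x)\<inverse> \<and> sel (arcs h x))}"
    unfolding card_cyc_filter[OF x S, of "\<lambda>D. D \<noteq> D\<inverse> \<and> sel D"]
    by (rule sum.cong[OF _ refl]) (use asym in blast)
  also have "\<dots> \<le> num S"
    unfolding num_def by (rule card_mono) (use finite_goods[OF S] goods_eq[of S x] in auto)
  finally show ?thesis .
qed

end

section \<open>Bounding the number of maps with a two-cycle\<close>

section \<open>Rerooting\<close>

context ugraph
begin

definition paths :: "'a set \<Rightarrow> 'a \<Rightarrow> 'a list set" where
  "paths S v = {xs. xs \<noteq> [] \<and> hd xs = v \<and> distinct xs \<and> set xs \<subseteq> S \<and> walk xs}"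

text \<open>Divided by \<open>num S\<close>, this will bound the expected number of moves of the
  walk from \<open>v\<close> until it succeeds; the summand of \<open>xs\<close> accounts for the
  visits to the path \<open>xs\<close>.\<close>

definition step_sum :: "'a set \<Rightarrow> 'a \<Rightarrow> nat" where
  "step_sum S v = (\<Sum>xs\<in>paths S v. card (nb (last xs)) * num (S - set xs))"

definition long_bad :: "'a set \<Rightarrow> 'a \<Rightarrow> ('a \<Rightarrow> 'a) set" where
  "long_bad S x = {h \<in> goods_except S x. x \<in> orbit h x \<and> \<not> sel (arcs h x) \<and> h (h x) \<noteq> x}"

definition two_bad :: "'a set \<Rightarrow> 'a \<Rightarrow> ('a \<Rightarrow> 'a) set" where
  "two_bad S x = {h \<in> goods_except S x. h (h x) = x}"

lemma finite_paths: "S \<subseteq> V \<Longrightarrow> finite (paths S v)"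
  by (rule finite_subset[OF _ finite_subset_distinct[of S]])
     (auto simp: paths_def intro: finite_subset[OF _ finite_V])

lemma orbit_two:
  assumes "h (h x) = x"
  shows "orbit h x = {x, h x}"
proof
  show "orbit h x \<subseteq> {x, h x}"
    using assms by (intro orbit_subset_closed) auto
  show "{x, h x} \<subseteq> orbit h x"
    using orbit.base[of h x] orbit.step[of "h x" h x] assms by auto
qed

lemma two_bad_not_sel: "h (h x) = x \<Longrightarrow> \<not> sel (arcs h x)"
  by (auto simp: arcs_def orbit_two sel_def)

lemma goods_except_cases:
  assumes "h \<in> goods_except S x" "x \<in> S"
  shows "h \<in> goods S \<or> h \<in> long_bad S x \<or> h \<in> two_bad S x"
  using assms unfolding goods_eq[of S x] by (auto simp: long_bad_def two_bad_def)

text \<open>A path, a good map off the path and a free value at its end together form a map whose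
  exceptional vertex is the end of the path. The path is recovered as the unique path of the map
  from \<open>v\<close> to that vertex, so nothing is counted twice.\<close>

lemma step_sum_le_card:
  assumes S: "S \<subseteq> V"
  shows "step_sum S v \<le> card (SIGMA x:S. {h \<in> goods_except S x. x \<in> insert v (orbit h v)})"
proof -
  let ?A = "SIGMA xs:paths S v. goods (S - set xs) \<times> nb (last xs)"
  let ?m = "\<lambda>(xs, f, y). (last xs, asg f xs y)"
  let ?B = "SIGMA x:S. {h \<in> goods_except S x. x \<in> insert v (orbit h v)}"
  have "step_sum S v = card ?A"
    unfolding step_sum_def using finite_paths[OF S] S
    by (subst card_SigmaI) (auto simp: num_def card_cartesian_product mult.commute intro!: finite_goods)
  also have "\<dots> \<le> card ?B"
  proof (rule card_inj_on_le)
    show "inj_on ?m ?A"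
    proof (rule inj_onI)
      fix p p' assume p: "p \<in> ?A" "p' \<in> ?A" and m: "?m p = ?m p'"
      obtain xs f y where p1: "p = (xs, f, y)" by (cases p)
      obtain xs' f' y' where p2: "p' = (xs', f', y')" by (cases p')
      have xs: "xs \<in> paths S v" "xs' \<in> paths S v"
        and f: "f \<in> goods (S - set xs)" "f' \<in> goods (S - set xs')"
        and y: "y \<in> nb (last xs)" "y' \<in> nb (last xs')"
        using p unfolding p1 p2 by simp_all
      have eq: "last xs = last xs'" "asg f xs y = asg f' xs' y'"
        using m unfolding p1 p2 by simp_all
      have "follows (asg f xs y) xs" "follows (asg f xs y) xs'"
        using xs follows_asg[of xs f y] follows_asg[of xs' f' y'] eq(2) by (auto simp: paths_def)
      then have xx: "xs' = xs"
        using xs eq(1) by (intro follows_unique) (auto simp: paths_def)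
      have "inj_on (\<lambda>(f, y). asg f xs y) (goods (S - set xs) \<times> nb (last xs))"
        using bij_asg[of xs S] xs by (auto simp: paths_def bij_betw_def)
      moreover have "(\<lambda>(f, y). asg f xs y) (f, y) = (\<lambda>(f, y). asg f xs y) (f', y')"
        using eq(2) unfolding xx by simp
      moreover have "(f, y) \<in> goods (S - set xs) \<times> nb (last xs)"
        "(f', y') \<in> goods (S - set xs) \<times> nb (last xs)"
        using f y unfolding xx by simp_all
      ultimately have "(f, y) = (f', y')" by (rule inj_onD)
      then show "p = p'" using xx p1 p2 by simp
    qed
    show "?m ` ?A \<subseteq> ?B"
    proof (rule image_subsetI)
      fix p assume p: "p \<in> ?A"
      obtain xs f y where p1: "p = (xs, f, y)" by (cases p)
      have xs: "xs \<in> paths S v" and f: "f \<in> goods (S - set xs)" and y: "y \<in> nb (last xs)"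
        using p unfolding p1 by simp_all
      have U: "S - set xs \<union> set xs = S" using xs by (auto simp: paths_def)
      have "asg f xs y \<in> goods_except S (last xs)"
        using asg_goods_except[OF f, of xs y] xs y U by (auto simp: paths_def)
      moreover have "last xs \<in> insert v (orbit (asg f xs y) v)"
      proof (cases "v = last xs")
        case False
        have "distinct xs" "v \<in> set xs" using xs by (auto simp: paths_def)
        then show ?thesis using follows_flow_last[OF follows_asg[of xs f y], of v] False by simp
      qed simp
      moreover have "last xs \<in> S" using xs last_in_set[of xs] by (auto simp: paths_def)
      ultimately show "?m p \<in> ?B" unfolding p1 by simp
    qed
    show "finite ?B"
      using S finite_V by (intro finite_SigmaI) (auto intro: finite_subset finite_goods_except)
  qed
  finally show ?thesis .
qed

text \<open>A two-cycle is never selected and a map in \<open>goods_except\<close> may have only one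
  unselected cycle, so both exceptional vertices lie on the same two-cycle.\<close>

lemma two_bad_unique:
  assumes "h \<in> two_bad S x" "h \<in> two_bad S x'" "x \<in> S" "x' \<in> S"
  shows "x' \<in> {x, h x}"
proof -
  have orb: "orbit h x' = {x', h x'}" "x' \<in> orbit h x'"
    using assms orbit_two[of h x'] by (auto simp: two_bad_def)
  then have "x \<in> orbit h x'"
    using assms two_bad_not_sel[of h x'] by (auto simp: two_bad_def goods_except_def)
  then show ?thesis using orb assms by (auto simp: two_bad_def)
qed

text \<open>Pairs of an exceptional vertex and a map are of three kinds: good maps; maps with a long
  unselected cycle, at most \<open>num S\<close> for each vertex by reversal; and maps with a
  two-cycle, each paired with at most two vertices. Only the third kind calls for the separate bound
  \<open>B\<close>.\<close>

lemma step_sum_le: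
  assumes S: "S \<subseteq> V"
    and W: "card {h. \<exists>x\<in>S. h \<in> two_bad S x \<and> x \<in> insert v (orbit h v)} \<le> B"
  shows "step_sum S v \<le> 2 * card S * num S + 2 * B"
proof -
  let ?W = "{h. \<exists>x\<in>S. h \<in> two_bad S x \<and> x \<in> insert v (orbit h v)}"
  let ?T = "SIGMA x:S. {h \<in> two_bad S x. x \<in> insert v (orbit h v)}"
  have finS: "finite S" using S finite_V by (rule finite_subset)
  have finT: "finite ?T"
    using finS S by (intro finite_SigmaI) (auto simp: two_bad_def intro!: finite_goods_except)
  have W_eq: "?W = snd ` ?T" by (force simp: image_iff)
  have finW: "finite ?W" unfolding W_eq using finT by (rule finite_imageI)
  have "(SIGMA x:S. {h \<in> goods_except S x. x \<in> insert v (orbit h v)})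
      \<subseteq> (S \<times> goods S) \<union> (SIGMA x:S. long_bad S x) \<union> ?T"
    using goods_except_cases by auto
  then have "step_sum S v \<le> card ((S \<times> goods S) \<union> (SIGMA x:S. long_bad S x) \<union> ?T)"
    using step_sum_le_card[OF S, of v] finS finT S finite_goods finite_goods_except
    by (elim order_trans[OF _ card_mono[rotated]])
       (auto simp: long_bad_def intro!: finite_SigmaI)
  also have "\<dots> \<le> card (S \<times> goods S) + card (SIGMA x:S. long_bad S x) + card ?T"
    by (intro order_trans[OF card_Un_le] add_right_mono card_Un_le)
  also have "card (S \<times> goods S) = card S * num S"
    by (simp add: card_cartesian_product num_def)
  also have "card (SIGMA x:S. long_bad S x) \<le> card S * num S"
  proof -
    have "card (SIGMA x:S. long_bad S x) = (\<Sum>x\<in>S. card (long_bad S x))"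
      using finS S finite_goods_except by (intro card_SigmaI) (auto simp: long_bad_def)
    also have "\<dots> \<le> (\<Sum>x\<in>S. num S)"
      using card_long_bad_le S by (intro sum_mono) (auto simp: long_bad_def)
    finally show ?thesis by simp
  qed
  also have "card ?T \<le> 2 * card ?W"
  proof -
    have "\<exists>g. \<forall>h\<in>?W. g h \<in> S \<and> h \<in> two_bad S (g h)"
      by (intro bchoice) auto
    then obtain g where g: "\<forall>h\<in>?W. g h \<in> S \<and> h \<in> two_bad S (g h)" by blast
    have "card ?T = card (prod.swap ` ?T)"
      by (rule card_image[symmetric]) (auto intro: inj_onI)
    also have "\<dots> \<le> card (SIGMA h:?W. {g h, h (g h)})"
    proof (rule card_mono)
      show "finite (SIGMA h:?W. {g h, h (g h)})" using finW by auto
      show "prod.swap ` ?T \<subseteq> (SIGMA h:?W. {g h, h (g h)})"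
      proof (rule subsetI)
        fix p assume "p \<in> prod.swap ` ?T"
        then obtain x h where p: "p = (h, x)" "x \<in> S" "h \<in> two_bad S x" "x \<in> insert v (orbit h v)"
          by auto
        then have "h \<in> ?W" by blast
        moreover have "x \<in> {g h, h (g h)}"
          using two_bad_unique[of h S "g h" x] p g \<open>h \<in> ?W\<close> by blast
        ultimately show "p \<in> (SIGMA h:?W. {g h, h (g h)})" unfolding p(1) by (simp only: mem_Sigma_iff)
      qed
    qed
    also have "\<dots> = (\<Sum>h\<in>?W. card {g h, h (g h)})"
      using finW by (intro card_SigmaI) auto
    also have "\<dots> \<le> (\<Sum>h\<in>?W. 2)"
      by (intro sum_mono) (simp add: card_insert_if)
    finally show ?thesis by simp
  qed
  finally show ?thesis using W by simp
qed

text \<open>\<open>h\<close> runs along \<open>xs\<close> to \<open>last xs\<close>, from there to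
  \<open>y\<close> and back. Cutting out \<open>xs\<close> leaves \<open>f\<close>, where the
  two-cycle is broken because \<open>f y\<close> is now outside the domain; \<open>xs\<close> can
  then be laid in again in the opposite direction, behind \<open>y\<close>.\<close>

definition rerooted :: "'a set \<Rightarrow> ('a \<Rightarrow> 'a) \<Rightarrow> ('a \<Rightarrow> 'a) \<Rightarrow> 'a list \<Rightarrow> 'a \<Rightarrow> bool" where
  "rerooted S h f xs y \<longleftrightarrow> xs \<noteq> [] \<and> distinct xs \<and> walk xs \<and> set xs \<subseteq> S \<and> y \<in> S - set xs
     \<and> f \<in> goods (S - set xs) \<and> f y = last xs \<and> h = asg f xs y \<and> follows h xs"

lemma rerooted_exists:
  assumes h: "h \<in> two_bad S x" and x: "x \<in> S" and a: "a \<in> S" "x \<in> insert a (orbit h a)"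
  shows "\<exists>f xs y. rerooted S h f xs y \<and> hd xs = a"
proof -
  have ch: "h \<in> choices S" and hx: "h (h x) = x" "h \<in> goods_except S x"
    using h by (auto simp: two_bad_def goods_except_def)
  have hx': "h \<in> goods_except S (h x)"
    using hx orbit.step[of x h] by (auto simp: goods_except_def)
  have "h x \<in> S" "h x \<noteq> x"
  proof -
    show "h x \<noteq> x" using ch x nb_irrefl by (auto simp: choices_def)
    then show "h x \<in> S" using ch hx(1) choicesD(2)[OF ch] by metis
  qed
  obtain xs where xs: "xs \<noteq> []" "hd xs = a" "last xs = x" "distinct xs" "follows h xs"
    "set xs \<subseteq> insert a (orbit h a)"
    using follows_exists_orbit[OF a(2)] by blast
  have subS: "set xs \<subseteq> S"
  proof (rule ccontr)
    assume "\<not> set xs \<subseteq> S"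
    then obtain u where u: "u \<in> set xs" "u \<notin> S" by auto
    then have "x \<in> orbit h u" using follows_flow_last[OF xs(5), of u] xs(3) x by auto
    moreover have "orbit h u = {u}" using choicesD(2)[OF ch u(2)] by (rule orbit_fixpoint)
    ultimately show False using u x by auto
  qed
  have key: "\<exists>f xs y. rerooted S h f xs y \<and> hd xs = a"
    if xs: "xs \<noteq> []" "hd xs = a" "distinct xs" "follows h xs" "set xs \<subseteq> S" "h (last xs) = y"
      "h y = last xs" "y \<notin> set xs" "y \<in> S" "h \<in> goods_except S (last xs)" for xs y
  proof -
    let ?f = "restr h (S - set xs)"
    have "walk xs" using follows_walk[OF ch xs(4,5)] .
    moreover have "?f \<in> goods (S - set xs)"
      using restr_goods[OF xs(10), of "set xs"] xs(1) by simp
    moreover have "?f y = last xs" using xs by (simp add: restr_def)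
    moreover have "h = asg ?f xs y" using asg_restr[OF ch xs(4,3,1,6)] by simp
    ultimately have "rerooted S h ?f xs y"
      using xs unfolding rerooted_def by blast
    then show ?thesis using xs(2) by blast
  qed
  show ?thesis
  proof (cases "h x \<in> set xs")
    case False
    then show ?thesis
      using xs subS hx \<open>h x \<in> S\<close> by (intro key[of xs "h x"]) auto
  next
    \<comment> \<open>The path enters the two-cycle at \<open>h x\<close>. It is stopped there, and
      \<open>x\<close> becomes the vertex of the two-cycle off the path.\<close>
    case True
    then obtain as bs where s: "xs = as @ h x # bs" by (auto simp: in_set_conv_decomp)
    have "bs \<noteq> []" using s xs(3) \<open>h x \<noteq> x\<close> by auto
    moreover from this have "hd bs = x" using xs(5) s hx(1) by (auto simp: follows_append follows_Cons)
    ultimately obtain cs where "bs = x # cs" by (cases bs) auto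
    with s xs(3,4) have s: "xs = as @ [h x, x]" by (auto split: if_splits)
    have "hd (as @ [h x]) = a" using s xs(2) by (cases as) auto
    then show ?thesis
      using s xs subS hx hx' x by (intro key[of "as @ [h x]" x]) (auto simp: follows_append)
  qed
qed

text \<open>\<open>h\<close> is recovered from \<open>g = asg f (rev xs) b\<close>, the vertex
  \<open>a = hd xs\<close> and \<open>y\<close>: the reversed path is the unique path of
  \<open>g\<close> from \<open>g y\<close> to \<open>a\<close>, cutting it out gives
  \<open>f\<close>, and laying it in forwards gives \<open>h\<close>. The three factors count
  \<open>a\<close>, \<open>y\<close> and \<open>g\<close>.\<close>

lemma rerooted_count:
  assumes S: "S \<subseteq> V" and A: "A \<subseteq> S"
    and W: "\<And>h. h \<in> W \<Longrightarrow> \<exists>f xs y b. rerooted S h f xs y \<and> hd xs \<in> A \<and> asg f (rev xs) b \<in> G (hd xs)"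
    and G: "\<And>a. a \<in> A \<Longrightarrow> finite (G a)" "\<And>a. a \<in> A \<Longrightarrow> card (G a) \<le> c"
  shows "card W \<le> card A * card S * c"
proof -
  have finS: "finite S" "finite A" using S A finite_V by (auto dest: finite_subset)
  have "\<forall>h\<in>W. \<exists>q. case q of (f, xs, y, b) \<Rightarrow> rerooted S h f xs y \<and> hd xs \<in> A \<and> asg f (rev xs) b \<in> G (hd xs)"
    using W by fast
  then obtain q where q: "\<forall>h\<in>W. case q h of (f, xs, y, b) \<Rightarrow>
      rerooted S h f xs y \<and> hd xs \<in> A \<and> asg f (rev xs) b \<in> G (hd xs)"
    by (rule bchoice[THEN exE])
  let ?m = "\<lambda>h. case q h of (f, xs, y, b) \<Rightarrow> (hd xs, asg f (rev xs) b, y)"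
  let ?B = "SIGMA a:A. G a \<times> S"
  have "card W \<le> card ?B"
  proof (rule card_inj_on_le)
    show "finite ?B" using finS G by auto
    show "?m ` W \<subseteq> ?B" using q by (fastforce simp: rerooted_def split: prod.splits)
    show "inj_on ?m W"
    proof (rule inj_onI)
      fix h h' assume h: "h \<in> W" "h' \<in> W" and eq: "?m h = ?m h'"
      obtain f xs y b where q1: "q h = (f, xs, y, b)" by (cases "q h")
      obtain f' xs' y' b' where q2: "q h' = (f', xs', y', b')" by (cases "q h'")
      have r: "rerooted S h f xs y" "rerooted S h' f' xs' y'"
        using q h q1 q2 by auto
      let ?g = "asg f (rev xs) b"
      have e: "hd xs = hd xs'" "?g = asg f' (rev xs') b'" "y = y'"
        using eq q1 q2 by auto
      have "?g y = last xs" "?g y = last xs'"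
        using r e asg_notin[of y "rev xs" f b] asg_notin[of y "rev xs'" f' b']
        by (auto simp: rerooted_def)
      then have l: "last xs = last xs'" by simp
      have "follows ?g (rev xs)"
        using r by (intro follows_asg) (auto simp: rerooted_def)
      moreover have "follows ?g (rev xs')"
        unfolding e(2) using r by (intro follows_asg) (auto simp: rerooted_def)
      ultimately have "rev xs = rev xs'"
        using r l e(1) by (rule_tac follows_unique) (auto simp: rerooted_def hd_rev last_rev)
      then have xx: "xs = xs'" by simp
      have "restr ?g (S - set xs) = f"
        using r by (intro restr_asg) (auto simp: rerooted_def goods_def)
      moreover have "restr (asg f' (rev xs') b') (S - set xs') = f'"
        using r by (intro restr_asg) (auto simp: rerooted_def goods_def)
      ultimately have "f = f'" using xx e(2) by metis
      then show "h = h'" using r xx e(3) by (auto simp: rerooted_def)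
    qed
  qed
  also have "\<dots> = (\<Sum>a\<in>A. card (G a) * card S)"
    using finS G by (subst card_SigmaI) (auto simp: card_cartesian_product)
  also have "\<dots> \<le> (\<Sum>a\<in>A. c * card S)"
    using G by (intro sum_mono mult_right_mono) auto
  finally show ?thesis by (simp add: mult.commute mult.left_commute)
qed

lemma rerooted_goods_except:
  assumes r: "rerooted S h f xs y" and b: "b \<in> nb (hd xs)"
  shows "asg f (rev xs) b \<in> goods_except S (hd xs)"
proof -
  have "S - set xs \<union> set xs = S" using r by (auto simp: rerooted_def)
  then show ?thesis
    using asg_goods_except[of f "S - set xs" "rev xs" b] r b
    by (auto simp: rerooted_def walk_rev last_rev)
qed

text \<open>A vertex whose image leaves \<open>S\<close> lies on no cycle, so the exception granted
  to it is empty.\<close>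

lemma exit_goods:
  assumes h: "h \<in> goods_except S v" and "h v \<notin> S"
  shows "h \<in> goods S"
proof -
  have ch: "h \<in> choices S" using h by (auto simp: goods_except_def)
  have "v \<notin> orbit h v" if "v \<in> S"
    using orbit_choices_subset[OF ch that] orbit.base[of h v] assms(2) by auto
  then show ?thesis using h unfolding goods_eq[of S v] by auto
qed

text \<open>After the reversal \<open>v\<close> is sent out of \<open>S\<close> to \<open>b\<close>,
  so no new cycle arises and the result is good. With \<open>v\<close> fixed only \<open>y\<close>
  is lost, and \<open>B = card S * num S\<close> turns the bound of \<open>step_sum_le\<close> into
  the factor 4.\<close>

lemma step_sum_root:
  assumes S: "S \<subseteq> V" and v: "v \<in> S" and b: "b \<in> nb v" "b \<notin> S"
  shows "step_sum S v \<le> 4 * card S * num S"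
proof -
  have "card {h. \<exists>x\<in>S. h \<in> two_bad S x \<and> x \<in> insert v (orbit h v)} \<le> card {v} * card S * num S"
  proof (rule rerooted_count[where G = "\<lambda>_. goods S"])
    fix h assume "h \<in> {h. \<exists>x\<in>S. h \<in> two_bad S x \<and> x \<in> insert v (orbit h v)}"
    then obtain f xs y where r: "rerooted S h f xs y" "hd xs = v"
      using rerooted_exists v by blast
    have "asg f (rev xs) b v = b"
      using r asg_last[of "rev xs" f b] by (auto simp: rerooted_def last_rev)
    then have "asg f (rev xs) b \<in> goods S"
      using rerooted_goods_except[OF r(1), of b] r b by (intro exit_goods[of _ S v]) auto
    then show "\<exists>f xs y b. rerooted S h f xs y \<and> hd xs \<in> {v} \<and> asg f (rev xs) b \<in> goods S"
      using r by blast
  qed (use S v in \<open>auto simp: num_def intro: finite_goods\<close>)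
  from step_sum_le[OF S this] show ?thesis by simp
qed

lemma connected_exit:
  assumes con: "connected_graph V E" and S: "S \<subseteq> V" "S \<noteq> {}" "S \<noteq> V"
  shows "\<exists>v\<in>S. \<exists>b\<in>nb v. b \<notin> S"
proof (rule ccontr)
  assume no: "\<not> ?thesis"
  obtain u t where ut: "u \<in> S" "t \<in> V" "t \<notin> S" using S by blast
  then have "(u, t) \<in> {(x, y). {x, y} \<in> E}\<^sup>*"
    using con S by (auto simp: connected_graph_def reach_def)
  then have "t \<in> S"
    by induction (use ut no in \<open>auto simp: nb_def\<close>)
  with ut show False by simp
qed

lemma free_edge:
  assumes con: "connected_graph V E" and E: "card V \<le> card E"
    and h: "h \<in> choices V" "h (h x) = x" and x: "x \<in> V"
  shows "\<exists>a\<in>V. \<exists>b\<in>nb a. x \<in> insert a (orbit h a) \<and> (\<forall>u\<in>V. {u, h u} \<noteq> {a, b})"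
proof -
  let ?K = "{a \<in> V. x \<in> insert a (orbit h a)}"
  have hxV: "h x \<in> V" using h x nb_subset by (auto simp: choices_def)
  have hx: "h x \<noteq> x" using h x nb_irrefl by (auto simp: choices_def)
  have unfold: "orbit h a = insert (h a) (orbit h (h a))" for a
  proof
    show "orbit h a \<subseteq> insert (h a) (orbit h (h a))"
      by (rule orbit_subset_closed) (auto intro: orbit.intros)
    show "insert (h a) (orbit h (h a)) \<subseteq> orbit h a"
      using orbit.base[of h a] orbit_trans[OF _ orbit.base[of h a]] by blast
  qed
  show ?thesis
  proof (cases "?K = V")
    case True
    let ?R = "(\<lambda>u. {u, h u}) ` V"
    have R: "?R = (\<lambda>u. {u, h u}) ` (V - {x})"
    proof
      show "?R \<subseteq> (\<lambda>u. {u, h u}) ` (V - {x})"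
      proof clarify
        fix u assume u: "u \<in> V"
        show "{u, h u} \<in> (\<lambda>u. {u, h u}) ` (V - {x})"
        proof (cases "u = x")
          case True
          have "{x, h x} = (\<lambda>u. {u, h u}) (h x)" using h(2) by auto
          then show ?thesis using True hx hxV by blast
        qed (use u in auto)
      qed
    qed auto
    have "card ?R \<le> card (V - {x})"
      using finite_V by (subst R) (intro card_image_le finite_Diff)
    also have "\<dots> < card V" using x finite_V by (rule card_Diff1_less[rotated])
    finally have lt: "card ?R < card E" using E by simp
    have "?R \<subseteq> E" using h(1) by (auto simp: choices_def nb_def)
    moreover have "?R \<noteq> E" using lt by (rule contrapos_pn) simp
    ultimately have "?R \<subset> E" by (rule psubsetI)
    from psubset_imp_ex_mem[OF this] obtain e where "e \<in> E - ?R" ..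
    then have e: "e \<in> E" "e \<notin> ?R" unfolding Diff_iff by blast+
    then obtain a b where ab: "e = {a, b}" using edge_card[of e] by (auto simp: card_2_iff)
    have "a \<in> V" "b \<in> nb a" using ab e edge_subset by (auto simp: nb_def)
    moreover have "x \<in> insert a (orbit h a)" using True \<open>a \<in> V\<close> by auto
    moreover have "\<forall>u\<in>V. {u, h u} \<noteq> {a, b}"
    proof (intro ballI notI)
      fix u assume u: "u \<in> V" and eq: "{u, h u} = {a, b}"
      have "{u, h u} \<in> ?R" using u by (rule imageI)
      then have "e \<in> ?R" unfolding eq ab .
      with e(2) show False by contradiction
    qed
    ultimately show ?thesis by (intro bexI[of _ a] bexI[of _ b] conjI)
  next
    case False
    have "?K \<noteq> {}" using x by blast
    then obtain a b where ab: "a \<in> ?K" "b \<in> nb a" "b \<notin> ?K"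
      using connected_exit[OF con _ _ False] by blast
    have "b \<in> V" using ab nb_subset by auto
    have "{u, h u} \<noteq> {a, b}" for u
    proof
      assume "{u, h u} = {a, b}"
      then consider "h a = b" | "h b = a" by (auto simp: doubleton_eq_iff)
      then show False
      proof cases
        case 1
        then have "x \<in> insert b (orbit h b)"
          using ab(1) unfold[of a] unfold[of "h x"] h(2) by auto
        then show False using ab \<open>b \<in> V\<close> by auto
      next
        case 2
        then show False using ab \<open>b \<in> V\<close> unfold[of b] by auto
      qed
    qed
    moreover have "a \<in> V" "x \<in> insert a (orbit h a)" using ab by blast+
    ultimately show ?thesis using ab(2) by (intro bexI[of _ a] bexI[of _ b] conjI ballI)
  qed
qed

text \<open>The free edge from \<open>a\<close> to \<open>b\<close> takes the place of an exit. It
  may close a new cycle through \<open>a\<close>, but not one of length two, since the other arc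
  would show that \<open>h\<close> had used this edge. So the result is good or fails only by a long
  cycle.\<close>

lemma reroot_full:
  assumes con: "connected_graph V E" and E: "card V \<le> card E" and h: "h \<in> two_bad V x" and x: "x \<in> V"
  shows "\<exists>f xs y b. rerooted V h f xs y \<and> hd xs \<in> V \<and> asg f (rev xs) b \<in> goods V \<union> long_bad V (hd xs)"
proof -
  have ch: "h \<in> choices V" "h (h x) = x" using h by (auto simp: two_bad_def goods_except_def)
  obtain a b where ab: "a \<in> V" "b \<in> nb a" "x \<in> insert a (orbit h a)" "\<And>u. u \<in> V \<Longrightarrow> {u, h u} \<noteq> {a, b}"
    using free_edge[OF con E ch x] by blast
  obtain f xs y where r: "rerooted V h f xs y" "hd xs = a"
    using rerooted_exists[OF h x ab(1,3)] by blast
  let ?g = "asg f (rev xs) b"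
  have ge: "?g \<in> goods_except V a"
    using rerooted_goods_except[OF r(1)] r(2) ab by auto
  have ga: "?g a = b"
    using r asg_last[of "rev xs" f b] by (auto simp: rerooted_def last_rev)
  have "b \<noteq> a" using ab nb_irrefl by auto
  have "?g b \<noteq> a"
  proof
    assume gb: "?g b = a"
    have bV: "b \<in> V" using ab nb_subset by auto
    show False
    proof (cases "b \<in> set xs")
      \<comment> \<open>The reversed path sends \<open>b\<close> to its predecessor \<open>p\<close>
        on \<open>xs\<close>. If \<open>p = a\<close>, then \<open>h a = b\<close>, contrary to the
        choice of the edge.\<close>
      case True
      then obtain as bs where s: "xs = as @ b # bs" by (auto simp: in_set_conv_decomp)
      have "as \<noteq> []" using s r(2) \<open>b \<noteq> a\<close> by auto
      then obtain cs p where as: "as = cs @ [p]" by (metis append_butlast_last_id)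
      have "follows ?g (rev xs)" using r by (intro follows_asg) (auto simp: rerooted_def)
      then have "?g b = p" unfolding s as by (auto simp: follows_append)
      moreover have "h p = b" using r unfolding s as by (auto simp: rerooted_def follows_append)
      moreover have "p \<in> V" using r unfolding s as by (auto simp: rerooted_def)
      ultimately show False using gb ab(4)[of p] by auto
    next
      case False
      then have "?g b = f b" "h b = f b"
        using asg_notin[of b "rev xs" f b] asg_notin[of b xs f y] r by (auto simp: rerooted_def)
      then show False using gb ab(4)[OF bV] by auto
    qed
  qed
  then have "?g \<notin> two_bad V a" using ga by (auto simp: two_bad_def)
  then have "?g \<in> goods V \<union> long_bad V a"
    using goods_except_cases[OF ge ab(1)] by auto
  then show ?thesis using r ab by blast
qed

text \<open>Here the first vertex \<open>a\<close> of the path is lost together with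
  \<open>y\<close>, and the rerooted map may have a long unselected cycle, which doubles the count:
  \<open>B = 2 * card V ^ 2 * num V\<close>. The linear term of \<open>step_sum_le\<close> is
  absorbed, giving 2 + 4 = 6.\<close>

lemma step_sum_full:
  assumes con: "connected_graph V E" and E: "card V \<le> card E"
  shows "step_sum V v \<le> 6 * card V ^ 2 * num V"
proof -
  have "card {h. \<exists>x\<in>V. h \<in> two_bad V x \<and> x \<in> insert v (orbit h v)} \<le> card V * card V * (2 * num V)"
  proof (rule rerooted_count[where G = "\<lambda>a. goods V \<union> long_bad V a"])
    fix h assume "h \<in> {h. \<exists>x\<in>V. h \<in> two_bad V x \<and> x \<in> insert v (orbit h v)}"
    then show "\<exists>f xs y b. rerooted V h f xs y \<and> hd xs \<in> V \<and> asg f (rev xs) b \<in> goods V \<union> long_bad V (hd xs)"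
      using reroot_full[OF con E] by blast
  next
    fix a assume a: "a \<in> V"
    show "finite (goods V \<union> long_bad V a)"
      using finite_goods finite_goods_except by (auto simp: long_bad_def)
    show "card (goods V \<union> long_bad V a) \<le> 2 * num V"
      using card_Un_le[of "goods V" "long_bad V a"] card_long_bad_le[OF a order_refl]
      by (simp add: num_def long_bad_def)
  qed auto
  from step_sum_le[OF order_refl this]
  have "step_sum V v \<le> 2 * card V * num V + 4 * card V ^ 2 * num V"
    by (simp add: power2_eq_square mult.assoc)
  also have "\<dots> \<le> 2 * card V ^ 2 * num V + 4 * card V ^ 2 * num V"
    by (intro add_right_mono mult_right_mono mult_left_mono) (auto simp: power2_eq_square)
  finally show ?thesis by (simp add: mult.commute mult.left_commute)
qed

lemma num_empty: "num {} = 1"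
proof -
  have "goods {} = {\<lambda>v. v}" by (auto simp: goods_def choices_def)
  then show ?thesis by (simp add: num_def)
qed

lemma num_pos_iff: "S \<subseteq> V \<Longrightarrow> 0 < num S \<longleftrightarrow> goods S \<noteq> {}"
  using finite_goods by (simp add: num_def card_gt_0_iff)

lemma num_pos_proper:
  assumes con: "connected_graph V E" and S: "S \<subset> V"
  shows "0 < num S"
  using S
proof (induction "card S" arbitrary: S rule: less_induct)
  case less
  show ?case
  proof (cases "S = {}")
    case False
    then obtain v b where vb: "v \<in> S" "b \<in> nb v" "b \<notin> S"
      using connected_exit[OF con, of S] less.prems by blast
    have "finite S" using less.prems finite_V by (auto dest: finite_subset)
    then have "0 < num (S - {v})"
      using vb less.prems card_Diff1_less[of S v] by (intro less.hyps) blast+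
    moreover have "S - {v} \<subseteq> V" using less.prems by auto
    ultimately obtain f where f: "f \<in> goods (S - {v})" using num_pos_iff by blast
    have "insert v S = S" using vb by auto
    then have "asg f [v] b \<in> goods_except S v"
      using asg_goods_except[OF f, of "[v]" b] vb by simp
    then have "asg f [v] b \<in> goods S" using vb by (intro exit_goods[of _ S v]) auto
    then show ?thesis using less.prems num_pos_iff by blast
  qed (simp add: num_empty)
qed

text \<open>For \<open>S = V\<close>, a good map off one vertex \<open>v\<close> is extended by any
  edge at \<open>v\<close>. The result is good, or has a long unselected cycle and can be reversed,
  or has a two-cycle and can be rerooted; in each case \<open>num V\<close> is positive.\<close>

lemma num_pos:
  assumes con: "connected_graph V E" and E: "card V \<le> card E" and S: "S \<subseteq> V"
  shows "0 < num S"
proof (cases "S = V")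
  case True
  have long: "0 < num V" if "h \<in> goods V \<union> long_bad V a" "a \<in> V" for h a
  proof (cases "h \<in> goods V")
    case False
    then have "0 < card (long_bad V a)"
      using that finite_goods_except[of V a] by (auto simp: card_gt_0_iff long_bad_def)
    then show ?thesis using card_long_bad_le[OF that(2) order_refl] by (simp add: long_bad_def)
  qed (use num_pos_iff in blast)
  have "V \<noteq> {}" using con by (auto simp: connected_graph_def)
  then have "card V > 0" using finite_V by (simp add: card_gt_0_iff)
  then have "card E > 0" using E by simp
  then obtain e where "e \<in> E" by (auto simp: card_gt_0_iff)
  then obtain v y where vy: "e = {v, y}" using edge_card[OF \<open>e \<in> E\<close>] by (auto simp: card_2_iff)
  then have v: "v \<in> V" "y \<in> nb v" using \<open>e \<in> E\<close> edge_subset by (auto simp: nb_def)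
  obtain f where f: "f \<in> goods (V - {v})"
    using num_pos_proper[OF con, of "V - {v}"] num_pos_iff[of "V - {v}"] v by blast
  have "insert v V = V" using v by auto
  then have "asg f [v] y \<in> goods_except V v"
    using asg_goods_except[OF f, of "[v]" y] v by simp
  from goods_except_cases[OF this v(1)] show ?thesis
  proof (elim disjE)
    assume "asg f [v] y \<in> two_bad V v"
    from reroot_full[OF con E this v(1)] show ?thesis using long True by blast
  qed (use long v True in blast)+
qed (use num_pos_proper[OF con] S in blast)

end

section \<open>Bijection between good maps and bases\<close>

section \<open>Bases of the bicircular matroid and good functional graphs\<close>

definition cedges :: "'a list \<Rightarrow> 'a set set" where
  "cedges xs = (\<lambda>(x, y). {x, y}) ` carcs xs"

lemma is_cycle_iff: "is_cycle C \<longleftrightarrow> (\<exists>x ys. distinct (x # ys) \<and> 2 \<le> length ys \<and> C = cedges (x # ys))"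
proof -
  have eq: "{{vs ! i, vs ! (Suc i mod length vs)} | i. i < length vs} = cedges vs" for vs :: "'a list"
  proof -
    have "zip vs (rotate1 vs) = map (\<lambda>i. (vs ! i, vs ! (Suc i mod length vs))) [0..<length vs]"
      by (rule nth_equalityI) (auto simp: nth_rotate1)
    then have "cedges vs = (\<lambda>i. {vs ! i, vs ! (Suc i mod length vs)}) ` {0..<length vs}"
      by (simp add: cedges_def carcs_def image_image)
    then show ?thesis by auto
  qed
  show ?thesis
  proof
    assume "is_cycle C"
    then obtain vs where vs: "distinct vs" "3 \<le> length vs" "C = cedges vs"
      unfolding is_cycle_def eq by blast
    then show "\<exists>x ys. distinct (x # ys) \<and> 2 \<le> length ys \<and> C = cedges (x # ys)"
      by (cases vs) auto
  next
    assume "\<exists>x ys. distinct (x # ys) \<and> 2 \<le> length ys \<and> C = cedges (x # ys)"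
    then obtain x ys where "distinct (x # ys)" "2 \<le> length ys" "C = cedges (x # ys)" by blast
    then show "is_cycle C"
      unfolding is_cycle_def eq by (intro exI[of _ "x # ys"]) auto
  qed
qed

lemma cedges_rev: "cedges (x # rev ys) = cedges (x # ys)"
  unfolding cedges_def carcs_rev by (force simp: image_iff insert_commute)

lemma Union_cedges: "\<Union> (cedges xs) = set xs"
proof -
  have "\<Union> (cedges xs) = fst ` set (zip xs (rotate1 xs)) \<union> snd ` set (zip xs (rotate1 xs))"
    by (force simp: cedges_def carcs_def)
  also have "\<dots> = set xs"
    by (simp flip: set_map)
  finally show ?thesis .
qed

lemma cedges_closed: "cedges (x # ys) = {{a, b} | a b. (a, b) \<in> set (zip (x # ys) (ys @ [x]))}"
  by (auto simp: cedges_def carcs_def image_def)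

lemma cedges_follows:
  assumes "follows h (x # ys)" "h (last (x # ys)) = x"
  shows "cedges (x # ys) = (\<lambda>u. {u, h u}) ` orbit h x"
  unfolding cedges_def arcs_cycle_list[OF assms, symmetric] by (auto simp: arcs_def image_def)

text \<open>If \<open>b\<close> is sent back to \<open>a\<close>, it is not sent on to
  \<open>c \<noteq> a\<close>, so the next edge is used by \<open>c\<close>. In this way the
  direction of the first edge spreads along the list.\<close>

lemma backward_propagates:
  assumes "successively (\<lambda>a b. g a = b \<or> g b = a) zs" "\<And>i. Suc (Suc i) < length zs \<Longrightarrow> zs ! i \<noteq> zs ! Suc (Suc i)"
    and "zs = a # b # rest" "g b = a"
  shows "successively (\<lambda>a b. g b = a) zs"
  using assms
proof (induction zs arbitrary: a b rest)
  case (Cons z zs)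
  show ?case
  proof (cases rest)
    case Nil
    then show ?thesis using Cons.prems by simp
  next
    case (Cons c rest')
    have "a \<noteq> c" using Cons.prems(2)[of 0] Cons.prems(3) Cons by simp
    then have "g c = b" using Cons.prems Cons by auto
    have "successively (\<lambda>a b. g b = a) zs"
    proof (rule Cons.IH)
      show "zs ! i \<noteq> zs ! Suc (Suc i)" if "Suc (Suc i) < length zs" for i
        using Cons.prems(2)[of "Suc i"] that by simp
      show "zs = b # c # rest'" using Cons.prems(3) Cons by simp
    qed (use Cons.prems Cons \<open>g c = b\<close> in auto)
    then show ?thesis using Cons.prems Cons by auto
  qed
qed simp

lemma closed_nth_distinct:
  assumes "distinct (x # ys)" "2 \<le> length ys" "Suc (Suc i) < length (x # ys @ [x])"
  shows "(x # ys @ [x]) ! i \<noteq> (x # ys @ [x]) ! Suc (Suc i)"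
proof -
  have 1: "(x # ys @ [x]) ! i = (x # ys) ! i"
    using assms(3) by (cases i) (auto simp: nth_append)
  show ?thesis
  proof (cases "Suc i = length ys")
    \<comment> \<open>The entry two places ahead is the closing \<open>x\<close>; with at least
      three vertices \<open>i\<close> is not 0.\<close>
    case True
    then have "(x # ys @ [x]) ! Suc (Suc i) = (x # ys) ! 0" by (simp add: nth_append)
    then show ?thesis
      unfolding 1 using assms True nth_eq_iff_index_eq[OF assms(1), of i 0] by auto
  next
    case False
    then have "(x # ys @ [x]) ! Suc (Suc i) = (x # ys) ! Suc (Suc i)"
      using assms(3) by (simp add: nth_append)
    then show ?thesis
      unfolding 1 using assms(3) False nth_eq_iff_index_eq[OF assms(1), of i "Suc (Suc i)"] by auto
  qed
qed

lemma follows_closed: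
  "follows g (x # ys @ [z]) \<longleftrightarrow> follows g (x # ys) \<and> g (last (x # ys)) = z"
  using follows_append[of g "x # ys" "[z]"] by simp

text \<open>Every vertex uses only one edge, so the edges of a cycle inside the edge set of a map
  all point the same way round. Propagation starts at the edge between \<open>x\<close> and
  \<open>y\<close>, or, if \<open>x\<close> itself uses that edge, at the closing edge with the list
  read backwards.\<close>

lemma cycle_directed:
  assumes d: "distinct (x # ys)" "2 \<le> length ys"
    and e: "\<And>a b. {a, b} \<in> cedges (x # ys) \<Longrightarrow> g a = b \<or> g b = a"
  shows "follows g (x # ys) \<and> g (last (x # ys)) = x \<or> follows g (x # rev ys) \<and> g (last (x # rev ys)) = x"
proof -
  let ?zs = "x # ys @ [x]"
  have succ: "successively (\<lambda>a b. g a = b \<or> g b = a) ?zs"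
  proof (subst successively_conv_nth, intro allI impI)
    fix i assume i: "Suc i < length ?zs"
    have "(?zs ! i, ?zs ! Suc i) \<in> set (zip (x # ys) (ys @ [x]))"
      unfolding in_set_zip using i by (intro exI[of _ i]) (auto simp: nth_Cons nth_append split: nat.splits)
    then show "g (?zs ! i) = ?zs ! Suc i \<or> g (?zs ! Suc i) = ?zs ! i"
      by (intro e) (auto simp: cedges_closed)
  qed
  obtain y ys' where ys: "ys = y # ys'" using d(2) by (cases ys) auto
  obtain l ys'' where ys'': "ys = ys'' @ [l]" using d(2) by (cases ys rule: rev_cases) auto
  have "l \<noteq> y" using d ys ys'' by (cases ys'') auto
  consider "g y = x" | "g x = y" using succ ys by auto
  then show ?thesis
  proof cases
    case 1
    have "successively (\<lambda>a b. g b = a) ?zs"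
      by (rule backward_propagates[OF succ closed_nth_distinct[OF d]]) (use ys 1 in auto)
    then have "follows g (rev ?zs)" unfolding follows_def successively_rev .
    then have "follows g (x # rev ys) \<and> g (last (x # rev ys)) = x"
      unfolding follows_closed[symmetric] by simp
    then show ?thesis by blast
  next
    case 2
    have s2: "successively (\<lambda>a b. g a = b \<or> g b = a) (rev ?zs)"
      using succ unfolding successively_rev by (simp add: disj_commute cong: successively_cong)
    have d2: "distinct (x # rev ys)" "2 \<le> length (rev ys)" using d by auto
    \<comment> \<open>\<open>x\<close> is sent to \<open>y \<noteq> l\<close>, so the edge between
      \<open>l\<close> and \<open>x\<close> is used by \<open>l\<close>.\<close>
    have "g l = x" using s2 ys'' 2 \<open>l \<noteq> y\<close> by auto
    have r: "rev ?zs = x # rev ys @ [x]" by simp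
    have "successively (\<lambda>a b. g b = a) (rev ?zs)"
      by (rule backward_propagates[OF s2 closed_nth_distinct[OF d2, folded r]])
         (use ys'' \<open>g l = x\<close> in auto)
    then have "follows g ?zs" unfolding follows_def successively_rev .
    then have "follows g (x # ys) \<and> g (last (x # ys)) = x"
      unfolding follows_closed[symmetric] .
    then show ?thesis by blast
  qed
qed

lemma successively_closed:
  "successively P (x # ys @ [z]) \<longleftrightarrow> (\<forall>(u, v)\<in>set (zip (x # ys) (ys @ [z])). P u v)"
  by (induction ys arbitrary: x) auto

lemma last_closed: "{last (a # zs), a} \<in> cedges (a # zs)"
proof -
  have "(last (a # zs), z) \<in> set (zip (a # zs) (zs @ [z]))" for z
    by (induction zs arbitrary: a) auto
  then show ?thesis unfolding cedges_closed by blast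
qed

lemma simple_path_exists:
  assumes "(a, b) \<in> {(x, y). {x, y} \<in> Q}\<^sup>*"
  shows "\<exists>vs. vs \<noteq> [] \<and> hd vs = a \<and> last vs = b \<and> distinct vs \<and> successively (\<lambda>x y. {x, y} \<in> Q) vs"
  using assms
proof (induction rule: converse_rtrancl_induct)
  case base
  then show ?case by (intro exI[of _ "[b]"]) auto
next
  case (step a c)
  then obtain vs where vs: "vs \<noteq> []" "hd vs = c" "last vs = b" "distinct vs"
    "successively (\<lambda>x y. {x, y} \<in> Q) vs" by blast
  show ?case
  proof (cases "a \<in> set vs")
    case False
    then show ?thesis using vs step by (intro exI[of _ "a # vs"]) (auto simp: successively_Cons)
  next
    case True
    then obtain as bs where "vs = as @ a # bs" by (auto simp: in_set_conv_decomp)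
    then show ?thesis using vs
      by (intro exI[of _ "a # bs"]) (auto simp: successively_append_iff split: if_splits)
  qed
qed

lemma reach_sym: "(u, t) \<in> reach V R \<Longrightarrow> (t, u) \<in> reach V R"
proof -
  have "sym ({(x, y). {x, y} \<in> R}\<^sup>*)"
    by (intro sym_rtrancl) (auto simp: sym_def insert_commute)
  then show "(u, t) \<in> reach V R \<Longrightarrow> (t, u) \<in> reach V R"
    by (auto simp: reach_def dest: symD)
qed

lemma reach_trans: "(u, t) \<in> reach V R \<Longrightarrow> (t, s) \<in> reach V R \<Longrightarrow> (u, s) \<in> reach V R"
  by (auto simp: reach_def)

lemma cedges_connected:
  assumes "cedges (x # ys) \<subseteq> R" "a \<in> set (x # ys)"
  shows "(x, a) \<in> {(x, y). {x, y} \<in> R}\<^sup>*"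
proof -
  have "successively (\<lambda>a b. {a, b} \<in> R) (x # ys)"
  proof (subst successively_conv_nth, intro allI impI)
    fix i assume i: "Suc i < length (x # ys)"
    have "((x # ys) ! i, (x # ys) ! Suc i) \<in> set (zip (x # ys) (ys @ [x]))"
      unfolding in_set_zip using i by (intro exI[of _ i]) (auto simp: nth_Cons nth_append split: nat.splits)
    then show "{(x # ys) ! i, (x # ys) ! Suc i} \<in> R"
      using assms(1) by (auto simp: cedges_closed)
  qed
  then show ?thesis using assms(2)
  proof (induction ys arbitrary: x)
    case (Cons y ys)
    then have "(x, y) \<in> {(x, y). {x, y} \<in> R}" by auto
    moreover have "a \<noteq> x \<Longrightarrow> (y, a) \<in> {(x, y). {x, y} \<in> R}\<^sup>*"
      using Cons by auto
    ultimately show ?case by (cases "a = x") (auto intro: converse_rtrancl_into_rtrancl)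
  qed simp
qed

context ugraph
begin

definition fedges :: "('a \<Rightarrow> 'a) \<Rightarrow> 'a set set" where
  "fedges f = (\<lambda>u. {u, f u}) ` V"

lemma fedgesD: "{a, b} \<in> fedges f \<Longrightarrow> f a = b \<or> f b = a"
  by (auto simp: fedges_def doubleton_eq_iff)

lemma choices_V: "f \<in> choices V \<Longrightarrow> v \<in> V \<Longrightarrow> f v \<in> V"
  using nb_subset by (auto simp: choices_def)

lemma cycle_fedges:
  assumes "is_cycle C" "C \<subseteq> fedges f"
  obtains x where "x \<in> orbit f x" "C = (\<lambda>u. {u, f u}) ` orbit f x" "\<Union> C = orbit f x"
proof -
  obtain x ys where C: "distinct (x # ys)" "2 \<le> length ys" "C = cedges (x # ys)"
    using assms(1) unfolding is_cycle_iff by blast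
  have "follows f (x # ys) \<and> f (last (x # ys)) = x \<or> follows f (x # rev ys) \<and> f (last (x # rev ys)) = x"
  proof (rule cycle_directed[OF C(1,2)])
    fix a b assume "{a, b} \<in> cedges (x # ys)"
    then have "{a, b} \<in> fedges f" using C(3) assms(2) by blast
    then show "f a = b \<or> f b = a" by (rule fedgesD)
  qed
  then obtain zs where zs: "follows f (x # zs)" "f (last (x # zs)) = x" "C = cedges (x # zs)"
  proof (elim disjE conjE)
    assume "follows f (x # rev ys)" "f (last (x # rev ys)) = x"
    then show thesis by (rule that) (simp only: C(3) cedges_rev)
  qed (rule that[of ys], simp_all only: C(3))
  have orb: "orbit f x = set (x # zs)" using zs by (intro orbit_cycle_list)
  show thesis
  proof (rule that[of x])
    show "x \<in> orbit f x" using orb by simp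
    show "C = (\<lambda>u. {u, f u}) ` orbit f x" using zs cedges_follows by simp
    show "\<Union> C = orbit f x" unfolding zs(3) Union_cedges orb ..
  qed
qed

lemma fcycle_list:
  assumes f: "f \<in> goods V" and x: "x \<in> V" "x \<in> orbit f x"
  obtains ys where "distinct (x # ys)" "2 \<le> length ys" "follows f (x # ys)" "f (last (x # ys)) = x"
proof -
  have ch: "f \<in> choices V" and sel: "sel (arcs f x)" using f x by (auto simp: goods_def)
  have "f x \<noteq> x" using ch x nb_irrefl by (auto simp: choices_def)
  then obtain ys where ys: "ys \<noteq> []" "distinct (x # ys)" "follows f (x # ys)" "f (last ys) = x"
    using follows_exists_cycle[OF x(2)] by blast
  have "length ys \<noteq> 1"
  proof
    assume "length ys = 1"
    then obtain y where "ys = [y]" by (auto simp: length_Suc_conv)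
    then have "f (f x) = x" using ys by auto
    then have "\<not> sel (arcs f x)" by (rule two_bad_not_sel)
    with sel show False by contradiction
  qed
  then have "2 \<le> length ys" using ys(1) by (cases ys) (auto simp: Suc_le_eq)
  then show thesis using that ys by auto
qed

lemma periodic_exists:
  assumes ch: "f \<in> choices V" and u: "u \<in> V"
  obtains z k where "z = (f ^^ k) u" "z \<in> V" "z \<in> orbit f z"
proof -
  have in_V: "(f ^^ k) u \<in> V" for k by (induction k) (use u ch choices_V in auto)
  then have "range (\<lambda>k. (f ^^ k) u) \<subseteq> V" by auto
  then have "finite (range (\<lambda>k. (f ^^ k) u))" using finite_V finite_subset by blast
  then have "\<not> inj (\<lambda>k. (f ^^ k) u)" using range_inj_infinite by blast
  then obtain i j where "i \<noteq> j" "(f ^^ i) u = (f ^^ j) u" by (auto simp: inj_def)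
  then obtain i j where ij: "i < j" "(f ^^ i) u = (f ^^ j) u" by (metis nat_neq_iff)
  have "(f ^^ (j - i)) ((f ^^ i) u) = (f ^^ i) u"
    using ij by (metis comp_apply funpow_add le_add_diff_inverse2 less_imp_le)
  then have "(f ^^ i) u \<in> orbit f ((f ^^ i) u)"
    using ij(1) by (auto simp: orbit_altdef intro!: exI[of _ "j - i"])
  then show thesis using that in_V by blast
qed

text \<open>An edge joins a vertex to its image, so vertices of one component have a common iterate.
  Two cycles in one component therefore coincide.\<close>

lemma reach_orbits_meet:
  assumes "(u, t) \<in> {(x, y). {x, y} \<in> fedges f}\<^sup>*"
  shows "\<exists>i j. (f ^^ i) u = (f ^^ j) t"
  using assms
proof induction
  case base
  show ?case by blast
next
  case (step t s)
  then obtain i j where ij: "(f ^^ i) u = (f ^^ j) t" by blast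
  from step(2) have "f t = s \<or> f s = t" by (auto dest: fedgesD)
  then show ?case
  proof
    assume "f t = s"
    then have "(f ^^ Suc i) u = (f ^^ j) s" using ij by (simp add: funpow_swap1)
    then show ?thesis by blast
  next
    assume "f s = t"
    then have "(f ^^ i) u = (f ^^ Suc j) s" using ij by (simp add: funpow_swap1)
    then show ?thesis by blast
  qed
qed

lemma reach_funpow:
  assumes "f \<in> choices V" "u \<in> V"
  shows "(u, (f ^^ k) u) \<in> reach V (fedges f)"
proof (induction k)
  case (Suc k)
  then have V: "(f ^^ k) u \<in> V" by (auto simp: reach_def)
  then have "{(f ^^ k) u, f ((f ^^ k) u)} \<in> fedges f" by (auto simp: fedges_def)
  then have "((f ^^ k) u, f ((f ^^ k) u)) \<in> reach V (fedges f)"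
    using V choices_V[OF assms(1) V] by (auto simp: reach_def)
  with Suc show ?case by (auto intro: reach_trans)
qed (use assms in \<open>auto simp: reach_def\<close>)

lemma fedges_basis:
  assumes f: "f \<in> goods V"
  shows "fedges f \<in> bicircular_bases V E"
proof -
  have ch: "f \<in> choices V" using f by (auto simp: goods_def)
  have "\<exists>!C. is_cycle C \<and> C \<subseteq> fedges f \<and> \<Union> C \<subseteq> K" if K: "K \<in> components V (fedges f)" for K
  proof -
    obtain u where u: "u \<in> V" "K = reach V (fedges f) `` {u}"
      using K by (auto simp: components_def quotient_def)
    obtain z k where z: "z = (f ^^ k) u" "z \<in> V" "z \<in> orbit f z"
      using periodic_exists[OF ch u(1)] by blast
    obtain ys where ys: "distinct (z # ys)" "2 \<le> length ys" "follows f (z # ys)" "f (last (z # ys)) = z"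
      using fcycle_list[OF f z(2,3)] by blast
    let ?C = "cedges (z # ys)"
    have C: "?C = (\<lambda>u. {u, f u}) ` orbit f z" "\<Union> ?C = orbit f z"
      using cedges_follows[OF ys(3,4)] orbit_cycle_list[OF ys(3,4)] Union_cedges[of "z # ys"] by auto
    have orbK: "orbit f z \<subseteq> K"
    proof
      fix t assume "t \<in> orbit f z"
      then obtain i where "t = (f ^^ i) z" by (auto simp: orbit_altdef)
      then have "(z, t) \<in> reach V (fedges f)" using reach_funpow[OF ch z(2)] by simp
      moreover have "(u, z) \<in> reach V (fedges f)" using reach_funpow[OF ch u(1)] z(1) by simp
      ultimately have "(u, t) \<in> reach V (fedges f)" by (rule_tac reach_trans)
      then show "t \<in> K" unfolding u(2) by simp
    qed
    have "?C \<subseteq> fedges f"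
      unfolding C(1) fedges_def using orbit_choices_subset[OF ch z(2,3)] by (rule image_mono)
    moreover have "is_cycle ?C" unfolding is_cycle_iff using ys(1,2) by blast
    moreover have "\<Union> ?C \<subseteq> K" unfolding C(2) by (rule orbK)
    ultimately have "is_cycle ?C \<and> ?C \<subseteq> fedges f \<and> \<Union> ?C \<subseteq> K" by blast
    moreover have "D = ?C" if D: "is_cycle D \<and> D \<subseteq> fedges f \<and> \<Union> D \<subseteq> K" for D
    proof -
      obtain x where x: "x \<in> orbit f x" "D = (\<lambda>u. {u, f u}) ` orbit f x" "\<Union> D = orbit f x"
        using D cycle_fedges[of D f] by metis
      have "x \<in> K" "z \<in> K" using x(1,3) D orbK z(3) by auto
      then have "(x, u) \<in> reach V (fedges f)" "(u, z) \<in> reach V (fedges f)"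
        unfolding u(2) by (auto intro: reach_sym)
      then have "(x, z) \<in> reach V (fedges f)" by (rule reach_trans)
      then obtain i j where ij: "(f ^^ i) x = (f ^^ j) z"
        using reach_orbits_meet[of x z f] by (auto simp: reach_def)
      have "(f ^^ i) x \<in> orbit f x" "(f ^^ j) z \<in> orbit f z"
        using x(1) z(3) by (auto simp: funpow_in_orbit)
      then have "orbit f x = orbit f z"
        using ij orbit_periodic_eq[OF x(1), of "(f ^^ i) x"] orbit_periodic_eq[OF z(3), of "(f ^^ j) z"] by simp
      then show ?thesis unfolding x(2) C(1) by simp
    qed
    ultimately show ?thesis by (rule ex1I)
  qed
  moreover have "fedges f \<subseteq> E" using ch by (auto simp: fedges_def choices_def nb_def)
  ultimately show ?thesis by (auto simp: bicircular_bases_def)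
qed

lemma fedges_eq_periodic:
  assumes f: "f \<in> goods V" and g: "g \<in> goods V" and eq: "fedges f = fedges g"
    and x: "x \<in> V" "x \<in> orbit f x"
  shows "g x = f x \<and> x \<in> orbit g x"
proof -
  obtain ys where ys: "distinct (x # ys)" "2 \<le> length ys" "follows f (x # ys)" "f (last (x # ys)) = x"
    using fcycle_list[OF f x] by blast
  have orb: "orbit f x \<subseteq> V" using orbit_choices_subset[of f V x] f x by (auto simp: goods_def)
  have sub: "cedges (x # ys) \<subseteq> fedges g"
    using orb unfolding eq[symmetric] cedges_follows[OF ys(3,4)] by (auto simp: fedges_def)
  have "follows g (x # ys) \<and> g (last (x # ys)) = x \<or> follows g (x # rev ys) \<and> g (last (x # rev ys)) = x"
  proof (rule cycle_directed[OF ys(1,2)])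
    fix a b assume "{a, b} \<in> cedges (x # ys)"
    then show "g a = b \<or> g b = a" using sub by (intro fedgesD) blast
  qed
  then show ?thesis
  proof
    assume g1: "follows g (x # ys) \<and> g (last (x # ys)) = x"
    have "ys \<noteq> []" using ys(2) by auto
    then have "g x = f x" using g1 ys(3) by (auto simp: follows_Cons)
    moreover have "x \<in> orbit g x" using orbit_cycle_list[of g x ys] g1 by simp
    ultimately show ?thesis ..
  next
    assume g1: "follows g (x # rev ys) \<and> g (last (x # rev ys)) = x"
    \<comment> \<open>\<open>g\<close> would run through the cycle in the opposite direction, but
      only one of the two directions is selected.\<close>
    have a: "arcs g x = (arcs f x)\<inverse>"
      using arcs_cycle_list[of g x "rev ys"] arcs_cycle_list[OF ys(3,4)] g1 carcs_rev[of x ys] by simp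
    have "x \<in> orbit g x" using orbit_cycle_list[of g x "rev ys"] g1 by simp
    then have "sel (arcs g x)" "sel (arcs f x)" using f g x by (auto simp: goods_def)
    then have False using sel_converse[of "arcs f x"] unfolding a by (auto simp: sel_def)
    then show ?thesis ..
  qed
qed

text \<open>On cycles the selected orientation decides. Off the cycles one inducts on the number of
  steps to a cycle: if the edge from \<open>u\<close> to \<open>f u\<close> were used by
  \<open>g\<close> at \<open>f u\<close>, the induction hypothesis would give
  \<open>f (f u) = u\<close>, and \<open>u\<close> would lie on a cycle.\<close>

lemma inj_fedges: "inj_on fedges (goods V)"
proof (rule inj_onI)
  fix f g assume f: "f \<in> goods V" and g: "g \<in> goods V" and eq: "fedges f = fedges g"
  have ch: "f \<in> choices V" "g \<in> choices V" using f g by (auto simp: goods_def)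
  have "f u = g u" if "u \<in> V" "z = (f ^^ k) u" "z \<in> orbit f z" for u k z
    using that
  proof (induction k arbitrary: u)
    case 0
    then show ?case using fedges_eq_periodic[OF f g eq, of u] by simp
  next
    case (Suc k)
    show ?case
    proof (cases "u \<in> orbit f u")
      case True
      then show ?thesis using fedges_eq_periodic[OF f g eq, of u] Suc.prems by simp
    next
      case False
      have "f u \<in> V" using choices_V[OF ch(1) Suc.prems(1)] .
      then have "f (f u) = g (f u)"
        using Suc by (intro Suc.IH) (auto simp: funpow_swap1)
      moreover have "{u, f u} \<in> fedges g"
        unfolding eq[symmetric] using Suc.prems(1) by (auto simp: fedges_def)
      then have "g u = f u \<or> g (f u) = u" by (auto dest: fedgesD)
      moreover have "f (f u) \<noteq> u"
        using False orbit.step[OF orbit.base[of f u]] by metis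
      ultimately show ?thesis by auto
    qed
  qed
  then have "f u = g u" if "u \<in> V" for u
    using periodic_exists[OF ch(1) that] that by metis
  then show "f = g" using ch choicesD(2) by (metis ext)
qed

text \<open>Each cycle of \<open>R\<close> is run through in its selected orientation, and every
  other vertex steps to a neighbour closer to a cycle. That no edge of \<open>R\<close> is left over
  rests on the uniqueness of the cycle in each component.\<close>

lemma basis_fedges:
  assumes R: "R \<in> bicircular_bases V E"
  shows "\<exists>f\<in>goods V. fedges f = R"
proof -
  let ?A = "{(x, y). {x, y} \<in> R}"
  let ?comp = "\<lambda>u. reach V R `` {u}"
  define \<C> where "\<C> = {C. is_cycle C \<and> C \<subseteq> R}"
  have RE: "R \<subseteq> E" using R by (auto simp: bicircular_bases_def)
  then have RV: "a \<in> V \<and> b \<in> V \<and> a \<noteq> b" if "{a, b} \<in> R" for a b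
    using that edge_subset[of "{a, b}"] edge_card[of "{a, b}"] by auto
  have uniq: "\<exists>!C. is_cycle C \<and> C \<subseteq> R \<and> \<Union> C \<subseteq> ?comp u" if "u \<in> V" for u
    using R that unfolding bicircular_bases_def components_def by (blast intro: quotientI)
  have refl: "(u, u) \<in> reach V R" if "u \<in> V" for u using that by (auto simp: reach_def)
  have C_list: "\<exists>x ys. distinct (x # ys) \<and> 2 \<le> length ys \<and> C = cedges (x # ys) \<and> sel (carcs (x # ys))"
    if "C \<in> \<C>" for C
  proof -
    obtain x ys where C: "distinct (x # ys)" "2 \<le> length ys" "C = cedges (x # ys)"
      using \<open>C \<in> \<C>\<close> unfolding \<C>_def is_cycle_iff by blast
    show ?thesis
    proof (cases "sel (carcs (x # ys))")
      case False
      then have "sel (carcs (x # rev ys))" using sel_carcs_rev[OF C(1,2)] by blast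
      moreover have "C = cedges (x # rev ys)" unfolding cedges_rev by (rule C(3))
      moreover have "distinct (x # rev ys)" "2 \<le> length (rev ys)" using C(1,2) by simp_all
      ultimately show ?thesis by blast
    qed (use C in blast)
  qed
  have C_reach: "u \<in> V \<and> (u, t) \<in> reach V R" if "C \<in> \<C>" "u \<in> \<Union> C" "t \<in> \<Union> C" for C u t
  proof -
    obtain x ys where C: "C = cedges (x # ys)" using C_list[OF \<open>C \<in> \<C>\<close>] by blast
    have sub: "cedges (x # ys) \<subseteq> R" using that(1) C by (simp add: \<C>_def)
    have "\<Union> C \<subseteq> V" using that(1) RE edge_subset by (auto simp: \<C>_def)
    moreover have "x \<in> \<Union> C" unfolding C Union_cedges by simp
    ultimately have "(x, a) \<in> reach V R" if "a \<in> \<Union> C" for a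
      using cedges_connected[OF sub, of a] that unfolding reach_def C Union_cedges by auto
    then show ?thesis using that \<open>\<Union> C \<subseteq> V\<close> by (meson reach_sym reach_trans subsetD)
  qed
  have C_uniq: "C = D" if "C \<in> \<C>" "D \<in> \<C>" "c \<in> \<Union> C" "d \<in> \<Union> D" "(t, c) \<in> reach V R" "(t, d) \<in> reach V R"
    for C D c d t
  proof -
    have "t \<in> V" using that(5) by (auto simp: reach_def)
    moreover have "\<Union> C \<subseteq> ?comp t" using C_reach[OF that(1,3)] reach_trans[OF that(5)] by blast
    moreover have "\<Union> D \<subseteq> ?comp t" using C_reach[OF that(2,4)] reach_trans[OF that(6)] by blast
    ultimately show ?thesis using uniq[of t] that(1,2) unfolding \<C>_def by blast
  qed
  have "\<exists>L. \<forall>C\<in>\<C>. (\<lambda>(x, ys). distinct (x # ys) \<and> 2 \<le> length ys \<and> C = cedges (x # ys) \<and> sel (carcs (x # ys))) (L C)"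
    using C_list by (intro bchoice) fast
  then obtain L where L: "\<forall>C\<in>\<C>. (\<lambda>(x, ys). distinct (x # ys) \<and> 2 \<le> length ys \<and> C = cedges (x # ys) \<and> sel (carcs (x # ys))) (L C)"
    by blast
  define Cyc where "Cyc = \<Union> (\<Union> \<C>)"
  define cy where "cy u = (SOME C. C \<in> \<C> \<and> u \<in> \<Union> C)" for u
  have cy: "cy u = C" if "C \<in> \<C>" "u \<in> \<Union> C" for u C
  proof -
    have *: "cy u \<in> \<C> \<and> u \<in> \<Union> (cy u)"
      unfolding cy_def by (rule someI[of "\<lambda>C. C \<in> \<C> \<and> u \<in> \<Union> C" C]) (use that in simp)
    have "(u, u) \<in> reach V R" using C_reach[OF that that(2)] by simp
    then show ?thesis using * that C_uniq[of "cy u" C u u u] by simp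
  qed
  \<comment> \<open>Distance within \<open>R\<close> to the nearest vertex on a cycle; decreasing
    \<open>d\<close> directs the trees that hang off the cycles.\<close>
  define d where "d u = (LEAST k. \<exists>c\<in>Cyc. (u, c) \<in> ?A ^^ k)" for u
  have d_ex: "\<exists>k. \<exists>c\<in>Cyc. (u, c) \<in> ?A ^^ k" if u: "u \<in> V" for u
  proof -
    obtain C where C: "C \<in> \<C>" "\<Union> C \<subseteq> ?comp u"
      using uniq[OF u] unfolding \<C>_def by blast
    obtain x ys where "C = cedges (x # ys)" using C_list[OF C(1)] by blast
    then have "x \<in> \<Union> C" using Union_cedges[of "x # ys"] by simp
    then have "x \<in> Cyc" "(u, x) \<in> ?A\<^sup>*" using C by (auto simp: Cyc_def reach_def)
    then show ?thesis using rtrancl_imp_relpow by blast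
  qed
  have step: "\<exists>w. {u, w} \<in> R \<and> d w < d u" if u: "u \<in> V" "u \<notin> Cyc" for u
  proof -
    obtain c where c: "c \<in> Cyc" "(u, c) \<in> ?A ^^ d u"
      using LeastI_ex[OF d_ex[OF u(1)]] unfolding d_def by blast
    have "d u \<noteq> 0" using c u(2) by (metis relpow_0_E)
    then obtain k where k: "d u = Suc k" by (cases "d u") auto
    then obtain w where w: "(u, w) \<in> ?A" "(w, c) \<in> ?A ^^ k"
      using c(2) relpow_Suc_D2[of u c k ?A] by auto
    have "d w \<le> k" unfolding d_def by (rule Least_le) (use w(2) c(1) in blast)
    then show ?thesis using w(1) k by auto
  qed
  define nxt where "nxt u = (SOME w. {u, w} \<in> R \<and> d w < d u)" for u
  have nxt: "{u, nxt u} \<in> R" "d (nxt u) < d u" if "u \<in> V" "u \<notin> Cyc" for u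
    using someI_ex[OF step[OF that]] unfolding nxt_def by blast+
  define f where "f u = (if u \<notin> V then u else if u \<in> Cyc
      then asg id (fst (L (cy u)) # snd (L (cy u))) (fst (L (cy u))) u else nxt u)" for u
  have f_out: "f u = u" if "u \<notin> V" for u using that by (simp add: f_def)
  have f_nxt: "f u = nxt u" if "u \<in> V" "u \<notin> Cyc" for u using that by (simp add: f_def)
  have cyc_f: "\<exists>x ys. distinct (x # ys) \<and> 2 \<le> length ys \<and> C = cedges (x # ys) \<and> sel (carcs (x # ys)) \<and>
      follows f (x # ys) \<and> f (last (x # ys)) = x" if C: "C \<in> \<C>" for C
  proof -
    obtain x ys where LC: "L C = (x, ys)" by (cases "L C")
    have xy: "distinct (x # ys)" "2 \<le> length ys" "C = cedges (x # ys)" "sel (carcs (x # ys))"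
      using bspec[OF L C] unfolding LC by simp_all
    have eq: "f u = asg id (x # ys) x u" if "u \<in> set (x # ys)" for u
    proof -
      have "u \<in> \<Union> C" unfolding xy(3) Union_cedges by (rule that)
      then have "cy u = C" "u \<in> V" "u \<in> Cyc" using cy[OF C] C_reach[OF C] C by (auto simp: Cyc_def)
      then show ?thesis unfolding f_def by (simp add: LC del: asg.simps)
    qed
    have "follows f (x # ys)"
      using follows_asg[OF xy(1), of id x] follows_cong[of "x # ys" f "asg id (x # ys) x"] eq by blast
    moreover have "f (last (x # ys)) = x"
      using eq[of "last (x # ys)"] asg_last[OF xy(1), of id x] by (simp del: asg.simps)
    ultimately show ?thesis using xy by blast
  qed
  have f_R: "{u, f u} \<in> R" if "u \<in> V" for u
  proof (cases "u \<in> Cyc")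
    case True
    then obtain C where C: "C \<in> \<C>" "u \<in> \<Union> C" by (auto simp: Cyc_def)
    obtain x ys where xy: "C = cedges (x # ys)" "follows f (x # ys)" "f (last (x # ys)) = x"
      using cyc_f[OF C(1)] by blast
    have "u \<in> orbit f x" using C(2) unfolding orbit_cycle_list[OF xy(2,3)] xy(1) Union_cedges .
    then have "{u, f u} \<in> C" unfolding xy(1) cedges_follows[OF xy(2,3)] by blast
    then show ?thesis using C(1) by (auto simp: \<C>_def)
  qed (use nxt that f_nxt in simp)
  have f_V: "f u \<in> V" if "u \<in> V" for u using RV[OF f_R[OF that]] by simp
  have ch: "f \<in> choices V"
    using f_R RE f_out by (auto simp: choices_def nb_def)
  have Cyc_closed: "f u \<in> Cyc" if "u \<in> Cyc" for u
  proof -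
    obtain C where C: "C \<in> \<C>" "u \<in> \<Union> C" using \<open>u \<in> Cyc\<close> by (auto simp: Cyc_def)
    obtain x ys where xy: "C = cedges (x # ys)" "follows f (x # ys)" "f (last (x # ys)) = x"
      using cyc_f[OF C(1)] by blast
    have orb: "\<Union> C = orbit f x" unfolding orbit_cycle_list[OF xy(2,3)] xy(1) Union_cedges ..
    have "f u \<in> \<Union> C" using C(2) unfolding orb by (rule orbit.step)
    then show ?thesis using C(1) by (auto simp: Cyc_def)
  qed
  have good: "f \<in> goods V"
  proof -
    have "sel (arcs f z)" if z: "z \<in> V" "z \<in> orbit f z" for z
    proof -
      \<comment> \<open>A periodic \<open>z\<close> belongs to its own orbit, so the alternative
        \<open>d z < d z\<close> drops out and \<open>z\<close> is on a cycle of
        \<open>R\<close>.\<close>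
      have "t \<in> V \<and> (t \<in> Cyc \<or> d t < d z)" if "t \<in> orbit f z" for t
        using that
      proof induction
        case base
        show ?case using f_V[OF z(1)] Cyc_closed nxt[OF z(1)] f_nxt[OF z(1)] by (cases "z \<in> Cyc") auto
      next
        case (step t)
        then show ?case
          using f_V[of t] Cyc_closed[of t] nxt(2)[of t] f_nxt[of t] by (cases "t \<in> Cyc") auto
      qed
      from this[OF z(2)] have "z \<in> Cyc" by auto
      then obtain C where C: "C \<in> \<C>" "z \<in> \<Union> C" by (auto simp: Cyc_def)
      obtain x ys where xy: "C = cedges (x # ys)" "sel (carcs (x # ys))" "follows f (x # ys)" "f (last (x # ys)) = x"
        using cyc_f[OF C(1)] by blast
      have orb: "orbit f x = set (x # ys)" using orbit_cycle_list[OF xy(3,4)] .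
      have "z \<in> orbit f x" using C(2) unfolding orb xy(1) Union_cedges .
      then have "arcs f z = arcs f x"
        using orb by (intro arcs_periodic_eq) simp_all
      then show ?thesis using xy(2) unfolding arcs_cycle_list[OF xy(3,4)] by simp
    qed
    with ch show ?thesis by (auto simp: goods_def)
  qed
  let ?Q = "fedges f"
  let ?B = "{(x, y). {x, y} \<in> ?Q}"
  have QR: "?Q \<subseteq> R" using f_R by (auto simp: fedges_def)
  have B_sym: "(b, a) \<in> ?B\<^sup>*" if "(a, b) \<in> ?B\<^sup>*" for a b
    using that by (rule symD[rotated]) (intro sym_rtrancl, auto simp: sym_def insert_commute)
  have B_reach: "(a, b) \<in> reach V R" if "(a, b) \<in> ?B\<^sup>*" "a \<in> V" "b \<in> V" for a b
    using that rtrancl_mono[of ?B ?A] QR by (auto simp: reach_def)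
  have to_Cyc: "\<exists>c\<in>Cyc. (u, c) \<in> ?B\<^sup>*" if "u \<in> V" for u
    using that
  proof (induction "d u" arbitrary: u rule: less_induct)
    case less
    show ?case
    proof (cases "u \<in> Cyc")
      case False
      then have "d (f u) < d u" using nxt(2)[OF less.prems] f_nxt[OF less.prems] by simp
      then obtain c where c: "c \<in> Cyc" "(f u, c) \<in> ?B\<^sup>*" using less f_V by blast
      have "(u, f u) \<in> ?B" using less.prems by (auto simp: fedges_def)
      then show ?thesis using c by (meson converse_rtrancl_into_rtrancl)
    qed auto
  qed
  have "R \<subseteq> ?Q"
  proof
    fix e assume e: "e \<in> R"
    then obtain a b where ab: "e = {a, b}" using edge_card[of e] RE by (auto simp: card_2_iff)
    then have V: "a \<in> V" "b \<in> V" "a \<noteq> b" using RV[of a b] e by auto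
    show "e \<in> ?Q"
    proof (rule ccontr)
      assume no: "e \<notin> ?Q"
      obtain c where c: "c \<in> Cyc" "(a, c) \<in> ?B\<^sup>*" using to_Cyc[OF V(1)] by blast
      obtain c' where c': "c' \<in> Cyc" "(b, c') \<in> ?B\<^sup>*" using to_Cyc[OF V(2)] by blast
      obtain C where C: "C \<in> \<C>" "c \<in> \<Union> C" using c by (auto simp: Cyc_def)
      obtain C' where C': "C' \<in> \<C>" "c' \<in> \<Union> C'" using c' by (auto simp: Cyc_def)
      have cV: "c \<in> V" "c' \<in> V" using C_reach[OF C C(2)] C_reach[OF C' C'(2)] by auto
      have ac: "(a, c) \<in> reach V R" using B_reach[OF c(2) V(1) cV(1)] .
      have "(a, b) \<in> reach V R" using e V unfolding ab reach_def by auto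
      then have "(a, c') \<in> reach V R" using B_reach[OF c'(2) V(2) cV(2)] by (rule reach_trans)
      then have "C = C'" using C_uniq[OF C(1) C'(1) C(2) C'(2) ac] by simp
      obtain x ys where xy: "C = cedges (x # ys)" "follows f (x # ys)" "f (last (x # ys)) = x"
        using cyc_f[OF C(1)] by blast
      have "orbit f x = \<Union> C" unfolding orbit_cycle_list[OF xy(2,3)] xy(1) Union_cedges ..
      then have "orbit f x \<subseteq> V" using C_reach[OF C(1)] by blast
      then have CQ: "cedges (x # ys) \<subseteq> ?Q"
        unfolding cedges_follows[OF xy(2,3)] fedges_def by (rule image_mono)
      have "(x, c) \<in> ?B\<^sup>*" "(x, c') \<in> ?B\<^sup>*"
        using C(2) C'(2) cedges_connected[OF CQ] unfolding \<open>C = C'\<close>[symmetric] xy(1) Union_cedges by blast+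
      then have path: "(a, b) \<in> ?B\<^sup>*"
        using c(2) c'(2) B_sym rtrancl_trans by meson
      obtain vs where vs: "vs \<noteq> []" "hd vs = a" "last vs = b" "distinct vs" "successively (\<lambda>x y. {x, y} \<in> ?Q) vs"
        using simple_path_exists[OF path] by (elim exE conjE) (rule that)
      then obtain zs where zs: "vs = a # zs" by (cases vs) auto
      have "zs \<noteq> []" using vs(3) zs V(3) by auto
      have "length zs \<noteq> 1"
      proof
        assume "length zs = 1"
        then obtain z where "zs = [z]" by (auto simp: length_Suc_conv)
        then show False using vs(3,5) zs no ab by auto
      qed
      then have len: "2 \<le> length zs" using \<open>zs \<noteq> []\<close> by (cases zs) (auto simp: Suc_le_eq)
      have succ: "successively (\<lambda>x y. {x, y} \<in> insert e ?Q) (a # zs @ [a])"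
      proof -
        have "successively (\<lambda>x y. {x, y} \<in> insert e ?Q) (a # zs)"
          using vs(5) unfolding zs by (rule successively_mono) simp
        moreover have "{last (a # zs), a} \<in> insert e ?Q" using vs(3) unfolding zs ab by (simp add: insert_commute)
        ultimately show ?thesis
          using successively_append_iff[of "\<lambda>x y. {x, y} \<in> insert e ?Q" "a # zs" "[a]"] by simp
      qed
      let ?D = "cedges (a # zs)"
      have "?D \<subseteq> insert e ?Q"
        using succ unfolding successively_closed cedges_closed by auto
      then have "?D \<in> \<C>"
        using QR e vs(4) len zs unfolding \<C>_def is_cycle_iff by blast
      moreover have "a \<in> \<Union> ?D" unfolding Union_cedges by simp
      ultimately have "?D = C" using C_uniq[OF _ C(1) _ C(2) refl[OF V(1)] ac] by blast
      moreover have "e \<in> ?D"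
        using last_closed[of a zs] vs(3) unfolding zs ab by (simp add: insert_commute)
      ultimately show False using CQ xy(1) no by blast
    qed
  qed
  with QR have "fedges f = R" by (rule_tac subset_antisym)
  with good show ?thesis by blast
qed

theorem card_bicircular_bases: "card (bicircular_bases V E) = num V"
proof -
  have "bij_betw fedges (goods V) (bicircular_bases V E)"
    unfolding bij_betw_def using inj_fedges fedges_basis basis_fedges by blast
  then show ?thesis unfolding num_def by (rule bij_betw_same_card[symmetric])
qed

end

section \<open>Green-function bounds for absorbing Markov chains\<close>

section \<open>Expected rewards of finite absorbing chains\<close>

text \<open>\<open>u n x\<close> is the expected reward collected within \<open>n\<close> steps from \<open>x\<close>.\<close>

primrec reward_upto ::
  "real \<Rightarrow> ('x \<Rightarrow> 'i set) \<Rightarrow> ('x \<Rightarrow> 'i \<Rightarrow> 'x option) \<Rightarrow> ('x \<Rightarrow> 'i \<Rightarrow> real) \<Rightarrow> nat \<Rightarrow> 'x \<Rightarrow> real" where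
  "reward_upto a J nx rw 0 x = 0"
| "reward_upto a J nx rw (Suc n) x =
     a + (\<Sum>j\<in>J x. case nx x j of None \<Rightarrow> rw x j | Some z \<Rightarrow> reward_upto a J nx rw n z) / card (J x)"

definition reward ::
  "real \<Rightarrow> ('x \<Rightarrow> 'i set) \<Rightarrow> ('x \<Rightarrow> 'i \<Rightarrow> 'x option) \<Rightarrow> ('x \<Rightarrow> 'i \<Rightarrow> real) \<Rightarrow> 'x \<Rightarrow> ennreal" where
  "reward a J nx rw x = (SUP n. ennreal (reward_upto a J nx rw n x))"

context
  fixes a :: real and J :: "'x \<Rightarrow> 'i set" and nx :: "'x \<Rightarrow> 'i \<Rightarrow> 'x option" and rw :: "'x \<Rightarrow> 'i \<Rightarrow> real"
  assumes a: "0 \<le> a" and rw: "\<And>x j. 0 \<le> rw x j"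
begin

lemma reward_upto_nonneg: "0 \<le> reward_upto a J nx rw n x"
  by (induction n arbitrary: x) (auto intro!: add_nonneg_nonneg divide_nonneg_nonneg sum_nonneg a rw split: option.split)

lemma reward_upto_mono: "reward_upto a J nx rw n x \<le> reward_upto a J nx rw (Suc n) x"
proof (induction n arbitrary: x)
  case 0
  show ?case using reward_upto_nonneg[of "Suc 0" x] by simp
next
  case (Suc n)
  show ?case
    unfolding reward_upto.simps(2)[of a J nx rw "Suc n" x] reward_upto.simps(2)[of a J nx rw n x]
    by (intro add_left_mono divide_right_mono sum_mono) (auto intro: Suc simp del: reward_upto.simps split: option.split)
qed

lemma reward_unfold:
  "ennreal a + (\<Sum>j\<in>J x. case nx x j of None \<Rightarrow> ennreal (rw x j) | Some z \<Rightarrow> reward a J nx rw z) / of_nat (card (J x))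
    = reward a J nx rw x"
proof (cases "card (J x) = 0")
  \<comment> \<open>Degenerate case: a sum over an empty or infinite index set is 0, and so is its
    quotient by 0.\<close>
  case True
  have "reward a J nx rw x = ennreal a"
  proof (rule antisym)
    show "reward a J nx rw x \<le> ennreal a"
      unfolding reward_def
    proof (rule SUP_least)
      fix n show "ennreal (reward_upto a J nx rw n x) \<le> ennreal a"
        by (cases n) (use True a in auto)
    qed
    have "ennreal (reward_upto a J nx rw 1 x) \<le> reward a J nx rw x"
      unfolding reward_def by (rule SUP_upper) simp
    then show "ennreal a \<le> reward a J nx rw x" using True by simp
  qed
  moreover have "(\<Sum>j\<in>J x. case nx x j of None \<Rightarrow> ennreal (rw x j) | Some z \<Rightarrow> reward a J nx rw z) = 0"
    using True by (cases "finite (J x)") auto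
  ultimately show ?thesis by simp
next
  case False
  let ?u = "reward_upto a J nx rw"
  let ?c = "\<lambda>n j. case nx x j of None \<Rightarrow> ennreal (rw x j) | Some z \<Rightarrow> ennreal (?u n z)"
  have inc: "incseq (\<lambda>n. ennreal (?u n z))" for z
    by (rule incseq_SucI) (intro ennreal_leI reward_upto_mono)
  have lim: "(\<lambda>n. ennreal (?u n z)) \<longlonglongrightarrow> reward a J nx rw z" for z
    unfolding reward_def using inc by (rule LIMSEQ_SUP)
  have "(\<lambda>n. ennreal (?u (Suc n) x)) \<longlonglongrightarrow> reward a J nx rw x"
    using lim[of x] by (rule LIMSEQ_Suc)
  moreover have "ennreal (?u (Suc n) x) = ennreal a + (\<Sum>j\<in>J x. ?c n j) / of_nat (card (J x))" for n
  proof -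
    have "ennreal (?u (Suc n) x) = ennreal a + ennreal ((\<Sum>j\<in>J x. case nx x j of None \<Rightarrow> rw x j | Some z \<Rightarrow> ?u n z) / card (J x))"
      by (simp, rule ennreal_plus) (auto intro!: a divide_nonneg_nonneg sum_nonneg rw reward_upto_nonneg split: option.split)
    also have "ennreal ((\<Sum>j\<in>J x. case nx x j of None \<Rightarrow> rw x j | Some z \<Rightarrow> ?u n z) / card (J x))
        = ennreal (\<Sum>j\<in>J x. case nx x j of None \<Rightarrow> rw x j | Some z \<Rightarrow> ?u n z) / of_nat (card (J x))"
      using False by (subst divide_ennreal[symmetric])
        (auto intro!: sum_nonneg rw reward_upto_nonneg split: option.split simp: ennreal_of_nat_eq_real_of_nat)
    also have "ennreal (\<Sum>j\<in>J x. case nx x j of None \<Rightarrow> rw x j | Some z \<Rightarrow> ?u n z) = (\<Sum>j\<in>J x. ?c n j)"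
      by (subst sum_ennreal[symmetric])
        (auto intro!: rw reward_upto_nonneg sum.cong split: option.split)
    finally show ?thesis .
  qed
  moreover have "(\<lambda>n. ennreal a + (\<Sum>j\<in>J x. ?c n j) / of_nat (card (J x)))
      \<longlonglongrightarrow> ennreal a + (\<Sum>j\<in>J x. case nx x j of None \<Rightarrow> ennreal (rw x j) | Some z \<Rightarrow> reward a J nx rw z) / of_nat (card (J x))"
    unfolding divide_ennreal_def
  proof (intro tendsto_intros ennreal_tendsto_cmult tendsto_mult_ennreal)
    show "(\<lambda>n. ?c n j) \<longlonglongrightarrow> (case nx x j of None \<Rightarrow> ennreal (rw x j) | Some z \<Rightarrow> reward a J nx rw z)" for j
      using lim by (cases "nx x j") auto
  qed (use False in \<open>auto simp: ennreal_of_nat_eq_real_of_nat inverse_ennreal\<close>)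
  ultimately show ?thesis by (simp only:) (rule LIMSEQ_unique)
qed

text \<open>\<open>g\<close> dominates the expected numbers of visits from \<open>x0\<close>, since
  it satisfies the flow inequality with a unit source there. Let \<open>u\<close> be the reward
  within a finite horizon and \<open>h\<close> the reward collected directly; summing
  \<open>g * u\<close> over \<open>X\<close> and using monotonicity in the horizon gives
  \<open>sum (g u) \<le> sum (g h) + sum (g u) - u x0\<close>. The values \<open>u\<close> are real,
  so the sums cancel, and the bound holds for every horizon.\<close>

lemma reward_le:
  assumes X: "finite X" "x0 \<in> X" and J: "\<And>x. x \<in> X \<Longrightarrow> finite (J x)"
    and nx: "\<And>x j z. x \<in> X \<Longrightarrow> j \<in> J x \<Longrightarrow> nx x j = Some z \<Longrightarrow> z \<in> X"
    and g0: "\<And>x. x \<in> X \<Longrightarrow> 0 \<le> g x"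
    and g: "\<And>z. z \<in> X \<Longrightarrow> of_bool (z = x0) + (\<Sum>x\<in>X. g x / card (J x) * card {j \<in> J x. nx x j = Some z}) \<le> g z"
  shows "reward a J nx rw x0
    \<le> ennreal (\<Sum>x\<in>X. g x * (a + (\<Sum>j | j \<in> J x \<and> nx x j = None. rw x j) / card (J x)))"
  unfolding reward_def
proof (rule SUP_least, rule ennreal_leI)
  fix n
  let ?u = "reward_upto a J nx rw"
  let ?h = "\<lambda>x. a + (\<Sum>j | j \<in> J x \<and> nx x j = None. rw x j) / card (J x)"
  have split: "(\<Sum>j\<in>J x. case nx x j of None \<Rightarrow> rw x j | Some z \<Rightarrow> ?u n z)
      = (\<Sum>j | j \<in> J x \<and> nx x j = None. rw x j) + (\<Sum>z\<in>X. card {j \<in> J x. nx x j = Some z} * ?u n z)"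
    if x: "x \<in> X" for x
  proof -
    have "(\<Sum>j\<in>J x. case nx x j of None \<Rightarrow> rw x j | Some z \<Rightarrow> ?u n z)
        = (\<Sum>j | j \<in> J x \<and> nx x j = None. rw x j)
          + (\<Sum>j | j \<in> J x \<and> nx x j \<noteq> None. case nx x j of None \<Rightarrow> rw x j | Some z \<Rightarrow> ?u n z)"
    proof -
      have "J x = {j. j \<in> J x \<and> nx x j = None} \<union> {j. j \<in> J x \<and> nx x j \<noteq> None}" by blast
      then have "(\<Sum>j\<in>J x. case nx x j of None \<Rightarrow> rw x j | Some z \<Rightarrow> ?u n z)
          = (\<Sum>j\<in>{j. j \<in> J x \<and> nx x j = None} \<union> {j. j \<in> J x \<and> nx x j \<noteq> None}.
              case nx x j of None \<Rightarrow> rw x j | Some z \<Rightarrow> ?u n z)"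
        by (rule sum.cong) simp
      also have "\<dots> = (\<Sum>j | j \<in> J x \<and> nx x j = None. case nx x j of None \<Rightarrow> rw x j | Some z \<Rightarrow> ?u n z)
          + (\<Sum>j | j \<in> J x \<and> nx x j \<noteq> None. case nx x j of None \<Rightarrow> rw x j | Some z \<Rightarrow> ?u n z)"
        using J[OF x] by (intro sum.union_disjoint) auto
      also have "(\<Sum>j | j \<in> J x \<and> nx x j = None. case nx x j of None \<Rightarrow> rw x j | Some z \<Rightarrow> ?u n z)
          = (\<Sum>j | j \<in> J x \<and> nx x j = None. rw x j)"
        by (rule sum.cong) auto
      finally show ?thesis .
    qed
    also have "(\<Sum>j | j \<in> J x \<and> nx x j \<noteq> None. case nx x j of None \<Rightarrow> rw x j | Some z \<Rightarrow> ?u n z)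
        = (\<Sum>z\<in>X. \<Sum>j | j \<in> {j. j \<in> J x \<and> nx x j \<noteq> None} \<and> the (nx x j) = z.
             case nx x j of None \<Rightarrow> rw x j | Some z \<Rightarrow> ?u n z)"
      using J[OF x] X nx[OF x] by (subst sum.group) auto
    also have "\<dots> = (\<Sum>z\<in>X. card {j \<in> J x. nx x j = Some z} * ?u n z)"
    proof (rule sum.cong[OF refl])
      fix z
      have "{j. j \<in> {j. j \<in> J x \<and> nx x j \<noteq> None} \<and> the (nx x j) = z} = {j \<in> J x. nx x j = Some z}"
        by auto
      then show "(\<Sum>j | j \<in> {j. j \<in> J x \<and> nx x j \<noteq> None} \<and> the (nx x j) = z.
             case nx x j of None \<Rightarrow> rw x j | Some z \<Rightarrow> ?u n z) = card {j \<in> J x. nx x j = Some z} * ?u n z"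
        by simp
    qed
    finally show ?thesis .
  qed
  have "(\<Sum>x\<in>X. g x * ?u n x) \<le> (\<Sum>x\<in>X. g x * ?u (Suc n) x)"
    using g0 by (intro sum_mono mult_left_mono reward_upto_mono)
  also have "\<dots> = (\<Sum>x\<in>X. g x * ?h x + (\<Sum>z\<in>X. g x / card (J x) * card {j \<in> J x. nx x j = Some z} * ?u n z))"
    by (rule sum.cong[OF refl])
       (simp add: split add_divide_distrib distrib_left sum_divide_distrib sum_distrib_left algebra_simps)
  also have "\<dots> = (\<Sum>x\<in>X. g x * ?h x)
      + (\<Sum>z\<in>X. (\<Sum>x\<in>X. g x / card (J x) * card {j \<in> J x. nx x j = Some z}) * ?u n z)"
    by (simp add: sum.distrib sum_distrib_right) (rule sum.swap)
  also have "(\<Sum>z\<in>X. (\<Sum>x\<in>X. g x / card (J x) * card {j \<in> J x. nx x j = Some z}) * ?u n z)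
      \<le> (\<Sum>z\<in>X. (g z - of_bool (z = x0)) * ?u n z)"
    using g by (intro sum_mono mult_right_mono reward_upto_nonneg) (auto simp: algebra_simps)
  also have "\<dots> = (\<Sum>z\<in>X. g z * ?u n z) - ?u n x0"
  proof -
    have "(\<Sum>z\<in>X. of_bool (z = x0) * ?u n z) = ?u n x0"
      using X by (simp add: of_bool_def if_distrib[of "\<lambda>t. t * _"] sum.delta cong: if_cong)
    then show ?thesis by (simp add: left_diff_distrib sum_subtractf)
  qed
  finally show "?u n x0 \<le> (\<Sum>x\<in>X. g x * ?h x)" by simp
qed

end

section \<open>Stationary flow of the loop-erased walk\<close>

section \<open>The loop-erased walk\<close>

context ugraph
begin

text \<open>From the path \<open>xs\<close> the walk moves to the neighbour \<open>y\<close> of its end; \<open>c\<close> is a coin. \<open>None\<close> means that the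
  walk has left \<open>S\<close> or closed a cycle that is kept.\<close>

definition walk_step :: "'a set \<Rightarrow> 'a list \<Rightarrow> 'a \<times> bool \<Rightarrow> 'a list option" where
  "walk_step S xs = (\<lambda>(y, c).
     if y \<notin> S then None
     else if y \<in> set xs then
       (let p = takeWhile (\<lambda>z. z \<noteq> y) xs in
          if length p + 3 \<le> length xs \<and> c then None else Some (p @ [y]))
     else Some (xs @ [y]))"

definition moves :: "'a list \<Rightarrow> ('a \<times> bool) set" where
  "moves xs = nb (last xs) \<times> UNIV"

lemma takeWhile_first: "y \<notin> set as \<Longrightarrow> takeWhile (\<lambda>z. z \<noteq> y) (as @ y # bs) = as"
  by (induction as) auto

lemma finite_moves: "finite (moves xs)" and card_moves: "card (moves xs) = 2 * card (nb (last xs))"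
  by (simp_all add: moves_def card_cartesian_product)

lemma walk_step_paths:
  assumes xs: "xs \<in> paths S v" and j: "j \<in> moves xs" and st: "walk_step S xs j = Some z"
  shows "z \<in> paths S v"
proof -
  obtain y c where yc: "j = (y, c)" by (cases j)
  have y: "y \<in> nb (last xs)" "y \<in> S"
    using j st by (auto simp: yc moves_def walk_step_def split: if_splits)
  show ?thesis
  proof (cases "y \<in> set xs")
    case False
    then have "z = xs @ [y]" using st y by (simp add: yc walk_step_def)
    then show ?thesis using xs y False by (auto simp: paths_def walk_append)
  next
    case True
    then have z: "z = takeWhile (\<lambda>z. z \<noteq> y) xs @ [y]"
      using st y by (auto simp: yc walk_step_def Let_def split: if_splits)
    obtain as bs where s: "xs = as @ y # bs" "y \<notin> set as" using True by (meson split_list_first)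
    have "takeWhile (\<lambda>z. z \<noteq> y) xs = as" using s by (simp add: takeWhile_first)
    then have "z = as @ [y]" using z by simp
    moreover have "walk (as @ [y])" using xs s by (auto simp: paths_def walk_append)
    moreover have "hd (as @ [y]) = v" using xs s by (cases as) (auto simp: paths_def)
    ultimately show ?thesis using xs s by (auto simp: paths_def)
  qed
qed

text \<open>A path \<open>z\<close> arises either by appending its last vertex, with any coin, or by
  erasing a cycle attached to its last vertex; a long cycle is erased only if the coin shows
  \<open>False\<close>.\<close>

lemma walk_step_predecessors:
  assumes z: "z \<in> paths S v"
  shows "{(xs, j). xs \<in> paths S v \<and> j \<in> moves xs \<and> walk_step S xs j = Some z}
    = (if z = [v] then {} else {butlast z} \<times> ({last z} \<times> UNIV))
      \<union> (\<lambda>(ys, c). (z @ ys, (last z, c))) ` (SIGMA ys:cyc (S - set z) (last z). {c. 2 \<le> length ys \<longrightarrow> \<not> c})"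
    (is "?L = ?A \<union> ?B")
proof
  show "?L \<subseteq> ?A \<union> ?B"
  proof clarify
    fix xs y c
    assume xs: "xs \<in> paths S v" and j: "(y, c) \<in> moves xs" and st: "walk_step S xs (y, c) = Some z"
      and nB: "(xs, y, c) \<notin> ?B"
    have y: "y \<in> nb (last xs)" "y \<in> S"
      using j st by (auto simp: moves_def walk_step_def split: if_splits)
    show "(xs, y, c) \<in> ?A"
    proof (cases "y \<in> set xs")
      case False
      then have "z = xs @ [y]" using st y by (simp add: walk_step_def)
      moreover have "xs \<noteq> []" using xs by (simp add: paths_def)
      ultimately show ?thesis by auto
    next
      case True
      obtain as bs where s: "xs = as @ y # bs" "y \<notin> set as" using True by (meson split_list_first)
      have tw: "takeWhile (\<lambda>z. z \<noteq> y) xs = as" using s by (simp add: takeWhile_first)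
      have zas: "z = as @ [y]" and len: "2 \<le> length bs \<longrightarrow> \<not> c"
        using st y True s tw by (auto simp: walk_step_def Let_def split: if_splits)
      have "bs \<noteq> []" using s y nb_irrefl by auto
      then have "bs \<in> cyc (S - set z) (last z)"
        using xs s zas y by (auto simp: cyc_def paths_def walk_append walk_Cons split: if_splits)
      then have "(xs, y, c) \<in> ?B"
        using len zas s by (intro image_eqI[where x = "(bs, c)"]) auto
      with nB show ?thesis by contradiction
    qed
  qed
  show "?A \<union> ?B \<subseteq> ?L"
  proof (rule Un_least)
    show "?A \<subseteq> ?L"
    proof (cases "z = [v]")
      case False
      obtain xs y where zx: "z = xs @ [y]"
        using z by (cases z rule: rev_cases) (auto simp: paths_def)
      moreover have "xs \<noteq> []" using False z zx by (auto simp: paths_def)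
      ultimately have zx: "z = xs @ [y]" "xs \<noteq> []" by blast+
      then have "xs \<in> paths S v" "y \<in> nb (last xs)" "y \<in> S" "y \<notin> set xs"
        using z by (auto simp: paths_def walk_append)
      then show ?thesis using zx False by (auto simp: moves_def walk_step_def)
    qed simp
    show "?B \<subseteq> ?L"
    proof clarify
      fix ys c assume ys: "ys \<in> cyc (S - set z) (last z)" and c: "2 \<le> length ys \<longrightarrow> \<not> c"
      obtain as y where zas: "z = as @ [y]" using z by (cases z rule: rev_cases) (auto simp: paths_def)
      have 1: "z @ ys \<in> paths S v"
        using z ys by (cases as) (auto simp: paths_def cyc_def walk_append walk_Cons zas hd_append)
      have 2: "(last z, c) \<in> moves (z @ ys)" using ys by (auto simp: moves_def cyc_def)
      have yas: "y \<notin> set as" "y \<in> S" using z zas by (auto simp: paths_def)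
      then have "takeWhile (\<lambda>t. t \<noteq> y) (z @ ys) = as"
        unfolding zas by (simp add: takeWhile_first)
      then have "walk_step S (z @ ys) (last z, c) = Some z"
        using yas c by (auto simp: walk_step_def zas)
      with 1 2 show "z @ ys \<in> paths S v \<and> (last z, c) \<in> moves (z @ ys) \<and> walk_step S (z @ ys) (last z, c) = Some z"
        by blast
    qed
  qed
qed

text \<open>Give the path \<open>xs\<close> the weight
  \<open>card (nb (last xs)) * num (S - set xs)\<close>; each of its moves then carries
  \<open>num (S - set xs) / 2\<close>. The arrivals at \<open>z\<close> are the two terms of
  \<open>balance\<close> at the end of \<open>z\<close>: extensions of \<open>butlast z\<close>, and
  erased cycles, the long ones for one coin out of two. At \<open>[v]\<close> nothing arrives by
  extension, and the missing \<open>num S\<close> is the source of the flow.\<close>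

lemma walk_step_inflow:
  assumes S: "S \<subseteq> V" and z: "z \<in> paths S v"
  shows "(\<Sum>xs\<in>paths S v. real (num (S - set xs)) / 2 * card {j \<in> moves xs. walk_step S xs j = Some z})
    = real (card (nb (last z))) * num (S - set z) - of_bool (z = [v]) * real (num S)"
proof -
  let ?P = "\<lambda>xs j. xs \<in> paths S v \<and> j \<in> moves xs \<and> walk_step S xs j = Some z"
  let ?n = "\<lambda>xs. real (num (S - set xs))"
  let ?x = "last z"
  let ?C = "cyc (S - set z) ?x"
  let ?D = "SIGMA ys:?C. {c. 2 \<le> length ys \<longrightarrow> \<not> c}"
  have zS: "z \<noteq> []" "set z \<subseteq> S" "?x \<in> set z" "distinct z" "hd z = v" using z by (auto simp: paths_def)
  have finC: "finite ?C" using S by (intro finite_cyc) auto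
  have "(\<Sum>xs\<in>paths S v. ?n xs / 2 * card {j \<in> moves xs. walk_step S xs j = Some z})
      = (\<Sum>xs\<in>paths S v. \<Sum>j | j \<in> moves xs \<and> walk_step S xs j = Some z. ?n xs / 2)"
    by (simp add: mult.commute)
  also have "\<dots> = (\<Sum>(xs, j)\<in>(SIGMA xs:paths S v. {j \<in> moves xs. walk_step S xs j = Some z}). ?n xs / 2)"
    using finite_paths[OF S] finite_moves by (subst sum.Sigma) auto
  also have "(SIGMA xs:paths S v. {j \<in> moves xs. walk_step S xs j = Some z}) = {(xs, j). ?P xs j}"
    by auto
  also have "\<dots> = (if z = [v] then {} else {butlast z} \<times> ({?x} \<times> (UNIV :: bool set)))
      \<union> (\<lambda>(ys, c). (z @ ys, (?x, c))) ` ?D"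
    by (rule walk_step_predecessors[OF z])
  also have "(\<Sum>(xs, j)\<in>\<dots>. ?n xs / 2) = (\<Sum>(xs, j)\<in>(if z = [v] then {} else {butlast z} \<times> ({?x} \<times> (UNIV :: bool set))). ?n xs / 2)
      + (\<Sum>(xs, j)\<in>(\<lambda>(ys, c). (z @ ys, (?x, c))) ` ?D. ?n xs / 2)"
  proof (rule sum.union_disjoint)
    have "length (butlast z) < length (z @ ys)" for ys using zS(1) by (cases z) auto
    then have "butlast z \<noteq> z @ ys" for ys by (metis less_irrefl)
    then show "(if z = [v] then {} else {butlast z} \<times> ({?x} \<times> (UNIV :: bool set))) \<inter> (\<lambda>(ys, c). (z @ ys, (?x, c))) ` ?D = {}"
      by auto
  qed (use finC in auto)
  also have "(\<Sum>(xs, j)\<in>(\<lambda>(ys, c). (z @ ys, (?x, c))) ` ?D. ?n xs / 2) = (\<Sum>(ys, c)\<in>?D. ?n (z @ ys) / 2)"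
    by (subst sum.reindex) (auto simp: inj_on_def intro!: sum.cong)
  also have "\<dots> = (\<Sum>ys\<in>?C. \<Sum>c | 2 \<le> length ys \<longrightarrow> \<not> c. ?n (z @ ys) / 2)"
    using finC by (subst sum.Sigma) auto
  also have "\<dots> = (\<Sum>ys\<in>?C. (if 2 \<le> length ys then 1/2 else 1) * real (num (S - set z - set ys)))"
  proof (rule sum.cong[OF refl])
    fix ys :: "'a list"
    have "card {c :: bool. 2 \<le> length ys \<longrightarrow> \<not> c} = (if 2 \<le> length ys then 1 else 2)"
    proof (cases "2 \<le> length ys")
      case True
      then have "{c. 2 \<le> length ys \<longrightarrow> \<not> c} = {False}" by auto
      then show ?thesis using True by simp
    qed (simp add: card_UNIV_bool)
    moreover have "S - (set z \<union> set ys) = S - set z - set ys" by blast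
    ultimately show "(\<Sum>c | 2 \<le> length ys \<longrightarrow> \<not> c. ?n (z @ ys) / 2)
        = (if 2 \<le> length ys then 1/2 else 1) * real (num (S - set z - set ys))"
      by simp
  qed
  also have "(\<Sum>(xs, j)\<in>(if z = [v] then {} else {butlast z} \<times> ({?x} \<times> (UNIV :: bool set))). ?n xs / 2)
      = (if z = [v] then 0 else ?n (butlast z))"
    by (simp add: sum.cartesian_product[symmetric] UNIV_bool)
  finally have sum: "(\<Sum>xs\<in>paths S v. ?n xs / 2 * card {j \<in> moves xs. walk_step S xs j = Some z})
      = (if z = [v] then 0 else ?n (butlast z))
        + (\<Sum>ys\<in>?C. (if 2 \<le> length ys then 1/2 else 1) * real (num (S - set z - set ys)))" .
  \<comment> \<open>The end of \<open>z\<close> is put back so that \<open>balance\<close> can be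
    applied there.\<close>
  let ?S = "insert ?x (S - set z)"
  have xz: "?S - {?x} = S - set z" using zS by auto
  have "?S \<subseteq> V" using S zS(2,3) by blast
  from balance[OF insertI1 this, unfolded xz]
  have bal: "real (card (nb ?x)) * num (S - set z) = num ?S
      + (\<Sum>ys\<in>?C. (if 2 \<le> length ys then 1/2 else 1) * real (num (S - set z - set ys)))" .
  have "num ?S = (if z = [v] then num S else num (S - set (butlast z)))"
  proof (cases "z = [v]")
    case True
    then have "?S = S" using zS by auto
    then show ?thesis using True by simp
  next
    case False
    have "z = butlast z @ [?x]" using zS(1) by simp
    then have "set z = insert ?x (set (butlast z))" "?x \<notin> set (butlast z)"
      using zS(4) by (metis list.set(1) list.set(2) set_append Un_insert_right Un_empty_right, metis distinct_append disjoint_insert(1) list.set(2))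
    then have "?S = S - set (butlast z)" using zS by auto
    then show ?thesis using False by simp
  qed
  with bal sum show ?thesis by auto
qed

definition succ_prob :: "'a set \<Rightarrow> 'a \<Rightarrow> real" where
  "succ_prob S v = num S / (card (nb v) * num (S - {v}))"

definition time_pot :: "'a set \<Rightarrow> 'a list \<Rightarrow> ennreal" where
  "time_pot S = reward 1 moves (walk_step S) (\<lambda>_ _. 0)"

text \<open>An excursion also stops on coming back to \<open>[v]\<close>, which makes success and
  return its two outcomes.\<close>

definition excursion_step :: "'a set \<Rightarrow> 'a \<Rightarrow> 'a list \<Rightarrow> 'a \<times> bool \<Rightarrow> 'a list option" where
  "excursion_step S v xs j = (if walk_step S xs j = Some [v] then None else walk_step S xs j)"

definition succ_pot :: "'a set \<Rightarrow> 'a \<Rightarrow> 'a list \<Rightarrow> ennreal" where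
  "succ_pot S v = reward 0 moves (excursion_step S v) (\<lambda>xs j. of_bool (walk_step S xs j = None))"

definition return_pot :: "'a set \<Rightarrow> 'a \<Rightarrow> 'a list \<Rightarrow> ennreal" where
  "return_pot S v = reward 0 moves (excursion_step S v) (\<lambda>xs j. of_bool (walk_step S xs j = Some [v]))"

lemma time_pot_unfold:
  "1 + (\<Sum>j\<in>moves xs. case walk_step S xs j of None \<Rightarrow> 0 | Some z \<Rightarrow> time_pot S z) / of_nat (card (moves xs))
    = time_pot S xs"
  using reward_unfold[where a = 1 and rw = "\<lambda>_ _. 0" and J = moves and x = xs and nx = "walk_step S", folded time_pot_def]
  by (simp cong: option.case_cong)

lemma succ_pot_unfold:
  "(\<Sum>j\<in>moves xs. case walk_step S xs j of None \<Rightarrow> 1 | Some z \<Rightarrow> if z = [v] then 0 else succ_pot S v z)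
      / of_nat (card (moves xs)) = succ_pot S v xs"
proof -
  have "(case excursion_step S v xs j of None \<Rightarrow> ennreal (of_bool (walk_step S xs j = None)) | Some z \<Rightarrow> succ_pot S v z)
      = (case walk_step S xs j of None \<Rightarrow> 1 | Some z \<Rightarrow> if z = [v] then 0 else succ_pot S v z)" for j
    by (auto simp: excursion_step_def split: option.split)
  note eq = this
  show ?thesis
    using reward_unfold[where a = 0 and rw = "\<lambda>xs j. of_bool (walk_step S xs j = None)" and J = moves and x = xs and nx = "excursion_step S v", folded succ_pot_def]
    unfolding eq by simp
qed

lemma return_pot_unfold:
  "(\<Sum>j\<in>moves xs. case walk_step S xs j of None \<Rightarrow> 0 | Some z \<Rightarrow> if z = [v] then 1 else return_pot S v z)
      / of_nat (card (moves xs)) = return_pot S v xs"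
proof -
  have "(case excursion_step S v xs j of None \<Rightarrow> ennreal (of_bool (walk_step S xs j = Some [v])) | Some z \<Rightarrow> return_pot S v z)
      = (case walk_step S xs j of None \<Rightarrow> 0 | Some z \<Rightarrow> if z = [v] then 1 else return_pot S v z)" for j
    by (auto simp: excursion_step_def split: option.split)
  note eq = this
  show ?thesis
    using reward_unfold[where a = 0 and rw = "\<lambda>xs j. of_bool (walk_step S xs j = Some [v])" and J = moves and x = xs and nx = "excursion_step S v", folded return_pot_def]
    unfolding eq by simp
qed

text \<open>\<open>g\<close> stands for the expected visits to each path: by
  \<open>walk_step_inflow\<close> it solves the flow equation with a unit source at
  \<open>[v]\<close>, so it is admissible in \<open>reward_le\<close>. Its total bounds the time
  until success, and \<open>g [v] = 1 / succ_prob S v\<close> is the corresponding number of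
  excursions.\<close>

lemma potentials_at_start:
  assumes S: "S \<subseteq> V" and v: "v \<in> S" "nb v \<noteq> {}" and pos: "0 < num S" "0 < num (S - {v})"
  shows "time_pot S [v] \<le> ennreal (step_sum S v / num S)"
    and "succ_pot S v [v] \<le> ennreal (succ_prob S v)"
    and "return_pot S v [v] \<le> ennreal (1 - succ_prob S v)"
    and "0 < succ_prob S v" "succ_prob S v \<le> 1"
    and "1 / succ_prob S v \<le> step_sum S v / num S"
proof -
  let ?X = "paths S v"
  let ?n = "\<lambda>xs. real (num (S - set xs))"
  let ?d = "\<lambda>xs. real (card (nb (last xs)))"
  let ?N = "real (num S)"
  let ?T = "\<lambda>xs z. {j \<in> moves xs. walk_step S xs j = Some z}"
  define g where "g xs = ?d xs * ?n xs / ?N" for xs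
  define r where "r = succ_prob S v"
  have vX: "[v] \<in> ?X" using v by (auto simp: paths_def)
  have finX: "finite ?X" using finite_paths[OF S] .
  have N: "?N > 0" using pos by simp
  have g_nonneg: "0 \<le> g xs" for xs by (simp add: g_def)
  have dpos: "?d xs > 0" if "xs \<in> ?X" for xs
  proof -
    have "nb (last xs) \<noteq> {}"
    proof (cases xs rule: rev_cases)
      case (snoc ys x)
      then show ?thesis using that v nb_sym by (cases ys rule: rev_cases) (auto simp: paths_def walk_append)
    qed (use that in \<open>auto simp: paths_def\<close>)
    then show ?thesis by (simp add: card_gt_0_iff)
  qed
  have gd: "g xs / card (moves xs) = ?n xs / 2 / ?N" if "xs \<in> ?X" for xs
  proof -
    have "nb (last xs) \<noteq> {}" using dpos[OF that] by auto
    then show ?thesis by (simp add: g_def card_moves)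
  qed
  have inflow: "(\<Sum>xs\<in>?X. g xs / card (moves xs) * card (?T xs z)) = g z - of_bool (z = [v])" if z: "z \<in> ?X" for z
  proof -
    have "(\<Sum>xs\<in>?X. g xs / card (moves xs) * card (?T xs z)) = (\<Sum>xs\<in>?X. ?n xs / 2 * card (?T xs z)) / ?N"
      unfolding sum_divide_distrib by (rule sum.cong) (simp_all add: gd)
    also have "\<dots> = (?d z * ?n z - of_bool (z = [v]) * ?N) / ?N"
      by (simp only: walk_step_inflow[OF S z])
    also have "\<dots> = g z - of_bool (z = [v])" using N by (simp add: g_def field_simps)
    finally show ?thesis .
  qed
  have sum_g: "(\<Sum>xs\<in>?X. g xs) = step_sum S v / ?N"
    by (simp add: g_def step_sum_def sum_divide_distrib)
  have "time_pot S [v] \<le> ennreal (\<Sum>xs\<in>?X. g xs * (1 + (\<Sum>j | j \<in> moves xs \<and> walk_step S xs j = None. 0) / card (moves xs)))"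
    unfolding time_pot_def
    by (rule reward_le) (use finX vX finite_moves walk_step_paths g_nonneg inflow in auto)
  then show "time_pot S [v] \<le> ennreal (step_sum S v / num S)" by (simp add: sum_g)
  have g0: "g [v] > 0" using pos dpos[OF vX] by (simp add: g_def)
  have r: "r = 1 / g [v]" by (simp add: r_def succ_prob_def g_def)
  then have rpos: "r > 0" using g0 by simp
  then show "0 < succ_prob S v" by (simp add: r_def)
  \<comment> \<open>Visits during a single excursion: the scaling by \<open>r\<close> makes the
    start count once.\<close>
  define G where "G xs = g xs * r" for xs
  have Gd: "G xs / card (moves xs) = r * (g xs / card (moves xs))" for xs by (simp add: G_def)
  have G0: "G [v] = 1" using g0 r by (simp add: G_def)
  let ?E = "\<lambda>xs z. {j \<in> moves xs. excursion_step S v xs j = Some z}"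
  have E: "?E xs z = (if z = [v] then {} else ?T xs z)" for xs z
    by (auto simp: excursion_step_def)
  have exc: "of_bool (z = [v]) + (\<Sum>xs\<in>?X. G xs / card (moves xs) * card (?E xs z)) \<le> G z" if z: "z \<in> ?X" for z
  proof (cases "z = [v]")
    case False
    then have "(\<Sum>xs\<in>?X. G xs / card (moves xs) * card (?E xs z)) = r * (\<Sum>xs\<in>?X. g xs / card (moves xs) * card (?T xs z))"
      unfolding E Gd by (simp add: sum_distrib_left mult.assoc)
    then show ?thesis using False inflow[OF z] by (simp add: G_def)
  qed (simp add: E G0)
  have exc_closed: "z \<in> ?X" if "xs \<in> ?X" "j \<in> moves xs" "excursion_step S v xs j = Some z" for xs j z
    using that walk_step_paths[of xs S v j z] by (auto simp: excursion_step_def split: if_splits)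
  have bound: "reward 0 moves (excursion_step S v) (\<lambda>xs j. of_bool (Q xs j)) [v]
      \<le> ennreal (r * (\<Sum>xs\<in>?X. g xs / card (moves xs) * card {j \<in> moves xs. Q xs j}))"
    if Q: "\<And>xs j. Q xs j \<Longrightarrow> excursion_step S v xs j = None" for Q
  proof -
    have "reward 0 moves (excursion_step S v) (\<lambda>xs j. of_bool (Q xs j)) [v]
        \<le> ennreal (\<Sum>xs\<in>?X. G xs * (0 + (\<Sum>j | j \<in> moves xs \<and> excursion_step S v xs j = None. of_bool (Q xs j)) / card (moves xs)))"
      by (rule reward_le)
        (use finX vX finite_moves exc_closed g_nonneg rpos exc in \<open>auto simp: G_def\<close>)
    also have "(\<Sum>xs\<in>?X. G xs * (0 + (\<Sum>j | j \<in> moves xs \<and> excursion_step S v xs j = None. of_bool (Q xs j)) / card (moves xs)))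
        = r * (\<Sum>xs\<in>?X. g xs / card (moves xs) * card {j \<in> moves xs. Q xs j})"
    proof -
      have "(\<Sum>j | j \<in> moves xs \<and> excursion_step S v xs j = None. of_bool (Q xs j)) = real (card {j \<in> moves xs. Q xs j})" for xs
      proof -
        have "{j \<in> moves xs. excursion_step S v xs j = None} \<inter> {j. Q xs j} = {j \<in> moves xs. Q xs j}"
          using Q by auto
        then show ?thesis using finite_moves[of xs] by (simp add: sum_of_bool_eq Int_def)
      qed
      then show ?thesis by (simp add: sum_distrib_left G_def algebra_simps)
    qed
    finally show ?thesis .
  qed
  \<comment> \<open>All visits to \<open>[v]\<close> except the first are returns; scaled by
    \<open>r\<close> this becomes \<open>1 - r\<close>.\<close>
  have ret: "(\<Sum>xs\<in>?X. g xs / card (moves xs) * card (?T xs [v])) = g [v] - 1"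
    using inflow[OF vX] by simp
  then have "g [v] - 1 \<ge> 0"
    using g_nonneg by (metis (no_types, lifting) divide_nonneg_nonneg mult_nonneg_nonneg of_nat_0_le_iff sum_nonneg)
  then have "1 / g [v] \<le> 1" using g0 by simp
  then show "succ_prob S v \<le> 1" using r by (simp add: r_def)
  have "return_pot S v [v] \<le> ennreal (r * (g [v] - 1))"
    unfolding return_pot_def ret[symmetric] by (rule bound) (simp add: excursion_step_def)
  also have "r * (g [v] - 1) = 1 - r" using g0 by (simp add: r field_simps)
  finally show "return_pot S v [v] \<le> ennreal (1 - succ_prob S v)" by (simp add: r_def)
  \<comment> \<open>Conservation of flow: all visits except the one at the start are arrivals by a
    move, so the moves that end the walk carry total weight 1.\<close>
  have out: "(\<Sum>xs\<in>?X. g xs / card (moves xs) * card {j \<in> moves xs. walk_step S xs j = None}) = 1"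
  proof -
    have cardm: "real (card (moves xs)) = card {j \<in> moves xs. walk_step S xs j = None} + (\<Sum>z\<in>?X. card (?T xs z))"
      if xs: "xs \<in> ?X" for xs
    proof -
      have "moves xs = {j \<in> moves xs. walk_step S xs j = None} \<union> (\<Union>z\<in>?X. ?T xs z)"
        using walk_step_paths[OF xs] by (auto, metis option.exhaust)
      then have "card (moves xs) = card ({j \<in> moves xs. walk_step S xs j = None} \<union> (\<Union>z\<in>?X. ?T xs z))" by simp
      also have "\<dots> = card {j \<in> moves xs. walk_step S xs j = None} + card (\<Union>z\<in>?X. ?T xs z)"
        using finX finite_moves by (intro card_Un_disjoint) auto
      also have "card (\<Union>z\<in>?X. ?T xs z) = (\<Sum>z\<in>?X. card (?T xs z))"
        using finX finite_moves by (intro card_UN_disjoint) auto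
      finally show ?thesis by simp
    qed
    have "(\<Sum>xs\<in>?X. g xs) = (\<Sum>xs\<in>?X. g xs / card (moves xs) * card (moves xs))"
      by (intro sum.cong) (auto simp: card_moves g_def)
    also have "\<dots> = (\<Sum>xs\<in>?X. g xs / card (moves xs) * card {j \<in> moves xs. walk_step S xs j = None}
        + (\<Sum>z\<in>?X. g xs / card (moves xs) * card (?T xs z)))"
      by (intro sum.cong refl) (simp add: cardm distrib_left sum_distrib_left)
    also have "\<dots> = (\<Sum>xs\<in>?X. g xs / card (moves xs) * card {j \<in> moves xs. walk_step S xs j = None})
        + (\<Sum>z\<in>?X. \<Sum>xs\<in>?X. g xs / card (moves xs) * card (?T xs z))"
      unfolding sum.distrib by (subst (2) sum.swap) (rule refl)
    also have "(\<Sum>z\<in>?X. \<Sum>xs\<in>?X. g xs / card (moves xs) * card (?T xs z)) = (\<Sum>z\<in>?X. g z - of_bool (z = [v]))"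
      by (intro sum.cong refl inflow)
    also have "\<dots> = (\<Sum>z\<in>?X. g z) - 1"
      using finX vX by (simp add: sum_subtractf of_bool_def sum.delta)
    finally show ?thesis by simp
  qed
  have "succ_pot S v [v] \<le> ennreal (r * 1)"
    unfolding succ_pot_def out[symmetric] by (rule bound) (simp add: excursion_step_def)
  then show "succ_pot S v [v] \<le> ennreal (succ_prob S v)" by (simp add: r_def)
  have "g [v] \<le> (\<Sum>xs\<in>?X. g xs)" using finX vX g_nonneg by (intro member_le_sum) auto
  then show "1 / succ_prob S v \<le> step_sum S v / num S" using r sum_g by (simp add: r_def[symmetric])
qed

end

section \<open>Compositional rules for expected running time\<close>

section \<open>Hoare triples with expected time\<close>

text \<open>The postcondition holds on every outcome, while the cost is an expectation. Quantifying
  over \<open>F\<close> allows any probabilistic bound on the rest of the program to be plugged in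
  behind, and a free price \<open>a\<close> lets one triple serve both time and error.\<close>

definition ht :: "ennreal \<Rightarrow> nat \<Rightarrow> (mem \<Rightarrow> bool) \<Rightarrow> com \<Rightarrow> real \<Rightarrow> (mem \<Rightarrow> bool) \<Rightarrow> bool" where
  "ht a w P c T Q \<longleftrightarrow> (\<forall>s F G. P s \<longrightarrow> (\<forall>s'. Q s' \<longrightarrow> F s' \<le> G) \<longrightarrow> wp a w c F s \<le> a * ennreal T + G)"

lemma htD:
  assumes "ht a w P c T Q" "P s" "\<forall>s'. Q s' \<longrightarrow> F s' \<le> G"
  shows "wp a w c F s \<le> a * ennreal T + G"
  using assms(1)[unfolded ht_def, THEN spec[of _ s], THEN spec[of _ F], THEN spec[of _ G]] assms(2,3) by simp

lemma ht_seq: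
  assumes 1: "ht a w P c1 T1 R" and 2: "ht a w R c2 T2 Q" and T: "0 \<le> T1" "0 \<le> T2"
  shows "ht a w P (Seq c1 c2) (T1 + T2) Q"
  unfolding ht_def
proof (intro allI impI)
  fix s and F :: "mem \<Rightarrow> ennreal" and G :: ennreal assume s: "P s" and G: "\<forall>s'. Q s' \<longrightarrow> F s' \<le> G"
  have "wp a w (Seq c1 c2) F s \<le> a * ennreal T1 + (a * ennreal T2 + G)"
    unfolding wp.simps
  proof (rule htD[OF 1], rule s, intro allI impI)
    fix s' assume "R s'"
    then show "wp a w c2 F s' \<le> a * ennreal T2 + G" by (rule htD[OF 2]) (rule G)
  qed
  then show "wp a w (Seq c1 c2) F s \<le> a * ennreal (T1 + T2) + G"
    using T by (simp add: ennreal_plus distrib_left add.assoc)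
qed

lemma ht_conseq:
  assumes "ht a w P c T Q" "\<And>s. P' s \<Longrightarrow> P s" "\<And>s. Q s \<Longrightarrow> Q' s" "T \<le> T'"
  shows "ht a w P' c T' Q'"
  unfolding ht_def
proof (intro allI impI)
  fix s and F :: "mem \<Rightarrow> ennreal" and G :: ennreal assume s: "P' s" and G: "\<forall>s'. Q' s' \<longrightarrow> F s' \<le> G"
  have "wp a w c F s \<le> a * ennreal T + G"
    by (rule htD[OF assms(1)], rule assms(2), rule s) (use assms(3) G in blast)
  also have "\<dots> \<le> a * ennreal T' + G" using assms(4) by (intro add_right_mono mult_left_mono ennreal_leI) auto
  finally show "wp a w c F s \<le> a * ennreal T' + G" .
qed

text \<open>The cost of a round may depend on the number of rounds left; \<open>ht_stages\<close>
  needs this because the first stage is dearer than the others.\<close>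

lemma ht_while_gen:
  assumes b: "\<And>s. I s \<Longrightarrow> eval w s e \<noteq> 0 \<Longrightarrow> 0 < \<mu> s"
    and body: "\<And>k. ht a w (\<lambda>s. I s \<and> eval w s e \<noteq> 0 \<and> \<mu> s = Suc k) c (Tb k) (\<lambda>s. I s \<and> \<mu> s \<le> k)"
    and T: "\<And>k. 0 \<le> T k" "\<And>k. T k \<le> T (Suc k)" "1 \<le> T 0" "\<And>k. 1 + Tb k + T k \<le> T (Suc k)" "\<And>k. 0 \<le> Tb k"
  shows "ht a w (\<lambda>s. I s \<and> \<mu> s \<le> k) (While e c) (T k) (\<lambda>s. I s \<and> eval w s e = 0)"
  unfolding ht_def
proof (intro allI impI)
  fix s and F :: "mem \<Rightarrow> ennreal" and G :: ennreal assume s: "I s \<and> \<mu> s \<le> k" and G: "\<forall>s'. I s' \<and> eval w s' e = 0 \<longrightarrow> F s' \<le> G"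
  have "incseq T" using T(2) by (rule incseq_SucI)
  then have mono: "T i \<le> T j" if "i \<le> j" for i j using that by (rule incseqD)
  have "wp a w (While e c) F s \<le> a * ennreal (T (\<mu> s)) + G" if "I s" for s
    using that
  proof (induction "\<mu> s" arbitrary: s rule: less_induct)
    case less
    show ?case
    proof (cases "eval w s e = 0")
      case True
      have "1 \<le> ennreal (T (\<mu> s))" using T(3) mono[of 0 "\<mu> s"] by (simp add: ennreal_1[symmetric] del: ennreal_1)
      then have "a * 1 \<le> a * ennreal (T (\<mu> s))" by (intro mult_left_mono) auto
      then show ?thesis
        using True G less.prems by (subst wp_while_unfold) (auto intro!: add_mono simp del: wp.simps)
    next
      case False
      then obtain k where k: "\<mu> s = Suc k" using b[OF less.prems] by (cases "\<mu> s") auto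
      have "wp a w c (wp a w (While e c) F) s \<le> a * ennreal (Tb k) + (a * ennreal (T k) + G)"
      proof (rule htD[OF body], goal_cases)
        case 1
        show ?case using less.prems False k by simp
      next
        case 2
        show ?case
      proof (intro allI impI)
        fix s' assume s': "I s' \<and> \<mu> s' \<le> k"
        have "wp a w (While e c) F s' \<le> a * ennreal (T (\<mu> s')) + G"
          using s' k by (intro less.hyps) auto
        also have "\<dots> \<le> a * ennreal (T k) + G"
          using s' mono by (intro add_right_mono mult_left_mono ennreal_leI) auto
        finally show "wp a w (While e c) F s' \<le> a * ennreal (T k) + G" .
      qed
      qed
      then have "wp a w (While e c) F s \<le> a + (a * ennreal (Tb k) + (a * ennreal (T k) + G))"
        using False by (subst wp_while_unfold) (auto intro!: add_left_mono simp del: wp.simps)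
      also have "\<dots> = a * ennreal (1 + Tb k + T k) + G"
        using T by (simp add: ennreal_plus distrib_left add.assoc)
      also have "\<dots> \<le> a * ennreal (T (\<mu> s)) + G"
        unfolding k using T(4) by (intro add_right_mono mult_left_mono ennreal_leI) auto
      finally show ?thesis .
    qed
  qed
  then have "wp a w (While e c) F s \<le> a * ennreal (T (\<mu> s)) + G" using s by blast
  also have "\<dots> \<le> a * ennreal (T k) + G"
    using s mono by (intro add_right_mono mult_left_mono ennreal_leI) auto
  finally show "wp a w (While e c) F s \<le> a * ennreal (T k) + G" .
qed

lemma ht_while:
  assumes "\<And>s. I s \<Longrightarrow> eval w s e \<noteq> 0 \<Longrightarrow> 0 < \<mu> s"
    and "\<And>k. ht a w (\<lambda>s. I s \<and> eval w s e \<noteq> 0 \<and> \<mu> s = Suc k) c Tb (\<lambda>s. I s \<and> \<mu> s \<le> k)"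
    and "0 \<le> Tb"
  shows "ht a w (\<lambda>s. I s \<and> \<mu> s \<le> k) (While e c) (1 + (1 + Tb) * real k) (\<lambda>s. I s \<and> eval w s e = 0)"
  by (rule ht_while_gen[where Tb = "\<lambda>_. Tb"]) (use assms in \<open>auto simp: algebra_simps\<close>)

text \<open>On code without draws and loops the transformer reduces to one final memory, which
  simplification can compute. The clauses of \<open>run\<close> and \<open>len\<close> for
  \<open>Rand\<close> and \<open>While\<close> are placeholders.\<close>

primrec straight :: "com \<Rightarrow> bool" where
  "straight Skip = True"
| "straight (Store b i e) = True"
| "straight (Rand b i e) = False"
| "straight (Seq c1 c2) = (straight c1 \<and> straight c2)"
| "straight (If e c1 c2) = (straight c1 \<and> straight c2)"
| "straight (While e c) = False"

primrec run :: "nat \<Rightarrow> com \<Rightarrow> mem \<Rightarrow> mem" where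
  "run w Skip s = s"
| "run w (Store b i e) s = update s b (eval w s i) (eval w s e)"
| "run w (Rand b i e) s = s"
| "run w (Seq c1 c2) s = run w c2 (run w c1 s)"
| "run w (If e c1 c2) s = (if eval w s e \<noteq> 0 then run w c1 s else run w c2 s)"
| "run w (While e c) s = s"

primrec len :: "com \<Rightarrow> nat" where
  "len Skip = 1"
| "len (Store b i e) = 1"
| "len (Rand b i e) = 1"
| "len (Seq c1 c2) = len c1 + len c2"
| "len (If e c1 c2) = 1 + max (len c1) (len c2)"
| "len (While e c) = 1"

lemma wp_straight: "straight c \<Longrightarrow> wp a w c F s \<le> a * ennreal (real (len c)) + F (run w c s)"
proof (induction c arbitrary: F s)
  case (Seq c1 c2)
  have "wp a w (Seq c1 c2) F s \<le> a * ennreal (real (len c1)) + (a * ennreal (real (len c2)) + F (run w c2 (run w c1 s)))"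
    using Seq.prems unfolding wp.simps
    by (intro order.trans[OF Seq.IH(1)] add_left_mono Seq.IH(2)) auto
  then show ?case by (simp add: ennreal_plus distrib_left add.assoc)
next
  case (If e c1 c2)
  have *: "a + (a * ennreal (real (len c)) + G) \<le> a * ennreal (real (1 + m)) + G" if "len c \<le> m" for c m G
  proof -
    have "a + (a * ennreal (real (len c)) + G) = a * ennreal (real (1 + len c)) + G"
      by (simp add: ennreal_plus distrib_left add.assoc)
    also have "\<dots> \<le> a * ennreal (real (1 + m)) + G"
      using that by (intro add_right_mono mult_left_mono ennreal_leI) auto
    finally show ?thesis .
  qed
  show ?case
  proof (cases "eval w s e = 0")
    case False
    have "wp a w (If e c1 c2) F s \<le> a + (a * ennreal (real (len c1)) + F (run w c1 s))"
      using False If by (auto intro!: add_left_mono)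
    also have "\<dots> \<le> a * ennreal (real (1 + max (len c1) (len c2))) + F (run w c1 s)"
      by (rule *) simp
    finally show ?thesis using False by (simp only: len.simps run.simps simp_thms if_True)
  next
    case True
    have "wp a w (If e c1 c2) F s \<le> a + (a * ennreal (real (len c2)) + F (run w c2 s))"
      using True If by (auto intro!: add_left_mono)
    also have "\<dots> \<le> a * ennreal (real (1 + max (len c1) (len c2))) + F (run w c2 s)"
      by (rule *) simp
    finally show ?thesis using True by (simp only: len.simps run.simps simp_thms if_False)
  qed
qed auto

lemma ht_straight:
  assumes "straight c" "\<And>s. P s \<Longrightarrow> Q (run w c s)" "real (len c) \<le> T"
  shows "ht a w P c T Q"
  unfolding ht_def
proof (intro allI impI)
  fix s and F :: "mem \<Rightarrow> ennreal" and G :: ennreal assume s: "P s" and G: "\<forall>s'. Q s' \<longrightarrow> F s' \<le> G"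
  have "wp a w c F s \<le> a * ennreal (real (len c)) + F (run w c s)" using assms(1) by (rule wp_straight)
  also have "\<dots> \<le> a * ennreal T + G"
    using assms(2)[OF s] G assms(3) by (intro add_mono mult_left_mono ennreal_leI) auto
  finally show "wp a w c F s \<le> a * ennreal T + G" .
qed

section \<open>Registers, arrays and the program text\<close>

section \<open>The program\<close>

text \<open>Scalars are kept at index 0 of an array. 10 to 14 hold \<open>K\<close>,
  \<open>M\<close>, \<open>L\<close>, \<open>Q\<close>, \<open>ell\<close>; 4 the degrees, 5 the
  adjacency lists in rows of length \<open>n\<close>, 6 the flags of removed vertices, 7 the current
  path, 8 the position of a vertex on it, 9 the excursion count of each vertex. 15 is a loop index,
  16 and 17 are temporaries, 18 counts the removed vertices, 19 is the current \<open>v\<close>, 20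
  and 21 count excursions and successes, 22 is the length of the path, 23 and 24 are the random
  neighbour index and coin.\<close>

abbreviation gv :: "nat \<Rightarrow> exp" where "gv b \<equiv> Get b (Const 0)"
abbreviation sv :: "nat \<Rightarrow> exp \<Rightarrow> com" where "sv b e \<equiv> Store b (Const 0) e"
abbreviation incr :: "nat \<Rightarrow> com" where "incr b \<equiv> sv b (Add (gv b) (Const 1))"

fun block :: "com list \<Rightarrow> com" where
  "block [] = Skip"
| "block [c] = c"
| "block (c # d # cs) = Seq c (block (d # cs))"

definition c_params :: com where
  "c_params = block
    [sv 10 (Add (Div (Get 0 (Const 3)) (Get 0 (Const 2))) (Const 1)),
     sv 11 (Mul (Const 144) (Mul (gv 0) (Mul (gv 10) (gv 10)))),
     sv 12 (Mul (Const 48) (Mul (gv 11) (Mul (gv 0) (Mul (gv 0) (gv 0))))),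
     sv 13 (Const 1)]"

definition c_scale :: com where
  "c_scale = While (Less (gv 13) (gv 12)) (block [sv 13 (Mul (gv 13) (Const 2)), incr 14])"

definition c_edge :: com where
  "c_edge = block
    [sv 16 (Get 1 (gv 15)), sv 17 (Get 2 (gv 15)),
     Store 5 (Add (Mul (gv 16) (gv 0)) (Get 4 (gv 16))) (gv 17),
     Store 4 (gv 16) (Add (Get 4 (gv 16)) (Const 1)),
     Store 5 (Add (Mul (gv 17) (gv 0)) (Get 4 (gv 17))) (gv 16),
     Store 4 (gv 17) (Add (Get 4 (gv 17)) (Const 1)),
     incr 15]"

definition c_adj :: com where
  "c_adj = While (Less (gv 15) (Get 0 (Const 1))) c_edge"

definition c_scan_body :: com where
  "c_scan_body = block
    [sv 16 (Get 1 (gv 15)), sv 17 (Get 2 (gv 15)),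
     If (Less (Get 6 (gv 16)) (Get 6 (gv 17))) (sv 19 (gv 16))
       (If (Less (Get 6 (gv 17)) (Get 6 (gv 16))) (sv 19 (gv 17)) Skip),
     incr 15]"

text \<open>Any crossing edge will do, the last one wins. The default 0 is the vertex of the first
  stage, when no edge can cross.\<close>

definition c_scan :: com where
  "c_scan = Seq (block [sv 19 (Const 0), sv 15 (Const 0)]) (While (Less (gv 15) (Get 0 (Const 1))) c_scan_body)"

definition c_start :: com where
  "c_start = block
    [sv 20 (Const 0), sv 21 (Const 0), Store 7 (Const 0) (gv 19), Store 8 (gv 19) (Const 0), sv 22 (Const 1)]"

definition c_success :: com where
  "c_success = block [incr 21, sv 22 (Const 1)]"

text \<open>Array 8 is never cleared: a stale position is recognised because it is beyond the path
  or array 7 holds another vertex there. So membership takes one test, and erasing a loop is just a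
  shorter length. A success also resets the length to 1, so the final test counts both ways of
  ending an excursion.\<close>

definition c_move :: com where
  "c_move = block
    [sv 17 (Get 5 (Add (Mul (gv 16) (gv 0)) (gv 23))),
     If (Get 6 (gv 17)) c_success
       (If (Mul (Less (Get 8 (gv 17)) (gv 22)) (Equal (Get 7 (Get 8 (gv 17))) (gv 17)))
          (If (Mul (Less (Add (Get 8 (gv 17)) (Const 2)) (gv 22)) (gv 24))
             c_success
             (sv 22 (Add (Get 8 (gv 17)) (Const 1))))
          (block [Store 7 (gv 22) (gv 17), Store 8 (gv 17) (gv 22), incr 22])),
     If (Equal (gv 22) (Const 1)) (If (Less (gv 20) (gv 12)) (incr 20) Skip) Skip]"

definition c_walk_body :: com where
  "c_walk_body = Seq (sv 16 (Get 7 (Sub (gv 22) (Const 1))))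
     (Seq (Rand 23 (Const 0) (Get 4 (gv 16))) (Seq (Rand 24 (Const 0) (Const 2)) c_move))"

definition c_walk :: com where
  "c_walk = While (Less (gv 21) (gv 11)) c_walk_body"

definition c_finish :: com where
  "c_finish = block [Store 9 (gv 19) (gv 20), Store 6 (gv 19) (Const 1), incr 18]"

definition c_stage :: com where
  "c_stage = Seq c_scan (Seq c_start (Seq c_walk c_finish))"

definition c_stages :: com where
  "c_stages = While (Less (gv 18) (gv 0)) c_stage"

text \<open>The extra factor \<open>Q = 2 ^ ell\<close> keeps the precision through the integer
  division and is paid back by adding \<open>ell\<close> to the negative exponent;
  \<open>c_halve\<close> then brings the mantissa below \<open>2 * Q\<close>.\<close>

definition c_mult :: com where
  "c_mult = block
    [sv 3 (Div (Mul (Mul (gv 3) (Get 4 (gv 15))) (Mul (gv 11) (gv 13))) (Get 9 (gv 15))),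
     Store 3 (Const 2) (Add (Get 3 (Const 2)) (gv 14))]"

definition c_halve :: com where
  "c_halve = While (Less (Sub (Mul (gv 13) (Const 2)) (Const 1)) (gv 3))
     (block [sv 3 (Div (gv 3) (Const 2)), Store 3 (Const 1) (Add (Get 3 (Const 1)) (Const 1))])"

definition c_product :: com where
  "c_product = Seq (block [sv 3 (gv 13), Store 3 (Const 2) (gv 14), sv 15 (Const 0)])
     (While (Less (gv 15) (gv 0)) (Seq c_mult (Seq c_halve (incr 15))))"

definition prog :: com where
  "prog = Seq c_params (Seq c_scale (Seq c_adj (Seq c_stages c_product)))"

section \<open>Parameters, scaling and adjacency lists\<close>

section \<open>Initialisation\<close>

definition nbs :: "(nat \<times> nat) list \<Rightarrow> nat \<Rightarrow> nat list" where
  "nbs es u = concat (map (\<lambda>(x, y). if x = u then [y] else if y = u then [x] else []) es)"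

lemma nbs_snoc: "nbs (es @ [(x, y)]) u = nbs es u @ (if x = u then [y] else if y = u then [x] else [])"
  by (simp add: nbs_def)

lemma nbs_simps [simp]:
  "nbs [] u = []"
  "nbs ((x, y) # es) u = (if x = u then [y] else if y = u then [x] else []) @ nbs es u"
  by (simp_all add: nbs_def)

lemma set_nbs: "set (nbs es u) = {v. {u, v} \<in> set (map (\<lambda>(x, y). {x, y}) es)}"
proof (induction es)
  case (Cons e es)
  obtain x y where "e = (x, y)" by (cases e)
  with Cons show ?case by (auto simp: doubleton_eq_iff)
qed simp

lemma distinct_nbs: "distinct (map (\<lambda>(x, y). {x, y}) es) \<Longrightarrow> distinct (nbs es u)"
proof (induction es)
  case (Cons e es)
  obtain x y where e: "e = (x, y)" by (cases e)
  have "nbs (e # es) u = (if x = u then [y] else if y = u then [x] else []) @ nbs es u"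
    by (simp add: e)
  moreover have "distinct (nbs es u)" using Cons by simp
  moreover have "v \<notin> set (nbs es u)" if "{u, v} = {x, y}" for v
    using Cons.prems that unfolding set_nbs by (auto simp: e)
  ultimately show ?case by (auto simp: insert_commute)
qed (simp add: nbs_def)

lemma length_nbs_take_le: "length (nbs (take j es) u) \<le> length (nbs es u)"
proof -
  have "nbs (xs @ ys) u = nbs xs u @ nbs ys u" for xs ys by (simp add: nbs_def)
  from this[of "take j es" "drop j es"] show ?thesis by simp
qed

locale bicircular_instance =
  fixes n :: nat and E :: "nat set set" and es :: "(nat \<times> nat) list" and p q w :: nat
  assumes graph: "simple_graph {0..<n} E" and con: "connected_graph {0..<n} E" and nE: "n \<le> card E"
    and el: "edge_list E es" and pq: "0 < p" "p < 2 ^ w" "q < 2 ^ w" and n3: "3 \<le> n"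
    and m_less: "length es < 2 ^ w"
begin

sublocale ugraph "{0..<n}" E
  using graph by unfold_locales

text \<open>An integer at least \<open>q / p\<close>, standing for the reciprocal of the accuracy;
  it exceeds this by at most a factor of three.\<close>

definition K :: nat where "K = q div p + 1"
text \<open>Relative accuracy one third of the goal costs a factor 9 in Chebyshev's inequality; then
  144 = 2 * 9 * 8 makes the failure probability due to the variance at most 1/8, see
  \<open>pot_initial\<close>.\<close>

definition M :: nat where "M = 144 * (n * (K * K))"
text \<open>A stage needs \<open>M / r \<le> 6 * n ^ 2 * M\<close> excursions on average, so with 48
  = 6 * 8 Markov's inequality bounds the probability of reaching \<open>L\<close> by
  \<open>1 / (8 * n)\<close>, which is 1/8 over all stages.\<close>

definition L :: nat where "L = 48 * (M * (n * (n * n)))"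
definition ell :: nat where "ell = (LEAST k. L \<le> 2 ^ k)"
text \<open>The unit of the floating-point mantissas, which stay between \<open>Q\<close> and
  \<open>2 * Q\<close>.\<close>

definition Q :: nat where "Q = 2 ^ ell"

end

text \<open>\<open>8 * n * M * (L * L)\<close> dominates the products formed before a division, and
  with a further factor \<open>n\<close> also the sum of all exponents, crudely estimated.\<close>

locale bicircular_run = bicircular_instance +
  assumes big: "8 * n * n * M * L * L < 2 ^ w"
begin

lemma pos: "0 < n" "0 < K" "0 < M" "0 < L"
  using n3 by (auto simp: K_def M_def L_def)

lemma L_le_Q: "L \<le> Q"
proof -
  have "L \<le> 2 ^ L" by (simp add: less_imp_le)
  then show ?thesis unfolding Q_def ell_def by (rule LeastI)
qed

lemma Q_less: "Q < 2 * L"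
proof (cases ell)
  case 0
  then show ?thesis using pos by (simp add: Q_def)
next
  case (Suc k)
  have "k < ell" using Suc by simp
  then have "\<not> L \<le> 2 ^ k" unfolding ell_def by (rule not_less_Least)
  then show ?thesis using Suc by (simp add: Q_def)
qed

lemma bounds:
  shows "(200::nat) < 2 ^ w" "n * n < 2 ^ w" "n * (n * n) < 2 ^ w" "M * (n * (n * n)) < 2 ^ w" "L < 2 ^ w"
    "K < 2 ^ w" "K * K < 2 ^ w" "n * (K * K) < 2 ^ w" "M < 2 ^ w" "4 * L < 2 ^ w" "n < 2 ^ w"
    "8 * n * M * (L * L) < 2 ^ w"
proof -
  let ?B = "8 * n * n * M * L * L"
  have a: "x \<le> x * y" if "0 < y" for x y :: nat using that by simp
  have M144: "144 \<le> M" using pos by (simp add: M_def)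
  have LM: "48 * M \<le> L" "n * (n * n) \<le> L" "M * (n * (n * n)) \<le> L"
    using pos by (auto simp: L_def M_def)
  have "4 * L \<le> 4 * L * (2 * n * n * M * L)" by (rule a) (use pos in simp)
  also have "\<dots> = 8 * n * n * M * L * L" by (simp add: mult.assoc mult.left_commute mult.commute)
  finally have 4: "4 * L < 2 ^ w" using big by (rule order.strict_trans1)
  have "n * n \<le> n * (n * n)" "n \<le> n * n" using pos by auto
  moreover have "K * K \<le> n * (K * K)" "n * (K * K) \<le> M" "K \<le> K * K" using pos by (auto simp: M_def)
  moreover have "8 * n * M * (L * L) < 2 ^ w"
  proof -
    have "8 * n * M * (L * L) \<le> 8 * n * M * (L * L) * n" by (rule a) (use pos in simp)
    also have "\<dots> = 8 * n * n * M * L * L" by (simp add: mult.assoc mult.left_commute mult.commute)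
    finally show ?thesis using big by (rule order.strict_trans1)
  qed
  ultimately show "(200::nat) < 2 ^ w" "n * n < 2 ^ w" "n * (n * n) < 2 ^ w" "M * (n * (n * n)) < 2 ^ w" "L < 2 ^ w"
    "K < 2 ^ w" "K * K < 2 ^ w" "n * (K * K) < 2 ^ w" "M < 2 ^ w" "4 * L < 2 ^ w" "n < 2 ^ w"
    "8 * n * M * (L * L) < 2 ^ w"
    using 4 LM M144 by linarith+
qed

lemma const_mod: "k \<le> 200 \<Longrightarrow> k mod 2 ^ w = k" for k :: nat
  using bounds(1) by simp

lemma w_pos: "0 < w"
  using bounds(1) by (cases w) auto

lemmas const_simps = const_mod w_pos

lemma edge_facts:
  assumes "j < length es" "es ! j = (x, y)"
  shows "x < n" "y < n" "x \<noteq> y" "{x, y} \<in> E"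
proof -
  have "{x, y} \<in> set (map (\<lambda>(u, v). {u, v}) es)"
    using assms nth_mem[OF assms(1)] by force
  then show E: "{x, y} \<in> E" using el by (simp add: edge_list_def)
  then show "x < n" "y < n" "x \<noteq> y" using edge_subset[OF E] edge_card[OF E] by auto
qed

lemma set_nbs_nb: "set (nbs es u) = nb u" and distinct_nbs_es: "distinct (nbs es u)"
  using el set_nbs[of es u] distinct_nbs[of es u] by (auto simp: edge_list_def nb_def)

lemma length_nbs: "length (nbs es u) = card (nb u)"
  using set_nbs_nb distinct_nbs_es by (metis distinct_card)

lemma card_nb_less: "card (nb u) < n"
proof (cases "u < n")
  case True
  have "card (nb u) \<le> card ({0..<n} - {u})"
    using nb_subset nb_irrefl by (intro card_mono) auto
  then show ?thesis using True pos by simp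
next
  case False
  then have "nb u = {}" using nb_subset nb_sym by fastforce
  then show ?thesis using pos by simp
qed

lemma addr_inj: "i < n \<Longrightarrow> i' < n \<Longrightarrow> u * n + i = u' * n + i' \<longleftrightarrow> u = u' \<and> i = i'"
proof
  assume i: "i < n" "i' < n" "u * n + i = u' * n + i'"
  have 1: "(u * n + i) div n = u" and 2: "(u' * n + i') div n = u'" using i(1,2) by auto
  have "u = u'" using 1 2 unfolding i(3) by simp
  then show "u = u' \<and> i = i'" using i by auto
qed auto

lemma addr_less: "u < n \<Longrightarrow> i < n \<Longrightarrow> u * n + i < 2 ^ w"
proof -
  assume ui: "u < n" "i < n"
  have "u * n + i < Suc u * n" using ui by simp
  also have "\<dots> \<le> n * n" using ui by (intro mult_right_mono) auto
  finally show ?thesis using bounds(2) by simp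
qed

lemma addr_less_0: "u < n \<Longrightarrow> u * n < 2 ^ w"
  using addr_less[of u 0] pos(1) by simp

definition inp :: "mem \<Rightarrow> bool" where
  "inp s \<longleftrightarrow> s 0 0 = n \<and> s 0 (Suc 0) = length es \<and> (\<forall>j<length es. s 1 j = fst (es ! j) \<and> s 2 j = snd (es ! j))
     \<and> s 10 0 = K \<and> s 11 0 = M \<and> s 12 0 = L \<and> s 3 = (\<lambda>_. 0)"

definition par :: "mem \<Rightarrow> bool" where
  "par s \<longleftrightarrow> inp s \<and> s 13 0 = Q \<and> s 14 0 = ell"

definition zeros :: "mem \<Rightarrow> bool" where
  "zeros s \<longleftrightarrow> s 4 = (\<lambda>_. 0) \<and> s 15 0 = 0 \<and> s 18 0 = 0 \<and> s 6 = (\<lambda>_. 0)"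

lemma ht_params:
  "ht a w (\<lambda>s. s = input_mem n es p q) c_params 4
     (\<lambda>s. inp s \<and> zeros s \<and> s 13 0 = 2 ^ s 14 0 \<and> s 14 0 = 0)"
proof (rule ht_straight)
  fix s assume s: "s = input_mem n es p q"
  have "q div p \<le> q" by (rule div_le_dividend)
  have K: "Suc (q div p) = K" "Suc (q div p) mod 2 ^ w = K" using bounds(6) by (auto simp: K_def)
  show "inp (run w c_params s) \<and> zeros (run w c_params s)
      \<and> run w c_params s 13 0 = 2 ^ run w c_params s 14 0 \<and> run w c_params s 14 0 = 0"
    unfolding c_params_def s
    using bounds K
    by (simp add: update_def input_mem_def zero_padded_def const_simps inp_def zeros_def fun_eq_iff
        M_def[symmetric] L_def[symmetric])
qed (auto simp: c_params_def)

lemma ht_scale: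
  "ht a w (\<lambda>s. inp s \<and> zeros s \<and> s 13 0 = 2 ^ s 14 0 \<and> s 14 0 = 0) c_scale (1 + 3 * ell)
     (\<lambda>s. par s \<and> zeros s)"
proof -
  let ?I = "\<lambda>s. inp s \<and> zeros s \<and> s 13 0 = 2 ^ s 14 0 \<and> s 14 0 \<le> ell"
  have less: "x < ell" if "2 ^ x < L" for x
  proof (rule ccontr)
    assume "\<not> x < ell"
    then have "Q \<le> 2 ^ x" unfolding Q_def by (intro power_increasing) auto
    then show False using L_le_Q that by simp
  qed
  have ellW: "ell < 2 ^ w"
  proof -
    have "ell < 2 ^ ell" by (rule less_exp)
    then show ?thesis using Q_less bounds(10) unfolding Q_def by linarith
  qed
  have "ht a w (\<lambda>s. ?I s \<and> ell - s 14 0 \<le> ell) c_scale (1 + (1 + 2) * real ell)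
      (\<lambda>s. ?I s \<and> eval w s (Less (gv 13) (gv 12)) = 0)"
    unfolding c_scale_def
  proof (rule ht_while)
    fix s assume "?I s" "eval w s (Less (gv 13) (gv 12)) \<noteq> 0"
    then have "2 ^ s 14 0 < L" by (simp add: inp_def const_simps split: if_splits)
    then show "0 < ell - s 14 0" using less by simp
  next
    fix k
    show "ht a w (\<lambda>s. ?I s \<and> eval w s (Less (gv 13) (gv 12)) \<noteq> 0 \<and> ell - s 14 0 = Suc k)
        (block [sv 13 (Mul (gv 13) (Const 2)), incr 14]) 2 (\<lambda>s. ?I s \<and> ell - s 14 0 \<le> k)"
    proof (rule ht_straight)
      fix s assume s: "?I s \<and> eval w s (Less (gv 13) (gv 12)) \<noteq> 0 \<and> ell - s 14 0 = Suc k"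
      then have l: "2 ^ s 14 0 < L" by (simp add: inp_def const_simps split: if_splits)
      then have lt: "s 14 0 < ell" by (rule less)
      have m: "2 ^ s 14 0 * 2 mod 2 ^ w = (2 ^ s 14 0 * 2 :: nat)" "Suc (s 14 0) mod 2 ^ w = Suc (s 14 0)"
        using l bounds(10) lt ellW by auto
      have "ell - Suc (s 14 0) \<le> k" using s by linarith
      then show "(\<lambda>s. ?I s \<and> ell - s 14 0 \<le> k) (run w (block [sv 13 (Mul (gv 13) (Const 2)), incr 14]) s)"
        using s lt m by (simp add: update_def inp_def zeros_def const_simps)
    qed auto
  qed auto
  then show ?thesis
  proof (rule ht_conseq)
    fix s assume s: "?I s \<and> eval w s (Less (gv 13) (gv 12)) = 0"
    then have "L \<le> 2 ^ s 14 0" using bounds(1) by (simp add: inp_def const_simps split: if_splits)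
    then have "ell \<le> s 14 0" unfolding ell_def by (rule Least_le)
    then show "par s \<and> zeros s" using s by (simp add: par_def Q_def)
  qed auto
qed

definition adj_upto :: "nat \<Rightarrow> mem \<Rightarrow> bool" where
  "adj_upto j s \<longleftrightarrow> (\<forall>u<n. s 4 u = length (nbs (take j es) u)
     \<and> (\<forall>i<length (nbs (take j es) u). s 5 (u * n + i) = nbs (take j es) u ! i))"

text \<open>The degree counted so far is also the next free position in the row of a vertex. Rows of
  length \<open>n\<close> suffice because degrees are below \<open>n\<close>.\<close>

lemma ht_adj:
  "ht a w (\<lambda>s. par s \<and> zeros s) c_adj (1 + 8 * length es)
     (\<lambda>s. par s \<and> adj_upto (length es) s \<and> s 18 0 = 0 \<and> s 6 = (\<lambda>_. 0))"
proof -
  let ?I = "\<lambda>s. par s \<and> adj_upto (s 15 0) s \<and> s 15 0 \<le> length es \<and> s 18 0 = 0 \<and> s 6 = (\<lambda>_. 0)"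
  have "ht a w (\<lambda>s. ?I s \<and> length es - s 15 0 \<le> length es) c_adj (1 + (1 + 7) * real (length es))
      (\<lambda>s. ?I s \<and> eval w s (Less (gv 15) (Get 0 (Const 1))) = 0)"
    unfolding c_adj_def
  proof (rule ht_while)
    fix s assume "?I s" "eval w s (Less (gv 15) (Get 0 (Const 1))) \<noteq> 0"
    then show "0 < length es - s 15 0" by (simp add: par_def inp_def const_simps split: if_splits)
  next
    fix k
    show "ht a w (\<lambda>s. ?I s \<and> eval w s (Less (gv 15) (Get 0 (Const 1))) \<noteq> 0 \<and> length es - s 15 0 = Suc k)
        c_edge 7 (\<lambda>s. ?I s \<and> length es - s 15 0 \<le> k)"
    proof (rule ht_straight)
      fix s assume s: "?I s \<and> eval w s (Less (gv 15) (Get 0 (Const 1))) \<noteq> 0 \<and> length es - s 15 0 = Suc k"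
      define j where "j = s 15 0"
      have j: "j < length es" using s by (simp add: j_def par_def inp_def const_simps split: if_splits)
      obtain x y where xy: "es ! j = (x, y)" by (cases "es ! j")
      note ef = edge_facts[OF j xy]
      have rd: "s 1 j = x" "s 2 j = y" "s 0 0 = n" using s j xy by (auto simp: par_def inp_def)
      have tk: "take (Suc j) es = take j es @ [(x, y)]" using j xy by (simp add: take_Suc_conv_app_nth)
      have dle: "length (nbs (take j es) u) < n" for u
        using length_nbs_take_le[of j es u] length_nbs[of u] card_nb_less[of u] by linarith
      have deg: "s 4 u = length (nbs (take j es) u)" if "u < n" for u
        using s that by (auto simp: adj_upto_def j_def)
      have dW: "Suc (length (nbs (take j es) u)) < 2 ^ w" for u
        using dle[of u] bounds(11) by linarith
      have md: "(x * n + length (nbs (take j es) x)) mod 2 ^ w = x * n + length (nbs (take j es) x)"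
        "(y * n + length (nbs (take j es) y)) mod 2 ^ w = y * n + length (nbs (take j es) y)"
        "x * n mod 2 ^ w = x * n" "y * n mod 2 ^ w = y * n"
        "Suc (length (nbs (take j es) x)) mod 2 ^ w = Suc (length (nbs (take j es) x))"
        "Suc (length (nbs (take j es) y)) mod 2 ^ w = Suc (length (nbs (take j es) y))"
        "Suc j mod 2 ^ w = Suc j"
        using addr_less addr_less_0 ef dle dW[of x] dW[of y] j m_less by (auto simp: mod_less)
      let ?s = "run w c_edge s"
      let ?a = "x * n + length (nbs (take j es) x)" and ?b = "y * n + length (nbs (take j es) y)"
      have r: "?s b = (if b = 15 then (s 15)(0 := Suc j)
          else if b = 4 then (s 4)(x := Suc (length (nbs (take j es) x)), y := Suc (length (nbs (take j es) y)))
          else if b = 5 then (s 5)(?a := y, ?b := x)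
          else if b = 16 then (s 16)(0 := x) else if b = 17 then (s 17)(0 := y) else s b)" for b
        unfolding c_edge_def
        using ef(1-3) deg[OF ef(1)] deg[OF ef(2)] md rd
        by (simp add: update_def const_simps j_def[symmetric])
      have "adj_upto (Suc j) ?s"
        unfolding adj_upto_def
      proof (intro allI impI)
        fix u assume u: "u < n"
        have old: "s 5 (u * n + i) = nbs (take j es) u ! i" if "i < length (nbs (take j es) u)" for i
          using s u that by (auto simp: adj_upto_def j_def)
        have ne: "u * n + i \<noteq> ?a \<or> (u = x \<and> i = length (nbs (take j es) x))"
          "u * n + i \<noteq> ?b \<or> (u = y \<and> i = length (nbs (take j es) y))" if "i \<le> length (nbs (take j es) u)" for i
          using addr_inj[of i "length (nbs (take j es) x)" u x] addr_inj[of i "length (nbs (take j es) y)" u y]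
            dle[of x] dle[of y] dle[of u] that by auto
        have nbu: "nbs (take (Suc j) es) u = nbs (take j es) u @ (if x = u then [y] else if y = u then [x] else [])"
          unfolding tk by (rule nbs_snoc)
        have "?s 5 (u * n + i) = nbs (take (Suc j) es) u ! i" if i: "i < length (nbs (take (Suc j) es) u)" for i
          using old[of i] ne[of i] i ef(3) unfolding nbu r
          by (auto simp: nth_append split: if_splits)
        moreover have "?s 4 u = length (nbs (take (Suc j) es) u)"
          using deg[OF u] ef(3) unfolding nbu r by auto
        ultimately show "?s 4 u = length (nbs (take (Suc j) es) u)
            \<and> (\<forall>i<length (nbs (take (Suc j) es) u). ?s 5 (u * n + i) = nbs (take (Suc j) es) u ! i)"
          by blast
      qed
      moreover have "par ?s \<and> ?s 15 0 = Suc j \<and> ?s 18 0 = 0 \<and> ?s 6 = (\<lambda>_. 0)"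
        using s by (simp add: r par_def inp_def)
      moreover have "length es - Suc j \<le> k" using s unfolding j_def by linarith
      ultimately show "?I ?s \<and> length es - ?s 15 0 \<le> k" using j by simp
    qed (auto simp: c_edge_def)
  qed auto
  then show ?thesis
  proof (rule ht_conseq)
    fix s assume s: "par s \<and> zeros s"
    then show "?I s \<and> length es - s 15 0 \<le> length es"
      by (simp add: zeros_def adj_upto_def nbs_def)
  next
    fix s assume s: "?I s \<and> eval w s (Less (gv 15) (Get 0 (Const 1))) = 0"
    then have "s 15 0 = length es"
      using bounds(1) by (simp add: par_def inp_def const_simps split: if_splits)
    then show "par s \<and> adj_upto (length es) s \<and> s 18 0 = 0 \<and> s 6 = (\<lambda>_. 0)" using s by simp
  qed auto
qed

end

context bicircular_run
begin

section \<open>Scanning for a vertex next to the removed ones\<close>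

section \<open>Choosing the next vertex\<close>

definition stage_inv :: "nat set \<Rightarrow> mem \<Rightarrow> bool" where
  "stage_inv R s \<longleftrightarrow> par s \<and> adj_upto (length es) s \<and> R \<subseteq> {0..<n} \<and> (\<forall>u<n. s 6 u = of_bool (u \<in> R))
     \<and> s 18 0 = card R \<and> (\<forall>u\<in>R. M \<le> s 9 u \<and> s 9 u \<le> L)"

text \<open>The listed arrays are the working space of a stage, which the invariant does not
  read.\<close>

lemma stage_inv_cong:
  "stage_inv R s \<Longrightarrow> (\<And>b. b \<notin> {7, 8, 15, 16, 17, 19, 20, 21, 22, 23, 24} \<Longrightarrow> s' b = s b) \<Longrightarrow> stage_inv R s'"
  by (simp add: stage_inv_def par_def inp_def adj_upto_def)

definition crosses :: "nat set \<Rightarrow> nat \<Rightarrow> bool" where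
  "crosses R i \<longleftrightarrow> (fst (es ! i) \<in> R) \<noteq> (snd (es ! i) \<in> R)"

definition scan_inv :: "nat set \<Rightarrow> nat \<Rightarrow> nat \<Rightarrow> bool" where
  "scan_inv R j v \<longleftrightarrow> ((\<forall>i<j. \<not> crosses R i) \<longrightarrow> v = 0) \<and>
     ((\<exists>i<j. crosses R i) \<longrightarrow> v < n \<and> v \<notin> R \<and> nb v \<inter> R \<noteq> {})"

lemma ht_scan:
  assumes R: "R \<noteq> {0..<n}"
  shows "ht a w (\<lambda>s. stage_inv R s \<and> s 9 = C) c_scan (3 + 7 * real (length es))
    (\<lambda>s. stage_inv R s \<and> s 9 = C \<and> s 19 0 \<in> {0..<n} - R \<and> (R \<noteq> {} \<longrightarrow> nb (s 19 0) \<inter> R \<noteq> {}))"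
proof -
  let ?I = "\<lambda>s. stage_inv R s \<and> s 9 = C \<and> s 15 0 \<le> length es \<and> scan_inv R (s 15 0) (s 19 0)"
  let ?e = "Less (gv 15) (Get 0 (Const 1))"
  have init: "ht a w (\<lambda>s. stage_inv R s \<and> s 9 = C) (block [sv 19 (Const 0), sv 15 (Const 0)]) 2
      (\<lambda>s. ?I s \<and> length es - s 15 0 \<le> length es)"
  proof (rule ht_straight)
    fix s assume s: "stage_inv R s \<and> s 9 = C"
    then have "\<forall>u\<in>R. M \<le> C u \<and> C u \<le> L" by (auto simp: stage_inv_def)
    with s show "?I (run w (block [sv 19 (Const 0), sv 15 (Const 0)]) s) \<and>
        length es - run w (block [sv 19 (Const 0), sv 15 (Const 0)]) s 15 0 \<le> length es"
      by (simp add: update_def stage_inv_def par_def inp_def adj_upto_def scan_inv_def)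
  qed auto
  have loop: "ht a w (\<lambda>s. ?I s \<and> length es - s 15 0 \<le> length es) (While ?e c_scan_body) (1 + (1 + 6) * real (length es))
      (\<lambda>s. ?I s \<and> eval w s ?e = 0)"
  proof (rule ht_while)
    fix s assume "?I s" "eval w s ?e \<noteq> 0"
    then show "0 < length es - s 15 0" by (simp add: stage_inv_def par_def inp_def const_simps split: if_splits)
  next
    fix k
    show "ht a w (\<lambda>s. ?I s \<and> eval w s ?e \<noteq> 0 \<and> length es - s 15 0 = Suc k) c_scan_body 6
        (\<lambda>s. ?I s \<and> length es - s 15 0 \<le> k)"
    proof (rule ht_straight)
      fix s assume s: "?I s \<and> eval w s ?e \<noteq> 0 \<and> length es - s 15 0 = Suc k"
      define j where "j = s 15 0"
      have j: "j < length es" using s by (simp add: j_def stage_inv_def par_def inp_def const_simps split: if_splits)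
      obtain x y where xy: "es ! j = (x, y)" by (cases "es ! j")
      note ef = edge_facts[OF j xy]
      have rd: "s 1 j = x" "s 2 j = y" "s 6 x = of_bool (x \<in> R)" "s 6 y = of_bool (y \<in> R)"
        using s j xy ef by (auto simp: stage_inv_def par_def inp_def)
      have jW: "Suc j mod 2 ^ w = Suc j" using j m_less by (simp add: mod_less)
      have ob: "of_bool P mod 2 ^ w = (of_bool P :: nat)" for P using w_pos by (cases P) auto
      let ?s = "run w c_scan_body s"
      let ?v = "if x \<notin> R \<and> y \<in> R then x else if y \<notin> R \<and> x \<in> R then y else s 19 0"
      have r: "?s b = (if b = 15 then (s 15)(0 := Suc j) else if b = 16 then (s 16)(0 := x)
          else if b = 17 then (s 17)(0 := y) else if b = 19 then (s 19)(0 := ?v) else s b)" for b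
        unfolding c_scan_body_def using rd jW
        by (simp add: update_def const_simps ob j_def[symmetric])
      have "scan_inv R (Suc j) ?v"
      proof -
        have cr: "crosses R j \<longleftrightarrow> (x \<in> R) \<noteq> (y \<in> R)" by (simp add: crosses_def xy)
        have old: "scan_inv R j (s 19 0)" using s by (simp add: j_def)
        have "y \<in> nb x" "x \<in> nb y" using ef(4) by (auto simp: nb_def insert_commute)
        then show ?thesis using old ef cr by (auto simp: scan_inv_def less_Suc_eq)
      qed
      moreover have "stage_inv R ?s"
        using s by (intro stage_inv_cong[of R s ?s]) (auto simp: r)
      moreover have "?s 9 = C \<and> ?s 15 0 = Suc j \<and> ?s 19 0 = ?v"
        using s by (simp add: r)
      moreover have "length es - Suc j \<le> k" using s unfolding j_def by linarith
      ultimately show "?I ?s \<and> length es - ?s 15 0 \<le> k" using j by simp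
    qed (auto simp: c_scan_body_def)
  qed auto
  have "ht a w (\<lambda>s. stage_inv R s \<and> s 9 = C) c_scan (2 + (1 + (1 + 6) * real (length es))) (\<lambda>s. ?I s \<and> eval w s ?e = 0)"
    unfolding c_scan_def by (rule ht_seq[OF init loop]) auto
  then show ?thesis
  proof (rule ht_conseq)
    fix s assume s: "?I s \<and> eval w s ?e = 0"
    then have j: "s 15 0 = length es" by (simp add: stage_inv_def par_def inp_def const_simps split: if_splits)
    have inv: "scan_inv R (length es) (s 19 0)" "R \<subseteq> {0..<n}" using s j by (auto simp: stage_inv_def)
    have "s 19 0 \<in> {0..<n} - R \<and> (R \<noteq> {} \<longrightarrow> nb (s 19 0) \<inter> R \<noteq> {})"
    proof (cases "\<exists>i<length es. crosses R i")
      case True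
      then show ?thesis using inv by (auto simp: scan_inv_def)
    next
      \<comment> \<open>By connectivity the absence of a crossing edge means that nothing has been
        removed, and the default vertex 0 qualifies.\<close>
      case False
      have "R = {}"
      proof (rule ccontr)
        assume "R \<noteq> {}"
        then obtain u b where ub: "u \<in> {0..<n} - R" "b \<in> nb u" "b \<notin> {0..<n} - R"
          using connected_exit[OF con, of "{0..<n} - R"] R inv(2) by blast
        then have "b \<in> R" using nb_subset[of u] by auto
        have "{u, b} \<in> set (map (\<lambda>(u, v). {u, v}) es)" using ub el by (simp add: nb_def edge_list_def)
        then obtain i x y where i: "i < length es" "es ! i = (x, y)" "{u, b} = {x, y}"
          by (auto simp: in_set_conv_nth image_iff)
        then have "crosses R i" using ub \<open>b \<in> R\<close> by (auto simp: crosses_def doubleton_eq_iff)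
        then show False using False i by blast
      qed
      moreover have "s 19 0 = 0" using False inv by (auto simp: scan_inv_def)
      ultimately show ?thesis using pos by simp
    qed
    then show "stage_inv R s \<and> s 9 = C \<and> s 19 0 \<in> {0..<n} - R \<and> (R \<noteq> {} \<longrightarrow> nb (s 19 0) \<inter> R \<noteq> {})"
      using s by simp
  qed auto
qed

section \<open>Rounding errors in the product of the stage estimates\<close>

section \<open>The floating-point product\<close>

lemma nb_nonempty: "u < n \<Longrightarrow> 0 < card (nb u)"
proof -
  assume u: "u < n"
  have "card {u} \<noteq> card {0..<n}" using n3 by simp
  then have "{u} \<noteq> {0..<n}" by metis
  then obtain b where "b \<in> nb u" using connected_exit[OF con, of "{u}"] u by auto
  then show ?thesis by (auto simp: card_gt_0_iff)
qed

text \<open>\<open>M / C u\<close> estimates the success probability of the stage of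
  \<open>u\<close>, so this estimates the ratio of the two consecutive values of
  \<open>num\<close>.\<close>

definition fac :: "(nat \<Rightarrow> nat) \<Rightarrow> nat \<Rightarrow> real" where
  "fac C u = card (nb u) * M / C u"

definition H :: nat where "H = floor_log (8 * n * M * (L * L))"

definition prod_inv :: "(nat \<Rightarrow> nat) \<Rightarrow> nat \<Rightarrow> mem \<Rightarrow> bool" where
  "prod_inv C i s \<longleftrightarrow> s 0 0 = n \<and> s 11 0 = M \<and> s 13 0 = Q \<and> s 14 0 = ell \<and> (\<forall>u<n. s 4 u = card (nb u)) \<and> s 9 = C
     \<and> s 15 0 = i \<and> i \<le> n"

text \<open>All rounding is downwards, so the exact product stays an upper bound, and every factor
  loses at most the fraction \<open>1 / Q\<close>.\<close>

definition est_inv :: "(nat \<Rightarrow> nat) \<Rightarrow> nat \<Rightarrow> mem \<Rightarrow> bool" where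
  "est_inv C i s \<longleftrightarrow> Q \<le> s 3 0 \<and> s 3 0 < 2 * Q \<and> s 3 2 = ell * Suc i \<and> s 3 1 \<le> i * H
     \<and> (1 - 1 / real Q) ^ i * (\<Prod>u<i. fac C u) \<le> estimate s \<and> estimate s \<le> (\<Prod>u<i. fac C u)"

text \<open>A division by \<open>c\<close> followed by \<open>k\<close> halvings is one division by
  \<open>c * 2 ^ k\<close>, hence rounded once. Less than 1 is lost from a result that is at least
  \<open>Q\<close>.\<close>

lemma round_bounds:
  fixes Y c k Q :: nat
  assumes "0 < c" "0 < Q" "Q \<le> Y div (c * 2 ^ k)"
  shows "real (Y div (c * 2 ^ k)) \<le> Y / (c * 2 ^ k)"
    and "(1 - 1 / real Q) * (Y / (c * 2 ^ k)) \<le> real (Y div (c * 2 ^ k))"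
proof -
  let ?m = "Y div (c * 2 ^ k)" and ?t = "real Y / (real c * 2 ^ k)"
  have t: "real ?m = of_int \<lfloor>?t\<rfloor>"
    using floor_divide_of_nat_eq[of Y "c * 2 ^ k", where ?'a = real] by simp
  then show "real ?m \<le> Y / (c * 2 ^ k)" by simp
  have "?t < real ?m + 1" unfolding t by linarith
  moreover have "(1 - 1 / real Q) * (real ?m + 1) \<le> real ?m"
  proof -
    have "real Q \<le> real ?m + 1" using assms(3) by linarith
    then have "1 \<le> (real ?m + 1) / Q" using assms(2) by simp
    then show ?thesis by (simp add: algebra_simps add_divide_distrib)
  qed
  moreover have "0 \<le> 1 - 1 / real Q" using assms(2) by simp
  ultimately show "(1 - 1 / real Q) * (Y / (c * 2 ^ k)) \<le> real ?m"
    using mult_left_mono[of ?t "real ?m + 1" "1 - 1 / real Q"] by simp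
qed

lemma ht_product_body:
  assumes C: "\<And>u. u < n \<Longrightarrow> M \<le> C u \<and> C u \<le> L" and i: "i < n"
  shows "ht a w (\<lambda>s. prod_inv C i s \<and> est_inv C i s) (Seq c_mult (Seq c_halve (incr 15))) (4 + 3 * real H)
    (\<lambda>s. prod_inv C (Suc i) s \<and> est_inv C (Suc i) s)"
proof -
  have Q0: "0 < Q" "Q < 2 * L" "L \<le> Q" using Q_less L_le_Q pos by auto
  have Ci: "0 < C i" "C i \<le> L" using C[OF i] pos by auto
  have d: "0 < card (nb i)" "card (nb i) < n" using nb_nonempty[OF i] card_nb_less by auto
  have ellQ: "ell < Q" unfolding Q_def by (rule less_exp)
  have H_le: "H \<le> 8 * n * M * (L * L)"
    unfolding H_def by (rule order_trans[OF less_imp_le[OF less_exp] floor_log_exp2_le]) (use pos in simp)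
  let ?X = "\<lambda>m. m * card (nb i) * (M * Q) div C i"
  have Ybound: "m * card (nb i) * (M * Q) \<le> 8 * n * M * (L * L)" if "m < 2 * Q" for m
  proof -
    have "m * card (nb i) * (M * Q) \<le> (4 * L) * n * (M * (2 * L))"
      using that Q0 d by (intro mult_le_mono) auto
    then show ?thesis by (simp add: mult.assoc mult.left_commute mult.commute)
  qed
  have small: "m * card (nb i) mod 2 ^ w = m * card (nb i)" "M * Q mod 2 ^ w = M * Q"
    "m * card (nb i) * (M * Q) mod 2 ^ w = m * card (nb i) * (M * Q)" if m: "m < 2 * Q" "Q \<le> m" for m
  proof -
    have Y: "m * card (nb i) * (M * Q) < 2 ^ w" using Ybound[OF m(1)] bounds(12) by (rule order.strict_trans1)
    have 1: "m * card (nb i) \<le> m * card (nb i) * (M * Q)" and 2: "M * Q \<le> m * card (nb i) * (M * Q)"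
      using pos Q0 m d by auto
    show "m * card (nb i) mod 2 ^ w = m * card (nb i)" "M * Q mod 2 ^ w = M * Q"
      "m * card (nb i) * (M * Q) mod 2 ^ w = m * card (nb i) * (M * Q)"
      using order.strict_trans1[OF 1 Y] order.strict_trans1[OF 2 Y] Y by (simp_all only: mod_less)
  qed
  have nL: "4 * n * L < 2 ^ w"
  proof -
    have "4 * n * L \<le> 4 * n * L * (2 * M * L)" using pos by simp
    also have "\<dots> = 8 * n * M * (L * L)" by (simp add: mult.assoc mult.left_commute mult.commute)
    finally show ?thesis using bounds(12) by (rule order.strict_trans1)
  qed
  have e2: "ell * Suc i + ell < 2 ^ w"
  proof -
    have "ell * Suc i + ell = ell * (i + 2)" by simp
    also have "\<dots> \<le> (2 * L) * (2 * n)" using ellQ Q0 i by (intro mult_le_mono) auto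
    finally show ?thesis using nL by (simp add: mult.assoc mult.left_commute mult.commute)
  qed
  let ?P = "\<lambda>e m0 X s. prod_inv C i s \<and> s 3 2 = ell * Suc (Suc i)
      \<and> (\<exists>k. s 3 1 = e + k \<and> s 3 0 = X div 2 ^ k \<and> Q \<le> s 3 0)"
  have nH: "e + k < 2 ^ w - 1" if "e \<le> i * H" "k \<le> H" "0 < k \<or> True" for e k
  proof -
    have "e + k \<le> i * H + H" using that by simp
    also have "\<dots> \<le> n * H" using i by (metis Suc_leI add.commute mult_Suc mult_le_mono1)
    also have "\<dots> \<le> n * (8 * n * M * (L * L))" using H_le by simp
    finally have 1: "e + k \<le> n * (8 * n * M * (L * L))" .
    have eq: "n * (8 * n * M * (L * L)) = 8 * n * n * M * L * L" by (simp add: mult.assoc mult.left_commute mult.commute)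
    \<comment> \<open>Both numbers are even, which sharpens \<open>< 2 ^ w\<close> to
      \<open>< 2 ^ w - 1\<close> and leaves room for one more increment.\<close>
    have "even (n * (8 * n * M * (L * L)))" "even ((2::nat) ^ w)" using w_pos by auto
    then have "n * (8 * n * M * (L * L)) \<noteq> 2 ^ w - 1" by (metis dvd_diffD1 even_add odd_one one_le_numeral one_le_power)
    then show ?thesis using 1 big unfolding eq[symmetric] by linarith
  qed
  \<comment> \<open>A postcondition cannot refer to the initial memory, so mantissa, exponent and
    estimate on entry are fixed as \<open>m\<close>, \<open>e\<close> and \<open>x\<close>.\<close>
  have main: "ht a w (\<lambda>s. prod_inv C i s \<and> est_inv C i s \<and> s 3 0 = m \<and> s 3 1 = e \<and> estimate s = x)
      (Seq c_mult (Seq c_halve (incr 15))) (2 + ((1 + (1 + 2) * real H) + 1)) (\<lambda>s. prod_inv C (Suc i) s \<and> est_inv C (Suc i) s)"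
    if m: "Q \<le> m" "m < 2 * Q" and e: "e \<le> i * H"
      and x: "x = real m * 2 powi (int e - int (ell * Suc i))"
        "(1 - 1 / real Q) ^ i * (\<Prod>u<i. fac C u) \<le> x" "x \<le> (\<Prod>u<i. fac C u)" for m e x
  proof -
    let ?Y = "m * card (nb i) * (M * Q)"
    let ?X = "?Y div C i"
    \<comment> \<open>\<open>C i \<le> L \<le> Q\<close> keeps the quotient from falling below
      \<open>Q\<close>; for this reason \<open>Q\<close> was chosen at least
      \<open>L\<close>.\<close>
    have QX: "Q \<le> ?X"
    proof -
      have "Q * C i \<le> Q * Q" using Ci Q0 by simp
      also have "\<dots> \<le> ?Y"
      proof -
        have "Q * Q = Q * 1 * (1 * Q)" by simp
        also have "\<dots> \<le> ?Y" using m d pos by (intro mult_le_mono) auto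
        finally show ?thesis .
      qed
      finally show ?thesis using Ci by (simp add: less_eq_div_iff_mult_less_eq)
    qed
    have XH: "floor_log ?X \<le> H"
      unfolding H_def using Ybound[OF m(2)] by (intro monoD[OF floor_log_mono]) (meson div_le_dividend le_trans)
    have 1: "ht a w (\<lambda>s. prod_inv C i s \<and> est_inv C i s \<and> s 3 0 = m \<and> s 3 1 = e \<and> estimate s = x) c_mult 2
        (\<lambda>s. ?P e m ?X s \<and> floor_log (s 3 0) \<le> H)"
    proof (rule ht_straight)
      fix s assume s: "prod_inv C i s \<and> est_inv C i s \<and> s 3 0 = m \<and> s 3 1 = e \<and> estimate s = x"
      have r: "run w c_mult s = s(3 := (s 3)(0 := ?X, 2 := ell * Suc (Suc i)))"
        unfolding c_mult_def using s small[OF m(2,1)] e2 i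
        by (simp add: prod_inv_def est_inv_def update_def const_simps fun_eq_iff)
      show "?P e m ?X (run w c_mult s) \<and> floor_log (run w c_mult s 3 0) \<le> H"
        unfolding r using s QX XH by (auto simp: prod_inv_def intro!: exI[of _ 0])
    qed (auto simp: c_mult_def)
    let ?b = "Less (Sub (Mul (gv 13) (Const 2)) (Const 1)) (gv 3)"
    have b: "eval w s ?b \<noteq> 0 \<longleftrightarrow> 2 * Q \<le> s 3 0" if "?P e m ?X s" for s
    proof -
      have "Q * 2 mod 2 ^ w = Q * 2" using Q0 bounds(10) by simp
      then show ?thesis using that Q0 by (auto simp: prod_inv_def const_simps)
    qed
    have 2: "ht a w (\<lambda>s. ?P e m ?X s \<and> floor_log (s 3 0) \<le> H) c_halve (1 + (1 + 2) * real H)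
        (\<lambda>s. ?P e m ?X s \<and> eval w s ?b = 0)"
      unfolding c_halve_def
    proof (rule ht_while)
      fix s assume s: "?P e m ?X s" "eval w s ?b \<noteq> 0"
      then have "2 \<le> s 3 0" using b[OF s(1)] Q0 by linarith
      then show "0 < floor_log (s 3 0)" using floor_log_rec[of "s 3 0"] by linarith
    next
      fix k'
      show "ht a w (\<lambda>s. ?P e m ?X s \<and> eval w s ?b \<noteq> 0 \<and> floor_log (s 3 0) = Suc k')
         (block [sv 3 (Div (gv 3) (Const 2)), Store 3 (Const 1) (Add (Get 3 (Const 1)) (Const 1))]) 2
         (\<lambda>s. ?P e m ?X s \<and> floor_log (s 3 0) \<le> k')" (is "ht a w ?A ?c 2 ?B")
      proof (rule ht_straight)
        fix s assume s: "?A s"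
        then obtain k where k: "s 3 1 = e + k" "s 3 0 = ?X div 2 ^ k" "Q \<le> s 3 0" by blast
        have ge: "2 * Q \<le> s 3 0" using b[of s] s by blast
        have kH: "k \<le> H"
        proof -
          have "0 < ?X div 2 ^ k" using k Q0 by linarith
          then have "2 ^ k \<le> ?X" by (simp add: div_greater_zero_iff)
          then have "floor_log (2 ^ k) \<le> floor_log ?X" by (rule monoD[OF floor_log_mono])
          then show ?thesis using XH by simp
        qed
        have md: "Suc (e + k) mod 2 ^ w = Suc (e + k)" using nH[OF e kH] by simp
        have r: "run w ?c s = s(3 := (s 3)(0 := s 3 0 div 2, 1 := Suc (e + k)))"
          using k md by (simp add: update_def const_simps fun_eq_iff)
        have "floor_log (s 3 0 div 2) \<le> k'"
          using s by (simp add: floor_log_half)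
        moreover have "s 3 0 div 2 = ?X div 2 ^ Suc k"
          unfolding k(2) by (simp add: div_mult2_eq[symmetric] mult.commute mult.left_commute)
        moreover have "Q \<le> s 3 0 div 2" using ge by simp
        ultimately show "?B (run w ?c s)"
          unfolding r using s by (auto simp: prod_inv_def intro!: exI[of _ "Suc k"])
      qed auto
    qed auto
    have 3: "ht a w (\<lambda>s. ?P e m ?X s \<and> eval w s ?b = 0) (incr 15) 1 (\<lambda>s. prod_inv C (Suc i) s \<and> est_inv C (Suc i) s)"
    proof (rule ht_straight)
      fix s assume s: "?P e m ?X s \<and> eval w s ?b = 0"
      then obtain k where k: "s 3 1 = e + k" "s 3 0 = ?X div 2 ^ k" "Q \<le> s 3 0" by blast
      have "\<not> 2 * Q \<le> s 3 0"
      proof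
        assume "2 * Q \<le> s 3 0"
        then have "eval w s ?b \<noteq> 0" by (rule iffD2[OF b[OF conjunct1[OF s]]])
        with conjunct2[OF s] show False by contradiction
      qed
      then have lt: "s 3 0 < 2 * Q" by simp
      have kH: "k \<le> H"
      proof -
        have "0 < ?X div 2 ^ k" using k Q0 by linarith
        then have "2 ^ k \<le> ?X" by (simp add: div_greater_zero_iff)
        then have "floor_log (2 ^ k) \<le> floor_log ?X" by (rule monoD[OF floor_log_mono])
        then show ?thesis using XH by simp
      qed
      have md: "Suc i mod 2 ^ w = Suc i" using i bounds(11) by simp
      have r: "run w (incr 15) s = s(15 := (s 15)(0 := Suc i))"
        using s md by (simp add: prod_inv_def update_def const_simps)
      have m': "s 3 0 = ?Y div (C i * 2 ^ k)" unfolding k(2) by (simp add: div_mult2_eq)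
      have rb: "real (s 3 0) \<le> ?Y / (C i * 2 ^ k)" "(1 - 1 / real Q) * (?Y / (C i * 2 ^ k)) \<le> real (s 3 0)"
        using round_bounds[OF Ci(1) Q0(1), of ?Y k] k(3) unfolding m' by simp_all
      let ?p = "2 powi (int (e + k) - int (ell * Suc (Suc i))) :: real"
      have scale: "?Y / (C i * 2 ^ k) * ?p = x * fac C i"
      proof -
        have "?p = 2 powi ((int e - int (ell * Suc i)) + int k + - int ell)"
          by (simp add: algebra_simps)
        also have "\<dots> = 2 powi (int e - int (ell * Suc i)) * 2 ^ k * inverse (2 ^ ell)"
          by (subst power_int_add, simp, subst power_int_add, simp) (simp add: power_int_minus)
        finally have "?p = 2 powi (int e - int (ell * Suc i)) * 2 ^ k / real Q"
          by (simp add: Q_def divide_inverse)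
        then show ?thesis
          using Q0 Ci unfolding x(1) fac_def by (simp add: field_simps)
      qed
      have est: "estimate s = real (s 3 0) * ?p" using s k(1) by (simp add: estimate_def)
      have p0: "0 \<le> ?p" by simp
      have f0: "0 \<le> fac C i" by (simp add: fac_def)
      have q0: "0 \<le> 1 - 1 / real Q" using Q0 by simp
      have up: "estimate s \<le> (\<Prod>u<Suc i. fac C u)"
      proof -
        have "estimate s \<le> ?Y / (C i * 2 ^ k) * ?p" unfolding est using rb(1) p0 by (rule mult_right_mono)
        also have "\<dots> = x * fac C i" by (rule scale)
        also have "\<dots> \<le> (\<Prod>u<i. fac C u) * fac C i" using x(3) f0 by (rule mult_right_mono)
        finally show ?thesis by simp
      qed
      have low: "(1 - 1 / real Q) ^ Suc i * (\<Prod>u<Suc i. fac C u) \<le> estimate s"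
      proof -
        have "(1 - 1 / real Q) ^ Suc i * (\<Prod>u<Suc i. fac C u)
            = (1 - 1 / real Q) * (((1 - 1 / real Q) ^ i * (\<Prod>u<i. fac C u)) * fac C i)"
          by simp
        also have "\<dots> \<le> (1 - 1 / real Q) * (x * fac C i)"
          using x(2) f0 q0 by (intro mult_left_mono mult_right_mono)
        also have "\<dots> = (1 - 1 / real Q) * (?Y / (C i * 2 ^ k)) * ?p" by (simp only: scale[symmetric] mult.assoc)
        also have "\<dots> \<le> estimate s" unfolding est using rb(2) p0 by (rule mult_right_mono)
        finally show ?thesis .
      qed
      have same: "estimate (run w (incr 15) s) = estimate s" unfolding r by (simp add: estimate_def)
      show "prod_inv C (Suc i) (run w (incr 15) s) \<and> est_inv C (Suc i) (run w (incr 15) s)"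
      proof
        show "prod_inv C (Suc i) (run w (incr 15) s)"
          unfolding r using conjunct1[OF conjunct1[OF s]] i by (simp add: prod_inv_def)
        have e2': "s 3 2 = ell * Suc (Suc i)" using conjunct1[OF s] by (elim conjE)
        have "e + k \<le> Suc i * H" using kH e by simp
        with e2' show "est_inv C (Suc i) (run w (incr 15) s)"
          unfolding est_inv_def same unfolding r fun_upd_apply using up low lt k(1,3) by simp
      qed
    qed auto
    show ?thesis by (intro ht_seq[OF 1 ht_seq[OF 2 3]]) auto
  qed
  show ?thesis
    unfolding ht_def
  proof (intro allI impI)
    fix s and F :: "mem \<Rightarrow> ennreal" and G :: ennreal
    assume s: "prod_inv C i s \<and> est_inv C i s" and G: "\<forall>s'. prod_inv C (Suc i) s' \<and> est_inv C (Suc i) s' \<longrightarrow> F s' \<le> G"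
    have "wp a w (Seq c_mult (Seq c_halve (incr 15))) F s \<le> a * ennreal (2 + ((1 + (1 + 2) * real H) + 1)) + G"
    proof (rule htD[OF main[of "s 3 0" "s 3 1" "estimate s"]])
      show "prod_inv C i s \<and> est_inv C i s \<and> s 3 0 = s 3 0 \<and> s 3 1 = s 3 1 \<and> estimate s = estimate s"
        using s by simp
      show "\<forall>s'. prod_inv C (Suc i) s' \<and> est_inv C (Suc i) s' \<longrightarrow> F s' \<le> G" by (rule G)
    qed (use s in \<open>auto simp: est_inv_def estimate_def\<close>)
    then show "wp a w (Seq c_mult (Seq c_halve (incr 15))) F s \<le> a * ennreal (4 + 3 * real H) + G"
      by (simp add: algebra_simps)
  qed
qed

lemma ht_product:
  assumes C: "\<And>u. u < n \<Longrightarrow> M \<le> C u \<and> C u \<le> L"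
  shows "ht a w (\<lambda>s. stage_inv {0..<n} s \<and> s 9 = C) c_product (4 + (5 + 3 * real H) * real n)
    (\<lambda>s. (1 - 1 / real Q) ^ n * (\<Prod>u<n. fac C u) \<le> estimate s \<and> estimate s \<le> (\<Prod>u<n. fac C u))"
proof -
  have Q0: "0 < Q" by (simp add: Q_def)
  let ?I = "\<lambda>s. prod_inv C (s 15 0) s \<and> est_inv C (s 15 0) s"
  let ?e = "Less (gv 15) (gv 0)"
  have 1: "ht a w (\<lambda>s. stage_inv {0..<n} s \<and> s 9 = C) (block [sv 3 (gv 13), Store 3 (Const 2) (gv 14), sv 15 (Const 0)]) 3
      (\<lambda>s. ?I s \<and> n - s 15 0 \<le> n)" (is "ht a w ?A ?c 3 ?B")
  proof (rule ht_straight)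
    fix s assume s: "?A s"
    have r: "run w ?c s = s(3 := (s 3)(0 := Q, 2 := ell), 15 := (s 15)(0 := 0))"
      using s by (simp add: stage_inv_def par_def update_def const_simps fun_eq_iff)
    have deg: "\<forall>u<n. s 4 u = card (nb u)"
      using s by (simp add: stage_inv_def adj_upto_def length_nbs)
    have "s 3 (Suc 0) = 0" using s by (simp add: stage_inv_def par_def inp_def)
    then have "estimate (s(3 := (s 3)(0 := Q, 2 := ell), 15 := (s 15)(0 := 0))) = 1"
      by (simp add: estimate_def Q_def power_int_minus)
    then show "?B (run w ?c s)"
      unfolding r using s deg Q0 by (simp add: prod_inv_def est_inv_def stage_inv_def par_def inp_def)
  qed auto
  have 2: "ht a w (\<lambda>s. ?I s \<and> n - s 15 0 \<le> n) (While ?e (Seq c_mult (Seq c_halve (incr 15)))) (1 + (1 + (4 + 3 * real H)) * real n)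
      (\<lambda>s. ?I s \<and> eval w s ?e = 0)"
  proof (rule ht_while)
    fix s assume "?I s" "eval w s ?e \<noteq> 0"
    then show "0 < n - s 15 0" by (simp add: prod_inv_def const_simps split: if_splits)
  next
    fix k
    show "ht a w (\<lambda>s. ?I s \<and> eval w s ?e \<noteq> 0 \<and> n - s 15 0 = Suc k) (Seq c_mult (Seq c_halve (incr 15))) (4 + 3 * real H)
        (\<lambda>s. ?I s \<and> n - s 15 0 \<le> k)"
    proof (cases "k < n")
      case True
      have i: "n - Suc k < n" using True by simp
      show ?thesis
      proof (rule ht_conseq[OF ht_product_body[where C = C and i = "n - Suc k" and a = a, OF C i]])
        fix s assume s: "?I s \<and> eval w s ?e \<noteq> 0 \<and> n - s 15 0 = Suc k"
        then have "s 15 0 \<le> n" "n - s 15 0 = Suc k" by (simp_all add: prod_inv_def)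
        then have "s 15 0 = n - Suc k" by linarith
        then show "prod_inv C (n - Suc k) s \<and> est_inv C (n - Suc k) s" using s by simp
      next
        fix s assume s: "prod_inv C (Suc (n - Suc k)) s \<and> est_inv C (Suc (n - Suc k)) s"
        then have "s 15 0 = Suc (n - Suc k)" by (simp add: prod_inv_def)
        then show "?I s \<and> n - s 15 0 \<le> k" using s True by simp
      qed auto
    next
      case False
      then show ?thesis unfolding ht_def by auto
    qed
  qed auto
  have "ht a w (\<lambda>s. stage_inv {0..<n} s \<and> s 9 = C) c_product (3 + (1 + (1 + (4 + 3 * real H)) * real n)) (\<lambda>s. ?I s \<and> eval w s ?e = 0)"
    unfolding c_product_def by (rule ht_seq[OF 1 2]) auto
  then show ?thesis
  proof (rule ht_conseq)
    fix s assume s: "?I s \<and> eval w s ?e = 0"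
    then have "s 15 0 = n" by (simp add: prod_inv_def const_simps split: if_splits)
    then show "(1 - 1 / real Q) ^ n * (\<Prod>u<n. fac C u) \<le> estimate s \<and> estimate s \<le> (\<Prod>u<n. fac C u)"
      using s by (simp add: est_inv_def)
  qed auto
qed

end

lemma avg_add:
  fixes b :: ennreal
  assumes "0 < d"
  shows "(\<Sum>t<d. b + f t) / of_nat d = b + (\<Sum>t<d. f t) / of_nat d"
proof -
  have fin: "(of_nat d :: ennreal) \<noteq> \<top>" "(of_nat d :: ennreal) \<noteq> 0"
    using assms by (auto simp: ennreal_of_nat_eq_real_of_nat)
  have "(of_nat d * b) / of_nat d = b"
    using fin by (metis ennreal_mult_divide_eq mult.commute)
  then show ?thesis by (simp add: sum.distrib add_divide_distrib_ennreal)
qed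

lemma avg_avg:
  fixes f :: "nat \<Rightarrow> nat \<Rightarrow> ennreal"
  assumes "0 < d"
  shows "(\<Sum>t<d. (\<Sum>c<2. f t c) / 2) / of_nat d = (\<Sum>t<d. \<Sum>c<2. f t c) / of_nat (2 * d)"
proof -
  have "(\<Sum>t<d. (\<Sum>c<2. f t c) / 2) = (\<Sum>t<d. \<Sum>c<2. f t c) * inverse 2"
    by (simp add: divide_ennreal_def sum_distrib_right)
  moreover have "inverse (of_nat (2 * d) :: ennreal) = inverse 2 * inverse (of_nat d)"
  proof -
    have 1: "inverse (of_nat (2 * d) :: ennreal) = ennreal (inverse (2 * real d))"
      using inverse_ennreal[of "real (2 * d)"] assms by (simp add: ennreal_of_nat_eq_real_of_nat)
    have 2: "inverse (of_nat d :: ennreal) = ennreal (inverse (real d))"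
      using inverse_ennreal[of "real d"] assms by (simp add: ennreal_of_nat_eq_real_of_nat)
    have 3: "inverse (2 :: ennreal) = ennreal (1 / 2)"
      using inverse_ennreal[of 2] by (simp add: inverse_eq_divide)
    show ?thesis
      unfolding 1 2 3 by (subst ennreal_mult'[symmetric]) (simp_all add: inverse_eq_divide)
  qed
  ultimately show ?thesis by (simp add: divide_ennreal_def mult.assoc)
qed

context bicircular_run
begin

section \<open>One move of the walk on the machine\<close>

section \<open>Verification of the walk\<close>

definition walk_inv :: "nat set \<Rightarrow> (nat \<Rightarrow> nat) \<Rightarrow> nat \<Rightarrow> nat list \<Rightarrow> mem \<Rightarrow> bool" where
  "walk_inv R C v xs s \<longleftrightarrow> stage_inv R s \<and> s 9 = C \<and> s 19 0 = v \<and> xs \<in> paths ({0..<n} - R) v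
     \<and> s 22 0 = length xs \<and> (\<forall>i<length xs. s 7 i = xs ! i \<and> s 8 (xs ! i) = i)"

lemma walk_inv_path: "walk_inv R C v xs s \<Longrightarrow> map (s 7) [0..<s 22 0] = xs"
  by (auto simp: walk_inv_def intro!: nth_equalityI)

lemma run_move:
  assumes inv: "walk_inv R C v xs s" and x: "s 16 0 = last xs" and t: "t < card (nb (last xs))" "s 23 0 = t"
    and c: "c < 2" "s 24 0 = c" and cnt: "s 20 0 \<le> L" and rn: "s 21 0 < M"
  shows "case walk_step ({0..<n} - R) xs (nbs es (last xs) ! t, c \<noteq> 0) of
      None \<Rightarrow> walk_inv R C v [v] (run w c_move s) \<and> run w c_move s 21 0 = Suc (s 21 0)
        \<and> run w c_move s 20 0 = min L (Suc (s 20 0))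
    | Some z \<Rightarrow> walk_inv R C v z (run w c_move s) \<and> run w c_move s 21 0 = s 21 0
        \<and> run w c_move s 20 0 = (if z = [v] then min L (Suc (s 20 0)) else s 20 0)"
proof -
  let ?S = "{0..<n} - R"
  let ?s = "run w c_move s"
  have stg: "stage_inv R s" "s 9 = C" "s 19 0 = v" and xs: "xs \<in> paths ?S v"
    and path: "s 22 0 = length xs" "\<And>i. i < length xs \<Longrightarrow> s 7 i = xs ! i \<and> s 8 (xs ! i) = i"
    using inv by (auto simp: walk_inv_def)
  have xs': "xs \<noteq> []" "hd xs = v" "distinct xs" "set xs \<subseteq> ?S" using xs by (auto simp: paths_def)
  define y where "y = nbs es (last xs) ! t"
  have tn: "t < n" using t card_nb_less[of "last xs"] by linarith
  have "last xs \<in> set xs" using xs' by simp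
  then have "last xs \<in> ?S" by (rule subsetD[OF xs'(4)])
  then have lastn: "last xs < n" by simp
  have y_nb: "y \<in> nb (last xs)" unfolding y_def set_nbs_nb[symmetric] using t by (simp add: length_nbs)
  have yn: "y < n" using subsetD[OF nb_subset y_nb] by simp
  have rd: "s 5 (last xs * n + t) = y" "s 0 0 = n" "s 12 0 = L" "s 6 y = of_bool (y \<in> R)"
    using stg(1) t lastn yn by (auto simp: stage_inv_def adj_upto_def y_def length_nbs par_def inp_def)
  have v: "v \<in> ?S" using xs' by (metis list.set_sel(1) subsetD)
  have vpath: "[v] \<in> paths ?S v" using v by (auto simp: paths_def)
  have p0: "s 7 0 = v" "s 8 v = 0" using path(2)[of 0] xs'(1,2) by (auto simp: hd_conv_nth)
  have lenn: "length xs \<le> n"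
  proof -
    have "length xs = card (set xs)" using xs' by (simp add: distinct_card)
    also have "\<dots> \<le> card {0..<n}" using xs' by (intro card_mono) auto
    finally show ?thesis by simp
  qed
  have ob: "of_bool P mod 2 ^ w = (of_bool P :: nat)" for P using w_pos by (cases P) auto
  have M200: "M < 2 ^ w - 1"
  proof -
    have "M * 48 \<le> L" using pos by (simp add: L_def)
    then show ?thesis using bounds(5) pos by linarith
  qed
  have nW: "Suc (Suc n) < 2 ^ w"
  proof -
    have "3 * n \<le> n * n" using n3 by simp
    then show ?thesis using bounds(2) n3 by linarith
  qed
  have md: "last xs * n mod 2 ^ w = last xs * n" "(last xs * n + t) mod 2 ^ w = last xs * n + t"
    "Suc (s 21 0) mod 2 ^ w = Suc (s 21 0)" "Suc (length xs) mod 2 ^ w = Suc (length xs)"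
    using addr_less[OF lastn tn] addr_less_0[OF lastn] rn M200 lenn nW by auto
  have cntW: "Suc (s 20 0) mod 2 ^ w = Suc (s 20 0)" if "s 20 0 < L" using that bounds(5) by simp
  have cnt': "(if s 20 0 < L then Suc (s 20 0) else s 20 0) = min L (Suc (s 20 0))" using cnt by auto
  \<comment> \<open>The invariant fixes array 8 on the path only; reading array 7 back excludes
    whatever is stored for other vertices.\<close>
  have mem: "s 8 y < length xs \<and> s 7 (s 8 y) = y \<longleftrightarrow> y \<in> set xs"
    using path(2) by (metis in_set_conv_nth)
  show ?thesis
  proof (cases "y \<in> R")
    case True
    have ws: "walk_step ?S xs (y, c \<noteq> 0) = None" using True by (simp add: walk_step_def)
    have r: "?s b = (if b = 17 then (s 17)(0 := y) else if b = 21 then (s 21)(0 := Suc (s 21 0))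
        else if b = 22 then (s 22)(0 := 1) else if b = 20 then (s 20)(0 := min L (Suc (s 20 0))) else s b)" for b
      unfolding c_move_def c_success_def using True x t rd md cntW cnt'
      by (auto simp: update_def const_simps ob fun_upd_idem_iff)
    have "stage_inv R ?s" using stg(1) by (rule stage_inv_cong) (auto simp: r)
    then show ?thesis
      unfolding y_def[symmetric] ws using stg vpath p0 by (simp add: r walk_inv_def)
  next
    case yR: False
    then have yS: "y \<in> ?S" using yn by auto
    show ?thesis
    proof (cases "y \<in> set xs")
      case False
      have ws: "walk_step ?S xs (y, c \<noteq> 0) = Some (xs @ [y])" using False yS by (simp add: walk_step_def)
      have len1: "Suc (length xs) \<noteq> 1" using xs' by simp
      have nm: "\<not> (s 8 y < length xs \<and> s 7 (s 8 y) = y)" using mem False by blast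
      have r: "?s b = (if b = 17 then (s 17)(0 := y) else if b = 7 then (s 7)(length xs := y)
          else if b = 8 then (s 8)(y := length xs) else if b = 22 then (s 22)(0 := Suc (length xs)) else s b)" for b
        unfolding c_move_def c_success_def using yR x t rd md nm path(1) xs'(1)
        by (auto simp: update_def const_simps ob)
      have "stage_inv R ?s" using stg(1) by (rule stage_inv_cong) (auto simp: r)
      moreover have "xs @ [y] \<in> paths ?S v"
        using walk_step_paths[OF xs _ ws] y_nb by (simp add: moves_def)
      moreover have "xs @ [y] \<noteq> [v]" using xs' by simp
      ultimately show ?thesis
        unfolding y_def[symmetric] ws using stg path False by (auto simp: r walk_inv_def nth_append)
    next
      case True
      define j where "j = s 8 y"
      have j: "j < length xs" "xs ! j = y" "s 7 j = y"
        using True path(2) by (auto simp: j_def in_set_conv_nth)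
      have sp: "xs = take j xs @ y # drop (Suc j) xs" using id_take_nth_drop[OF j(1)] j(2) by simp
      moreover have "y \<notin> set (take j xs)"
      proof
        assume "y \<in> set (take j xs)"
        then obtain i where "i < j" "xs ! i = y" using j(1) by (auto simp: in_set_conv_nth)
        then show False using j xs'(3) nth_eq_iff_index_eq[of xs i j] by auto
      qed
      ultimately have tw: "takeWhile (\<lambda>z. z \<noteq> y) xs = take j xs" by (metis takeWhile_first)
      have jW: "Suc j mod 2 ^ w = Suc j" "(j + 2) mod 2 ^ w = j + 2" "Suc (Suc j) mod 2 ^ w = Suc (Suc j)"
        using j lenn nW by auto
      have c01: "c = 0 \<or> c = 1" using c by auto
      show ?thesis
      proof (cases "j + 2 < length xs \<and> c \<noteq> 0")
        case long: True
        then have "c = 1" using c01 by simp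
        have ws: "walk_step ?S xs (y, c \<noteq> 0) = None"
          using True yS j long by (simp add: walk_step_def tw)
        have r: "?s b = (if b = 17 then (s 17)(0 := y) else if b = 21 then (s 21)(0 := Suc (s 21 0))
            else if b = 22 then (s 22)(0 := 1) else if b = 20 then (s 20)(0 := min L (Suc (s 20 0))) else s b)" for b
          unfolding c_move_def c_success_def using yR x t rd md cntW cnt' j jW long \<open>c = 1\<close> c(2) path(1)
          by (auto simp: update_def const_simps ob j_def[symmetric] fun_upd_idem_iff)
        have "stage_inv R ?s" using stg(1) by (rule stage_inv_cong) (auto simp: r)
        then show ?thesis
          unfolding y_def[symmetric] ws using stg vpath p0 by (simp add: r walk_inv_def)
      next
        case short: False
        have z: "take j xs @ [y] = take (Suc j) xs" using j by (simp add: take_Suc_conv_app_nth)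
        have ws: "walk_step ?S xs (y, c \<noteq> 0) = Some (take (Suc j) xs)"
          using True yS j short by (auto simp: walk_step_def tw Let_def z)
        have zp: "take (Suc j) xs \<in> paths ?S v"
          using walk_step_paths[OF xs _ ws] y_nb by (simp add: moves_def)
        have zv: "take (Suc j) xs = [v] \<longleftrightarrow> j = 0"
        proof
          assume "take (Suc j) xs = [v]"
          then have "length (take (Suc j) xs) = 1" by simp
          then show "j = 0" using j by simp
        next
          assume "j = 0"
          then show "take (Suc j) xs = [v]" using xs' by (cases xs) auto
        qed
        have r: "?s b = (if b = 17 then (s 17)(0 := y) else if b = 22 then (s 22)(0 := Suc j)
            else if b = 20 then (if j = 0 then (s 20)(0 := min L (Suc (s 20 0))) else s 20) else s b)" for b
          unfolding c_move_def c_success_def using yR x t rd md cntW cnt' j jW short c01 c(2) path(1)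
          by (auto simp: update_def const_simps ob j_def[symmetric] fun_upd_idem_iff)
        have "stage_inv R ?s" using stg(1) by (rule stage_inv_cong) (auto simp: r)
        then show ?thesis
          unfolding y_def[symmetric] ws option.case zv using stg path zp j by (auto simp: r walk_inv_def)
      qed
    qed
  qed
qed

lemma sum_moves:
  "(\<Sum>t<card (nb (last xs)). \<Sum>c<2::nat. f (nbs es (last xs) ! t, c \<noteq> 0)) = (\<Sum>j\<in>moves xs. f j)"
  for f :: "nat \<times> bool \<Rightarrow> ennreal"
proof -
  have "(\<Sum>t<card (nb (last xs)). \<Sum>c<2::nat. f (nbs es (last xs) ! t, c \<noteq> 0))
      = (\<Sum>t<card (nb (last xs)). \<Sum>b\<in>UNIV. f (nbs es (last xs) ! t, b))"
    by (simp add: numeral_2_eq_2 UNIV_bool add.commute)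
  also have "\<dots> = (\<Sum>y\<in>nb (last xs). \<Sum>b\<in>UNIV. f (y, b))"
    using bij_betw_nth[OF distinct_nbs_es[of "last xs"] refl refl]
    by (intro sum.reindex_bij_betw) (simp add: length_nbs set_nbs_nb)
  also have "\<dots> = (\<Sum>j\<in>moves xs. f j)"
    by (simp add: moves_def sum.cartesian_product)
  finally show ?thesis .
qed

text \<open>Drawing a neighbour index and a coin one after the other averages uniformly over
  \<open>moves xs\<close>, the index set of the chain analysed above.\<close>

lemma wp_walk_body:
  assumes inv: "walk_inv R C v xs s" and cnt: "s 20 0 \<le> L" and rn: "s 21 0 < M"
    and val: "\<And>s' j. j \<in> moves xs \<Longrightarrow>
        (case walk_step ({0..<n} - R) xs j of
          None \<Rightarrow> walk_inv R C v [v] s' \<and> s' 21 0 = Suc (s 21 0) \<and> s' 20 0 = min L (Suc (s 20 0))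
        | Some z \<Rightarrow> walk_inv R C v z s' \<and> s' 21 0 = s 21 0
            \<and> s' 20 0 = (if z = [v] then min L (Suc (s 20 0)) else s 20 0)) \<Longrightarrow> F s' \<le> out j"
  shows "wp a w c_walk_body F s \<le> a * 12 + (\<Sum>j\<in>moves xs. out j) / of_nat (card (moves xs))"
proof -
  have xs: "xs \<in> paths ({0..<n} - R) v" "s 22 0 = length xs" "xs \<noteq> []" "s 7 (length xs - 1) = last xs"
    using inv by (auto simp: walk_inv_def paths_def last_conv_nth)
  have "last xs \<in> set xs" using xs by simp
  moreover have "set xs \<subseteq> {0..<n} - R" using xs(1) by (simp add: paths_def)
  ultimately have "last xs \<in> {0..<n} - R" by (rule rev_subsetD)
  then have lastn: "last xs < n" by simp
  let ?d = "card (nb (last xs))"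
  have d: "0 < ?d" using nb_nonempty[OF lastn] .
  have deg: "s 4 (last xs) = ?d"
    using inv lastn by (simp add: walk_inv_def stage_inv_def adj_upto_def length_nbs)
  let ?s1 = "update s 16 0 (last xs)"
  let ?s2 = "\<lambda>t c. update (update ?s1 23 0 t) 24 0 c"
  have two: "2 mod 2 ^ w = (2::nat)" using const_mod[of 2] by simp
  have one: "Suc 0 mod 2 ^ w = Suc 0" using const_mod[of 1] by simp
  have E1: "wp a w c_walk_body F s = a + (a + (\<Sum>t<?d. a + (\<Sum>c<2. wp a w c_move F (?s2 t c)) / 2) / of_nat ?d)"
  proof -
    have "nb (last xs) \<noteq> {}" using d by auto
    then show ?thesis
      unfolding c_walk_body_def using xs deg
      by (simp add: two one w_pos) (simp add: update_def)
  qed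
  have E2: "(\<Sum>t<?d. a + (\<Sum>c<2. wp a w c_move F (?s2 t c)) / 2) / of_nat ?d
      = a + (\<Sum>t<?d. (\<Sum>c<2. wp a w c_move F (?s2 t c)) / 2) / of_nat ?d"
    using d by (rule avg_add)
  have E3: "(\<Sum>t<?d. (\<Sum>c<2. wp a w c_move F (?s2 t c)) / 2) / of_nat ?d
      \<le> (\<Sum>t<?d. (\<Sum>c<2::nat. a * 9 + out (nbs es (last xs) ! t, c \<noteq> 0)) / 2) / of_nat ?d"
  proof (intro divide_right_mono_ennreal sum_mono)
    fix t c assume t: "t \<in> {..<?d}" and c: "c \<in> {..<2::nat}"
    have inv2: "walk_inv R C v xs (?s2 t c)"
    proof -
      have "stage_inv R (?s2 t c)"
        by (rule stage_inv_cong[of R s]) (use inv in \<open>auto simp: walk_inv_def update_def\<close>)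
      then show ?thesis using inv by (simp add: walk_inv_def update_def)
    qed
    have s2: "?s2 t c 16 0 = last xs" "?s2 t c 23 0 = t" "?s2 t c 24 0 = c" "?s2 t c 20 0 = s 20 0" "?s2 t c 21 0 = s 21 0"
      by (simp_all add: update_def)
    have c2: "c < 2" and td: "t < ?d" using t c by simp_all
    have mv: "(nbs es (last xs) ! t, c \<noteq> 0) \<in> moves xs"
      using td nth_mem[of t "nbs es (last xs)"] by (simp add: moves_def length_nbs set_nbs_nb)
    have "F (run w c_move (?s2 t c)) \<le> out (nbs es (last xs) ! t, c \<noteq> 0)"
      by (rule val[OF mv])
         (use run_move[OF inv2 s2(1) td s2(2) c2 s2(3)] cnt rn in \<open>simp only: s2\<close>)
    moreover have "wp a w c_move F (?s2 t c) \<le> a * ennreal (real (len c_move)) + F (run w c_move (?s2 t c))"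
      by (rule wp_straight) (simp add: c_move_def c_success_def)
    moreover have "len c_move = 9" by (simp add: c_move_def c_success_def)
    ultimately show "wp a w c_move F (?s2 t c) \<le> a * 9 + out (nbs es (last xs) ! t, c \<noteq> 0)"
      by (simp add: order.trans[OF _ add_left_mono])
  qed
  have E4: "(\<Sum>t<?d. (\<Sum>c<2::nat. a * 9 + out (nbs es (last xs) ! t, c \<noteq> 0)) / 2) / of_nat ?d
      = a * 9 + (\<Sum>t<?d. (\<Sum>c<2::nat. out (nbs es (last xs) ! t, c \<noteq> 0)) / 2) / of_nat ?d"
  proof -
    have two_pos: "0 < (2::nat)" by simp
    have e1: "(\<Sum>c<2::nat. a * 9 + out (nbs es (last xs) ! t, c \<noteq> 0)) / 2
        = a * 9 + (\<Sum>c<2::nat. out (nbs es (last xs) ! t, c \<noteq> 0)) / 2" for t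
      using avg_add[OF two_pos, of "a * 9" "\<lambda>c. out (nbs es (last xs) ! t, c \<noteq> 0)"]
      by (simp only: of_nat_numeral)
    show ?thesis unfolding e1 by (rule avg_add[OF d])
  qed
  have E5: "(\<Sum>t<?d. (\<Sum>c<2::nat. out (nbs es (last xs) ! t, c \<noteq> 0)) / 2) / of_nat ?d
      = (\<Sum>j\<in>moves xs. out j) / of_nat (card (moves xs))"
    unfolding avg_avg[OF d] sum_moves card_moves ..
  \<comment> \<open>12 is one store, two draws and the nine steps of \<open>c_move\<close>.\<close>
  have "wp a w c_walk_body F s \<le> a + (a + (a + (a * 9 + (\<Sum>j\<in>moves xs. out j) / of_nat (card (moves xs)))))"
    unfolding E1 E2 E5[symmetric] E4[symmetric] by (intro add_left_mono E3)
  also have "\<dots> = a * 12 + (\<Sum>j\<in>moves xs. out j) / of_nat (card (moves xs))"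
  proof -
    have "a * 12 = a * (1 + (1 + (1 + 9)))" by simp
    then show ?thesis by (simp only: distrib_left mult_1_right add.assoc)
  qed
  finally show ?thesis .
qed

end

lemma wp_Seq: "wp a w (Seq c1 c2) F = wp a w c1 (wp a w c2 F)"
  by (rule ext) simp

lemma avg_lin:
  fixes b :: ennreal
  assumes "0 < card J"
  shows "(\<Sum>j\<in>J. b + c * t j + f j * x + g j * y) / of_nat (card J)
    = b + c * ((\<Sum>j\<in>J. t j) / of_nat (card J)) + ((\<Sum>j\<in>J. f j) / of_nat (card J)) * x
      + ((\<Sum>j\<in>J. g j) / of_nat (card J)) * y"
proof -
  have fin: "(of_nat (card J) :: ennreal) \<noteq> \<top>" "(of_nat (card J) :: ennreal) \<noteq> 0"
    using assms by (auto simp: ennreal_of_nat_eq_real_of_nat)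
  have "of_nat (card J) * b * inverse (of_nat (card J)) = b"
    using fin by (metis ennreal_mult_divide_eq mult.commute divide_ennreal_def)
  then show ?thesis
    by (simp add: divide_ennreal_def sum.distrib sum_distrib_left[symmetric] sum_distrib_right[symmetric]
        distrib_left distrib_right mult.assoc mult.left_commute mult.commute)
qed

lemma ennreal_convex:
  assumes "0 \<le> r" "r \<le> 1"
  shows "ennreal r * (b + x) + ennreal (1 - r) * (b + y) = b + (ennreal r * x + ennreal (1 - r) * y)"
proof -
  have "ennreal r + ennreal (1 - r) = 1" using assms by (simp add: ennreal_plus[symmetric] del: ennreal_plus)
  then have "ennreal r * b + ennreal (1 - r) * b = b"
    by (simp only: distrib_right[symmetric] mult_1_left)
  have "ennreal r * (b + x) + ennreal (1 - r) * (b + y)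
      = (ennreal r * b + ennreal (1 - r) * b) + (ennreal r * x + ennreal (1 - r) * y)"
    by (simp add: distrib_left add.assoc add.left_commute)
  then show ?thesis by (simp only: \<open>ennreal r * b + ennreal (1 - r) * b = b\<close>)
qed

context bicircular_run
begin

section \<open>Supermartingale argument for the loop of a stage\<close>

section \<open>The walk loop and a stage\<close>

text \<open>\<open>\<Psi> \<rho> k\<close> bounds the expected result when an excursion begins after
  \<open>\<rho>\<close> successes in \<open>k\<close> excursions. Within an excursion it is
  interpolated by the probabilities of success and return from the current path, so only its
  behaviour from one excursion to the next has to be supplied.\<close>

lemma wp_walk:
  fixes \<Psi> :: "nat \<Rightarrow> nat \<Rightarrow> ennreal" and R v
  defines "S \<equiv> {0..<n} - R"
  assumes inv: "walk_inv R C v [v] s" "s 20 0 = 0" "s 21 0 = 0"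
    and tau: "0 \<le> \<theta>" "time_pot S [v] \<le> ennreal \<theta>"
    and rr: "succ_pot S v [v] \<le> ennreal r" "return_pot S v [v] \<le> ennreal (1 - r)"
    and super: "\<And>\<rho> k. \<rho> < M \<Longrightarrow> k \<le> L \<Longrightarrow>
        ennreal r * \<Psi> (Suc \<rho>) (min L (Suc k)) + ennreal (1 - r) * \<Psi> \<rho> (min L (Suc k)) \<le> \<Psi> \<rho> k"
    and post: "\<And>s'. stage_inv R s' \<Longrightarrow> s' 9 = C \<Longrightarrow> s' 19 0 = v \<Longrightarrow> M \<le> s' 20 0 \<Longrightarrow> s' 20 0 \<le> L \<Longrightarrow> F s' \<le> \<Psi> M (s' 20 0)"
  shows "wp a w c_walk F s \<le> a * ennreal (13 * real M * \<theta> + 1) + \<Psi> 0 0"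
proof -
  let ?c = "\<lambda>k. min L (Suc k)"
  \<comment> \<open>13 steps (body and test) for every move expected before the next success and
    before each of the later ones, one final test, and the two possible outcomes of the current
    excursion.\<close>
  define \<phi> where "\<phi> \<rho> k xs = (if \<rho> < M then a * 13 * (time_pot S xs + of_nat (M - Suc \<rho>) * ennreal \<theta>) + a
      + succ_pot S v xs * \<Psi> (Suc \<rho>) (?c k) + return_pot S v xs * \<Psi> \<rho> (?c k) else a + \<Psi> M k)" for \<rho> k xs
  let ?J = "\<lambda>s. \<exists>xs. walk_inv R C v xs s \<and> s 20 0 \<le> L \<and> s 21 0 \<le> M \<and> s 21 0 \<le> s 20 0"
  \<comment> \<open>Park induction needs a function of the memory alone: the path is read back from
    array 7, and memories outside the invariant get the value \<open>\<top>\<close>, which makes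
    them harmless.\<close>
  define \<Phi> where "\<Phi> s = (if ?J s then \<phi> (s 21 0) (s 20 0) (map (s 7) [0..<s 22 0]) else \<top>)" for s
  have M_le_L: "M \<le> L" using pos by (simp add: L_def)
  have \<Phi>_eq: "\<Phi> s = \<phi> (s 21 0) (s 20 0) xs"
    if "walk_inv R C v xs s" "s 20 0 \<le> L" "s 21 0 \<le> M" "s 21 0 \<le> s 20 0" for s xs
    unfolding \<Phi>_def using that walk_inv_path[OF that(1)] by auto
  have start: "succ_pot S v [v] * \<Psi> (Suc \<rho>) (?c k) + return_pot S v [v] * \<Psi> \<rho> (?c k) \<le> \<Psi> \<rho> k"
    if "\<rho> < M" "k \<le> L" for \<rho> k
    by (rule order_trans[OF add_mono[OF mult_right_mono[OF rr(1)] mult_right_mono[OF rr(2)]] super[OF that]]) auto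
  have start': "\<phi> \<rho> k [v] \<le> a * 13 * (of_nat (M - \<rho>) * ennreal \<theta>) + a + \<Psi> \<rho> k" if "\<rho> \<le> M" "k \<le> L" for \<rho> k
  proof (cases "\<rho> < M")
    case True
    have "\<phi> \<rho> k [v] = a * 13 * (time_pot S [v] + of_nat (M - Suc \<rho>) * ennreal \<theta>) + a
        + (succ_pot S v [v] * \<Psi> (Suc \<rho>) (?c k) + return_pot S v [v] * \<Psi> \<rho> (?c k))"
      using True by (simp add: \<phi>_def add.assoc)
    also have "\<dots> \<le> a * 13 * (ennreal \<theta> + of_nat (M - Suc \<rho>) * ennreal \<theta>) + a + \<Psi> \<rho> k"
      by (intro add_mono mult_left_mono tau start True that order_refl) auto
    also have "ennreal \<theta> + of_nat (M - Suc \<rho>) * ennreal \<theta> = of_nat (Suc (M - Suc \<rho>)) * ennreal \<theta>"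
      by (simp add: distrib_right)
    also have "Suc (M - Suc \<rho>) = M - \<rho>" using True by simp
    finally show ?thesis .
  next
    case False
    then have "\<rho> = M" using that by simp
    then show ?thesis by (simp add: \<phi>_def)
  qed
  have step: "a + (if eval w s (Less (gv 21) (gv 11)) \<noteq> 0 then wp a w c_walk_body \<Phi> s else F s) \<le> \<Phi> s" for s
  proof (cases "?J s")
    case True
    then obtain xs where J: "walk_inv R C v xs s" "s 20 0 \<le> L" "s 21 0 \<le> M" "s 21 0 \<le> s 20 0" by blast
    have test: "eval w s (Less (gv 21) (gv 11)) \<noteq> 0 \<longleftrightarrow> s 21 0 < M"
      using J(1) w_pos by (auto simp: walk_inv_def stage_inv_def par_def inp_def)
    show ?thesis
    proof (cases "s 21 0 < M")
      case False
      then have "F s \<le> \<Psi> M (s 20 0)"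
        using J by (intro post) (auto simp: walk_inv_def)
      then show ?thesis
        unfolding \<Phi>_eq[OF J] using False test by (simp add: \<phi>_def add_left_mono del: eval.simps)
    next
      case lt: True
      let ?\<rho> = "s 21 0" and ?k = "s 20 0"
      let ?K0 = "a * 13 * (of_nat (M - Suc ?\<rho>) * ennreal \<theta>) + a"
      let ?t = "\<lambda>j. case walk_step S xs j of None \<Rightarrow> 0 | Some z \<Rightarrow> time_pot S z"
      let ?f = "\<lambda>j. case walk_step S xs j of None \<Rightarrow> 1 | Some z \<Rightarrow> if z = [v] then 0 else succ_pot S v z"
      let ?g = "\<lambda>j. case walk_step S xs j of None \<Rightarrow> 0 | Some z \<Rightarrow> if z = [v] then 1 else return_pot S v z"
      let ?x = "\<Psi> (Suc ?\<rho>) (?c ?k)" and ?y = "\<Psi> ?\<rho> (?c ?k)"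
      let ?out = "\<lambda>j. ?K0 + a * 13 * ?t j + ?f j * ?x + ?g j * ?y"
      \<comment> \<open>As \<open>M \<le> L\<close>, the cap cannot push the number of excursions
        below that of successes; this is why the final count is at least \<open>M\<close>.\<close>
      have cL: "?c ?k \<le> L" "Suc ?\<rho> \<le> ?c ?k" using J lt M_le_L by auto
      have body: "wp a w c_walk_body \<Phi> s \<le> a * 12 + (\<Sum>j\<in>moves xs. ?out j) / of_nat (card (moves xs))"
      proof (rule wp_walk_body[OF J(1,2) lt])
        fix s' j assume st: "case walk_step ({0..<n} - R) xs j of
          None \<Rightarrow> walk_inv R C v [v] s' \<and> s' 21 0 = Suc ?\<rho> \<and> s' 20 0 = ?c ?k
        | Some z \<Rightarrow> walk_inv R C v z s' \<and> s' 21 0 = ?\<rho> \<and> s' 20 0 = (if z = [v] then ?c ?k else ?k)"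
        show "\<Phi> s' \<le> ?out j"
        proof (cases "walk_step S xs j")
          case None
          then have s': "walk_inv R C v [v] s'" "s' 21 0 = Suc ?\<rho>" "s' 20 0 = ?c ?k" using st by (auto simp: S_def)
          have "\<Phi> s' = \<phi> (Suc ?\<rho>) (?c ?k) [v]" using \<Phi>_eq[OF s'(1)] s' cL lt by simp
          also have "\<dots> \<le> ?K0 + ?x" using start'[of "Suc ?\<rho>" "?c ?k"] cL lt by simp
          finally show ?thesis using None by simp
        next
          case (Some z)
          show ?thesis
          proof (cases "z = [v]")
            case True
            then have s': "walk_inv R C v [v] s'" "s' 21 0 = ?\<rho>" "s' 20 0 = ?c ?k" using st Some by (auto simp: S_def)
            have "\<Phi> s' = \<phi> ?\<rho> (?c ?k) [v]" using \<Phi>_eq[OF s'(1)] s' cL lt by simp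
            also have "\<dots> = a * 13 * (time_pot S [v] + of_nat (M - Suc ?\<rho>) * ennreal \<theta>) + a
                + (succ_pot S v [v] * \<Psi> (Suc ?\<rho>) (?c (?c ?k)) + return_pot S v [v] * \<Psi> ?\<rho> (?c (?c ?k)))"
              using lt by (simp add: \<phi>_def add.assoc)
            also have "\<dots> \<le> a * 13 * (time_pot S [v] + of_nat (M - Suc ?\<rho>) * ennreal \<theta>) + a + ?y"
              by (intro add_left_mono start lt cL)
            finally show ?thesis using Some True by (simp add: distrib_left add.assoc add.left_commute add.commute)
          next
            case False
            then have s': "walk_inv R C v z s'" "s' 21 0 = ?\<rho>" "s' 20 0 = ?k" using st Some by (auto simp: S_def)
            have "\<Phi> s' = \<phi> ?\<rho> ?k z" using \<Phi>_eq[OF s'(1)] s' J lt by simp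
            then show ?thesis using Some False lt by (simp add: \<phi>_def distrib_left add.assoc add.left_commute add.commute)
          qed
        qed
      qed
      have cm: "0 < card (moves xs)"
      proof -
        have "xs \<noteq> []" "set xs \<subseteq> S" using J(1) by (auto simp: walk_inv_def paths_def S_def)
        then have "last xs \<in> S" using last_in_set by blast
        then show ?thesis using nb_nonempty[of "last xs"] by (simp add: card_moves S_def)
      qed
      have "a + wp a w c_walk_body \<Phi> s \<le> a + (a * 12 + (\<Sum>j\<in>moves xs. ?out j) / of_nat (card (moves xs)))"
        by (intro add_left_mono body)
      also have "\<dots> = a + (a * 12 + (?K0 + a * 13 * ((\<Sum>j\<in>moves xs. ?t j) / of_nat (card (moves xs)))
          + succ_pot S v xs * ?x + return_pot S v xs * ?y))"
        unfolding avg_lin[OF cm] succ_pot_unfold return_pot_unfold ..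
      also have "\<dots> = a * 13 * ((1 + (\<Sum>j\<in>moves xs. ?t j) / of_nat (card (moves xs))) + of_nat (M - Suc ?\<rho>) * ennreal \<theta>) + a
          + succ_pot S v xs * ?x + return_pot S v xs * ?y"
      proof -
        have "a + a * 12 = a * 13"
        proof -
          have "a * (1 + 12) = a * 1 + a * 12" by (rule distrib_left)
          then show ?thesis by simp
        qed
        then show ?thesis by (simp add: distrib_left add.assoc[symmetric])
      qed
      also have "\<dots> = \<phi> ?\<rho> ?k xs" unfolding time_pot_unfold using lt by (simp add: \<phi>_def)
      finally show ?thesis unfolding \<Phi>_eq[OF J] using test lt by simp
    qed
  next
    case False
    then have "\<Phi> s = \<top>" unfolding \<Phi>_def by (rule if_not_P)
    then show ?thesis by (simp del: eval.simps)
  qed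
  have "wp a w c_walk F s \<le> \<Phi> s" unfolding c_walk_def by (rule wp_while_le[OF step])
  also have "\<dots> = \<phi> 0 0 [v]" using \<Phi>_eq[OF inv(1)] inv by simp
  also have "\<dots> \<le> a * 13 * (of_nat M * ennreal \<theta>) + a + \<Psi> 0 0" using start'[of 0 0] by simp
  also have "a * 13 * (of_nat M * ennreal \<theta>) + a = a * ennreal (13 * real M * \<theta> + 1)"
  proof -
    have "ennreal (13 * real M * \<theta> + 1) = 13 * (of_nat M * ennreal \<theta>) + 1"
      using tau(1) by (simp add: ennreal_plus ennreal_mult ennreal_of_nat_eq_real_of_nat mult.assoc)
    then show ?thesis by (simp add: distrib_left mult.assoc)
  qed
  finally show ?thesis .
qed

definition admissible_next :: "nat set \<Rightarrow> nat \<Rightarrow> bool" where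
  "admissible_next R v \<longleftrightarrow> v \<in> {0..<n} - R \<and> (R \<noteq> {} \<longrightarrow> nb v \<inter> R \<noteq> {})"

text \<open>The bounds from \<open>step_sum_full\<close> and \<open>step_sum_root\<close>, divided
  by \<open>num S\<close>.\<close>

definition tau :: "nat set \<Rightarrow> real" where
  "tau R = (if R = {} then 6 * real n ^ 2 else 4 * real n)"

lemma stage_potentials:
  assumes R: "R \<subseteq> {0..<n}" and v: "admissible_next R v"
  defines "S \<equiv> {0..<n} - R"
  shows "time_pot S [v] \<le> ennreal (tau R)" "succ_pot S v [v] \<le> ennreal (succ_prob S v)"
    "return_pot S v [v] \<le> ennreal (1 - succ_prob S v)" "0 < succ_prob S v" "succ_prob S v \<le> 1"
    "1 / succ_prob S v \<le> 6 * real n ^ 2"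
proof -
  have S: "S \<subseteq> {0..<n}" "v \<in> S" using v by (auto simp: S_def admissible_next_def)
  have N: "0 < num S" "0 < num (S - {v})" using S nE by (auto intro!: num_pos[OF con])
  have "nb v \<noteq> {}" using nb_nonempty[of v] S by auto
  note P = potentials_at_start[OF S this N]
  have tau: "step_sum S v / num S \<le> tau R"
  proof (cases "R = {}")
    case True
    then have "S = {0..<n}" by (simp add: S_def)
    then have "step_sum S v \<le> 6 * n ^ 2 * num S" using step_sum_full[OF con, of v] nE by simp
    then have "real (step_sum S v) \<le> real (6 * n ^ 2 * num S)" by (rule of_nat_mono)
    then show ?thesis using N True by (simp add: tau_def divide_le_eq)
  next
    case False
    then obtain b where b: "b \<in> nb v" "b \<in> R" using v by (auto simp: admissible_next_def)
    have "step_sum S v \<le> 4 * card S * num S"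
      using b by (intro step_sum_root[OF S]) (auto simp: S_def)
    also have "\<dots> \<le> 4 * n * num S" using card_mono[OF _ S(1)] by simp
    finally have "real (step_sum S v) \<le> real (4 * n * num S)" by (rule of_nat_mono)
    then show ?thesis using N False by (simp add: tau_def divide_le_eq)
  qed
  show "time_pot S [v] \<le> ennreal (tau R)" using P(1) tau by (meson ennreal_leI order_trans)
  have "4 * real n \<le> 6 * real n ^ 2" using n3 by (simp add: power2_eq_square)
  then have "tau R \<le> 6 * real n ^ 2" by (simp add: tau_def)
  then show "1 / succ_prob S v \<le> 6 * real n ^ 2" using P(6) tau by linarith
  show "succ_pot S v [v] \<le> ennreal (succ_prob S v)" "return_pot S v [v] \<le> ennreal (1 - succ_prob S v)"
    "0 < succ_prob S v" "succ_prob S v \<le> 1"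
    by (rule P)+
qed

text \<open>Scan, initialisation, 13 steps for each expected move up to \<open>M\<close> successes,
  the last test, and the bookkeeping at the end.\<close>

definition stage_time :: "nat set \<Rightarrow> real" where
  "stage_time R = (3 + 7 * real (length es)) + 5 + (13 * real M * tau R + 1) + 3"

text \<open>The family \<open>\<Psi>\<close> may depend on the vertex found by the scan. For the
  running time a constant is taken, for the error the potential of \<open>pot_stage\<close>.\<close>

lemma wp_stage:
  assumes inv: "stage_inv R s" and R: "R \<noteq> {0..<n}"
    and \<Psi>: "\<And>v. admissible_next R v \<Longrightarrow> \<exists>\<Psi> :: nat \<Rightarrow> nat \<Rightarrow> ennreal.
       (\<forall>\<rho> k. \<rho> < M \<longrightarrow> k \<le> L \<longrightarrow> ennreal (succ_prob ({0..<n} - R) v) * \<Psi> (Suc \<rho>) (min L (Suc k))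
          + ennreal (1 - succ_prob ({0..<n} - R) v) * \<Psi> \<rho> (min L (Suc k)) \<le> \<Psi> \<rho> k)
       \<and> (\<forall>s' k. stage_inv (insert v R) s' \<longrightarrow> s' 9 = (s 9)(v := k) \<longrightarrow> M \<le> k \<longrightarrow> k \<le> L \<longrightarrow> F s' \<le> \<Psi> M k)
       \<and> \<Psi> 0 0 \<le> G"
  shows "wp a w c_stage F s \<le> a * ennreal (stage_time R) + G"
proof -
  let ?S = "{0..<n} - R"
  have RV: "R \<subseteq> {0..<n}" using inv by (simp add: stage_inv_def)
  have tau0: "0 \<le> tau R" by (simp add: tau_def)
  let ?B = "a * ennreal 5 + (a * ennreal (13 * real M * tau R + 1) + (a * 3 + G))"
  have "wp a w c_scan (wp a w c_start (wp a w c_walk (wp a w c_finish F))) s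
      \<le> a * ennreal (3 + 7 * real (length es)) + ?B"
  proof (rule htD[OF ht_scan[OF R, of a "s 9"]], use inv in simp, intro allI impI)
    fix s1 assume s1: "stage_inv R s1 \<and> s1 9 = s 9 \<and> s1 19 0 \<in> {0..<n} - R \<and> (R \<noteq> {} \<longrightarrow> nb (s1 19 0) \<inter> R \<noteq> {})"
    define v where "v = s1 19 0"
    have v: "admissible_next R v" using s1 by (simp add: admissible_next_def v_def)
    then have vS: "v \<in> ?S" by (simp add: admissible_next_def)
    obtain \<Psi> :: "nat \<Rightarrow> nat \<Rightarrow> ennreal" where
      sup: "\<And>\<rho> k. \<rho> < M \<Longrightarrow> k \<le> L \<Longrightarrow> ennreal (succ_prob ?S v) * \<Psi> (Suc \<rho>) (min L (Suc k))
          + ennreal (1 - succ_prob ?S v) * \<Psi> \<rho> (min L (Suc k)) \<le> \<Psi> \<rho> k"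
      and post: "\<And>s' k. stage_inv (insert v R) s' \<Longrightarrow> s' 9 = (s 9)(v := k) \<Longrightarrow> M \<le> k \<Longrightarrow> k \<le> L \<Longrightarrow> F s' \<le> \<Psi> M k"
      and G: "\<Psi> 0 0 \<le> G"
      using \<Psi>[OF v] by (elim exE conjE) blast
    note pot = stage_potentials[OF RV v]
    let ?s2 = "run w c_start s1"
    have r: "?s2 b = (if b = 20 then (s1 20)(0 := 0) else if b = 21 then (s1 21)(0 := 0)
        else if b = 7 then (s1 7)(0 := v) else if b = 8 then (s1 8)(v := 0) else if b = 22 then (s1 22)(0 := 1) else s1 b)" for b
      unfolding c_start_def by (simp add: update_def const_simps v_def)
    have "stage_inv R ?s2"
    proof (rule stage_inv_cong[of R s1])
      show "stage_inv R s1" using s1 by blast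
    next
      fix b :: nat assume "b \<notin> {7, 8, 15, 16, 17, 19, 20, 21, 22, 23, 24}"
      then show "?s2 b = s1 b" by (simp add: r)
    qed
    moreover have "[v] \<in> paths ?S v" using vS by (simp add: paths_def)
    ultimately have winv: "walk_inv R (s 9) v [v] ?s2"
      using s1 by (simp add: r walk_inv_def v_def)
    have S1: "wp a w c_start (wp a w c_walk (wp a w c_finish F)) s1
        \<le> a * ennreal (real (len c_start)) + wp a w c_walk (wp a w c_finish F) ?s2"
      by (rule wp_straight) (simp add: c_start_def)
    have S2: "wp a w c_walk (wp a w c_finish F) ?s2 \<le> a * ennreal (13 * real M * tau R + 1) + (a * 3 + \<Psi> 0 0)"
    proof (rule wp_walk[where \<Psi> = "\<lambda>\<rho> k. a * 3 + \<Psi> \<rho> k", OF winv _ _ tau0 pot(1-3)])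
      fix \<rho> k assume "\<rho> < M" "k \<le> L"
      then show "ennreal (succ_prob ?S v) * (a * 3 + \<Psi> (Suc \<rho>) (min L (Suc k)))
          + ennreal (1 - succ_prob ?S v) * (a * 3 + \<Psi> \<rho> (min L (Suc k))) \<le> a * 3 + \<Psi> \<rho> k"
        using pot(4,5) by (subst ennreal_convex) (auto intro!: add_left_mono sup)
    next
      fix s' assume s': "stage_inv R s'" "s' 9 = s 9" "s' 19 0 = v" "M \<le> s' 20 0" "s' 20 0 \<le> L"
      let ?f = "run w c_finish s'"
      have cR: "Suc (card R) mod 2 ^ w = Suc (card R)"
      proof -
        have "card (insert v R) \<le> card {0..<n}" using RV vS by (intro card_mono) auto
        then have "Suc (card R) \<le> n" using vS RV finite_subset[OF RV] by (simp add: card_insert_if)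
        then show ?thesis using bounds(11) by simp
      qed
      have rf: "?f b = (if b = 9 then (s' 9)(v := s' 20 0) else if b = 6 then (s' 6)(v := 1)
          else if b = 18 then (s' 18)(0 := Suc (card R)) else s' b)" for b
        unfolding c_finish_def using s' cR by (simp add: update_def const_simps stage_inv_def)
      have "stage_inv (insert v R) ?f"
        using s' vS finite_subset[OF RV] by (auto simp: rf stage_inv_def par_def inp_def adj_upto_def)
      moreover have "?f 9 = (s 9)(v := s' 20 0)" using s' by (simp add: rf)
      ultimately have "F ?f \<le> \<Psi> M (s' 20 0)" using s' by (intro post)
      moreover have "wp a w c_finish F s' \<le> a * ennreal (real (len c_finish)) + F ?f"
        by (rule wp_straight) (simp add: c_finish_def)
      moreover have "len c_finish = 3" by (simp add: c_finish_def)
      ultimately show "wp a w c_finish F s' \<le> a * 3 + \<Psi> M (s' 20 0)"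
        by (simp add: order.trans[OF _ add_left_mono])
    qed (simp_all add: r)
    have "wp a w c_start (wp a w c_walk (wp a w c_finish F)) s1
        \<le> a * ennreal (real (len c_start)) + (a * ennreal (13 * real M * tau R + 1) + (a * 3 + \<Psi> 0 0))"
      by (rule order_trans[OF S1 add_left_mono[OF S2]])
    also have "\<dots> \<le> ?B" using G by (intro add_mono order_refl) (simp_all add: c_start_def)
    finally show "wp a w c_start (wp a w c_walk (wp a w c_finish F)) s1 \<le> ?B" .
  qed
  also have "a * ennreal (3 + 7 * real (length es)) + ?B = a * ennreal (stage_time R) + G"
  proof -
    have "ennreal (stage_time R) = ennreal (3 + 7 * real (length es)) + ennreal 5 + ennreal (13 * real M * tau R + 1) + 3"
      unfolding stage_time_def using tau0 by (simp add: ennreal_plus)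
    then show ?thesis by (simp only: distrib_left add.assoc)
  qed
  finally show ?thesis by (simp only: c_stage_def wp_Seq)
qed

text \<open>\<open>stage_time\<close> depends only on whether \<open>R\<close> is empty, and
  \<open>{0}\<close> stands for any nonempty set. The dear stage is the one entered with all
  \<open>n\<close> vertices left.\<close>

lemma ht_stages:
  "ht a w (\<lambda>s. stage_inv {} s) c_stages (1 + real n * (1 + stage_time {0}) + stage_time {}) (\<lambda>s. stage_inv {0..<n} s)"
proof -
  let ?I = "\<lambda>s. \<exists>R. stage_inv R s"
  let ?e = "Less (gv 18) (gv 0)"
  let ?T4 = "stage_time {0}" and ?T6 = "stage_time {}"
  have nn: "0 \<le> stage_time R" for R by (simp add: stage_time_def tau_def)
  have test: "eval w s ?e \<noteq> 0 \<longleftrightarrow> card R < n" if "stage_inv R s" for s R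
    using that w_pos by (simp add: stage_inv_def par_def inp_def)
  have "ht a w (\<lambda>s. ?I s \<and> n - s 18 0 \<le> n) c_stages (1 + real n * (1 + ?T4) + (if n \<le> n then ?T6 else 0)) (\<lambda>s. ?I s \<and> eval w s ?e = 0)"
    unfolding c_stages_def
  proof (rule ht_while_gen[where Tb = "\<lambda>k. if Suc k = n then ?T6 else ?T4" and T = "\<lambda>k. 1 + real k * (1 + ?T4) + (if n \<le> k then ?T6 else 0)"])
    fix s assume I: "?I s" and e: "eval w s ?e \<noteq> 0"
    then obtain R where R: "stage_inv R s" by blast
    then have "card R < n" using iffD1[OF test[OF R] e] by simp
    then show "0 < n - s 18 0" using R by (simp add: stage_inv_def)
  next
    fix k
    show "ht a w (\<lambda>s. ?I s \<and> eval w s ?e \<noteq> 0 \<and> n - s 18 0 = Suc k) c_stage (if Suc k = n then ?T6 else ?T4)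
        (\<lambda>s. ?I s \<and> n - s 18 0 \<le> k)"
      unfolding ht_def
    proof (intro allI impI)
      fix s and F :: "mem \<Rightarrow> ennreal" and G :: ennreal
      assume s: "?I s \<and> eval w s ?e \<noteq> 0 \<and> n - s 18 0 = Suc k" and G: "\<forall>s'. ?I s' \<and> n - s' 18 0 \<le> k \<longrightarrow> F s' \<le> G"
      obtain R where inv: "stage_inv R s" using s by blast
      have card: "card R = s 18 0" "R \<subseteq> {0..<n}" using inv by (auto simp: stage_inv_def)
      have ne: "R \<noteq> {0..<n}" using s card by auto
      have finR: "finite R" using card finite_subset by blast
      have "wp a w c_stage F s \<le> a * ennreal (stage_time R) + G"
      proof (rule wp_stage[OF inv ne])
        fix v assume v: "admissible_next R v"
        have "F s' \<le> G" if "stage_inv (insert v R) s'" for s'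
        proof -
          have "s' 18 0 = Suc (card R)" using that v finR by (simp add: stage_inv_def admissible_next_def)
          then show ?thesis using G that s card by auto
        qed
        moreover have "ennreal (succ_prob ({0..<n} - R) v) * G + ennreal (1 - succ_prob ({0..<n} - R) v) * G \<le> G"
          using ennreal_convex[of "succ_prob ({0..<n} - R) v" G 0 0] stage_potentials(4,5)[OF card(2) v] by simp
        ultimately show "\<exists>\<Psi> :: nat \<Rightarrow> nat \<Rightarrow> ennreal.
           (\<forall>\<rho> k. \<rho> < M \<longrightarrow> k \<le> L \<longrightarrow> ennreal (succ_prob ({0..<n} - R) v) * \<Psi> (Suc \<rho>) (min L (Suc k))
              + ennreal (1 - succ_prob ({0..<n} - R) v) * \<Psi> \<rho> (min L (Suc k)) \<le> \<Psi> \<rho> k)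
           \<and> (\<forall>s' k. stage_inv (insert v R) s' \<longrightarrow> s' 9 = (s 9)(v := k) \<longrightarrow> M \<le> k \<longrightarrow> k \<le> L \<longrightarrow> F s' \<le> \<Psi> M k)
           \<and> \<Psi> 0 0 \<le> G"
          by (intro exI[of _ "\<lambda>_ _. G"]) auto
      qed
      moreover have "stage_time R = (if Suc k = n then ?T6 else ?T4)"
      proof -
        have "n - card R = Suc k" using s card(1) by simp
        then have "Suc k = n \<longleftrightarrow> card R = 0" by arith
        then have "Suc k = n \<longleftrightarrow> R = {}" by (simp only: card_0_eq[OF finR])
        then show ?thesis by (auto simp: stage_time_def tau_def)
      qed
      ultimately show "wp a w c_stage F s \<le> a * ennreal (if Suc k = n then ?T6 else ?T4) + G" by simp
    qed
  qed (use nn[of "{0}"] nn[of "{}"] in \<open>auto simp: algebra_simps\<close>)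
  then show ?thesis
  proof (rule ht_conseq)
    fix s assume s: "?I s \<and> eval w s ?e = 0"
    then obtain R where R: "stage_inv R s" by blast
    have "\<not> card R < n"
    proof
      assume "card R < n"
      then have "eval w s ?e \<noteq> 0" by (rule iffD2[OF test[OF R]])
      from this conjunct2[OF s] show False by (rule notE)
    qed
    moreover have "R \<subseteq> {0..<n}" using R by (simp add: stage_inv_def)
    ultimately have "R = {0..<n}" using card_seteq[of "{0..<n}" R] by simp
    then show "stage_inv {0..<n} s" using R by simp
  qed auto
qed

end

section \<open>Chebyshev's inequality in the form of a potential\<close>

section \<open>Accuracy\<close>

text \<open>\<open>u\<close> predicts the final number of excursions and \<open>z\<close> is the
  variance left. A success moves \<open>u\<close> by \<open>1 - 1 / r\<close> and removes the
  variance \<open>(1 - r) / r^2\<close> of one geometric variable, a failure moves \<open>u\<close>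
  by 1; the predicted second moment is a martingale.\<close>

lemma quad_step:
  fixes r u z :: real
  assumes "0 < r"
  shows "r * ((u + 1 - 1 / r)\<^sup>2 + (z - (1 - r) / r\<^sup>2)) + (1 - r) * ((u + 1)\<^sup>2 + z) = u\<^sup>2 + z"
proof -
  define i where "i = 1 / r"
  have i: "r * i = 1" using assms by (simp add: i_def)
  have e: "(1 - r) / r\<^sup>2 = (1 - r) * i * i" by (simp add: i_def power2_eq_square)
  show ?thesis unfolding e unfolding i_def[symmetric] power2_eq_square using i by algebra
qed

lemma lin_step:
  fixes r u :: real
  assumes "0 < r"
  shows "r * (u + 1 - 1 / r) + (1 - r) * (u + 1) = u"
  using assms by (simp add: algebra_simps)

text \<open>The expectation, given the current state, of a quadratic function of the number of
  excursions at the end of the stage, plus a bound on the probability of reaching \<open>L\<close> excursions: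
  the number of excursions still needed is a sum of \<open>M - \<rho>\<close> geometric variables with parameter \<open>r\<close>.\<close>

definition quad_pot :: "real \<Rightarrow> real \<Rightarrow> real \<Rightarrow> real \<Rightarrow> real \<Rightarrow> real \<Rightarrow> real" where
  "quad_pot l \<alpha> \<beta> e u z = (\<alpha> * (u\<^sup>2 + z) - 2 * \<beta> * u + 1) * e + u / l"

definition excursion_pot :: "nat \<Rightarrow> nat \<Rightarrow> real \<Rightarrow> real \<Rightarrow> real \<Rightarrow> real \<Rightarrow> real \<Rightarrow> nat \<Rightarrow> nat \<Rightarrow> real" where
  "excursion_pot L M r \<alpha> \<beta> e c \<rho> k = (if L \<le> k then 1 else
     quad_pot L \<alpha> \<beta> e (k + (real M - real \<rho>) / r) ((real M - real \<rho>) * ((1 - r) / r\<^sup>2)) + c)"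

text \<open>Completing the square: for \<open>\<alpha> \<ge> \<beta>^2\<close> the quadratic part is
  at least \<open>(\<beta> * u - 1)^2\<close>, so the Markov term \<open>u / l\<close> remains as a
  lower bound.\<close>

lemma quad_pot_ge:
  assumes "\<beta>\<^sup>2 \<le> \<alpha>" "0 \<le> z" "0 \<le> e"
  shows "u / l \<le> quad_pot l \<alpha> \<beta> e u z"
proof -
  have a: "0 \<le> \<alpha>" using assms(1) zero_le_power2[of \<beta>] by linarith
  have "\<beta>\<^sup>2 * u\<^sup>2 \<le> \<alpha> * u\<^sup>2" using assms(1) by (intro mult_right_mono) auto
  moreover have "0 \<le> \<alpha> * z" using a assms(2) by simp
  moreover have "0 \<le> (\<beta> * u - 1)\<^sup>2" by simp
  moreover have "(\<beta> * u - 1)\<^sup>2 = \<beta>\<^sup>2 * u\<^sup>2 - 2 * \<beta> * u + 1" by (simp add: power2_eq_square algebra_simps)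
  ultimately have "0 \<le> \<alpha> * (u\<^sup>2 + z) - 2 * \<beta> * u + 1" by (simp add: distrib_left)
  then show ?thesis using assms(3) by (simp add: quad_pot_def)
qed

lemma quad_pot_step:
  assumes r: "0 < r"
  shows "r * quad_pot l \<alpha> \<beta> e (u + 1 - 1 / r) (z - (1 - r) / r\<^sup>2) + (1 - r) * quad_pot l \<alpha> \<beta> e (u + 1) z
    = quad_pot l \<alpha> \<beta> e u z"
proof -
  let ?a = "u + 1 - 1 / r" and ?y = "z - (1 - r) / r\<^sup>2"
  have "r * quad_pot l \<alpha> \<beta> e ?a ?y + (1 - r) * quad_pot l \<alpha> \<beta> e (u + 1) z
      = (\<alpha> * (r * (?a\<^sup>2 + ?y) + (1 - r) * ((u + 1)\<^sup>2 + z)) - 2 * \<beta> * (r * ?a + (1 - r) * (u + 1)) + 1) * e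
        + (r * ?a + (1 - r) * (u + 1)) * (1 / l)"
    unfolding quad_pot_def divide_inverse[of _ l] mult_1_left by (simp only: algebra_simps)
  then show ?thesis unfolding quad_step[OF r] lin_step[OF r] by (simp add: quad_pot_def)
qed

lemma excursion_pot_nonneg:
  assumes "0 < r" "r \<le> 1" "\<beta>\<^sup>2 \<le> \<alpha>" "0 \<le> e" "0 \<le> c" "\<rho> \<le> M"
  shows "0 \<le> excursion_pot L M r \<alpha> \<beta> e c \<rho> k"
proof (cases "L \<le> k")
  case False
  let ?u = "k + (real M - real \<rho>) / r"
  have "0 \<le> ?u / L" using assms by simp
  also have "\<dots> \<le> quad_pot L \<alpha> \<beta> e ?u ((real M - real \<rho>) * ((1 - r) / r\<^sup>2))"
    using assms by (intro quad_pot_ge) auto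
  finally show ?thesis using False assms(5) by (simp add: excursion_pot_def)
qed (simp add: excursion_pot_def)

lemma excursion_pot_step:
  assumes r: "0 < r" "r \<le> 1" and ab: "\<beta>\<^sup>2 \<le> \<alpha>" "0 \<le> e" "0 \<le> c" and L: "0 < L" and \<rho>: "\<rho> < M" and k: "k \<le> L"
  defines "\<Psi> \<equiv> excursion_pot L M r \<alpha> \<beta> e c"
  shows "r * \<Psi> (Suc \<rho>) (min L (Suc k)) + (1 - r) * \<Psi> \<rho> (min L (Suc k)) \<le> \<Psi> \<rho> k"
proof (cases "Suc k < L")
  case True
  let ?u = "k + (real M - real \<rho>) / r" and ?z = "(real M - real \<rho>) * ((1 - r) / r\<^sup>2)"
  have "\<Psi> (Suc \<rho>) (Suc k) = quad_pot L \<alpha> \<beta> e (?u + 1 - 1 / r) (?z - (1 - r) / r\<^sup>2) + c"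
  proof -
    have "real (Suc k) + (real M - real (Suc \<rho>)) / r = ?u + 1 - 1 / r" by (simp add: diff_divide_distrib add_divide_distrib)
    moreover have "(real M - real (Suc \<rho>)) * ((1 - r) / r\<^sup>2) = ?z - (1 - r) / r\<^sup>2"
    proof -
      have "(real M - real (Suc \<rho>)) * d = (real M - real \<rho>) * d - d" for d by (simp add: algebra_simps)
      then show ?thesis .
    qed
    ultimately show ?thesis using True by (simp only: \<Psi>_def excursion_pot_def) simp
  qed
  moreover have "\<Psi> \<rho> (Suc k) = quad_pot L \<alpha> \<beta> e (?u + 1) ?z + c"
  proof -
    have "real (Suc k) + (real M - real \<rho>) / r = ?u + 1" by simp
    then show ?thesis using True by (simp only: \<Psi>_def excursion_pot_def) simp
  qed
  moreover have "\<Psi> \<rho> k = quad_pot L \<alpha> \<beta> e ?u ?z + c" using True by (simp add: \<Psi>_def excursion_pot_def)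
  moreover have "min L (Suc k) = Suc k" using True by simp
  moreover have "r * (x + c) + (1 - r) * (y + c) = r * x + (1 - r) * y + c" for x y by (simp add: algebra_simps)
  ultimately show ?thesis using quad_pot_step[OF r(1), of L \<alpha> \<beta> e ?u ?z] by simp
next
  case False
  then have m: "min L (Suc k) = L" by simp
  \<comment> \<open>The next excursion reaches the cap, where the potential is 1. The prediction
    \<open>?u\<close> is then at least \<open>k + 1 \<ge> L\<close> already, so the Markov term
    alone is at least 1.\<close>
  have "1 \<le> \<Psi> \<rho> k"
  proof (cases "L \<le> k")
    case no: False
    let ?u = "k + (real M - real \<rho>) / r"
    have "1 \<le> real M - real \<rho>" using \<rho> by linarith
    then have "r \<le> real M - real \<rho>" using r by linarith
    then have "1 \<le> (real M - real \<rho>) / r" using r by (simp add: le_divide_eq)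
    moreover have "real L \<le> real k + 1" using False by linarith
    ultimately have "real L \<le> ?u" by linarith
    then have "1 \<le> ?u / L" using L by (simp add: le_divide_eq)
    also have "\<dots> \<le> quad_pot L \<alpha> \<beta> e ?u ((real M - real \<rho>) * ((1 - r) / r\<^sup>2))"
      using r ab \<rho> by (intro quad_pot_ge) auto
    finally show ?thesis using no ab by (simp add: \<Psi>_def excursion_pot_def)
  qed (simp add: \<Psi>_def excursion_pot_def)
  then show ?thesis unfolding m by (simp add: \<Psi>_def excursion_pot_def)
qed

text \<open>The choice of \<open>\<beta>\<close> turns the mean count \<open>M / r\<close> into
  \<open>Y\<close> again, and the variance \<open>M * (1 - r) / r^2\<close> increases the second
  moment by a factor of at most \<open>1 + 1 / M\<close>, which joins the power of
  \<open>g\<close>.\<close>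

lemma excursion_pot_start:
  fixes L M j :: nat and g Y r e c :: real
  assumes r: "0 < r" "r \<le> 1" and g: "1 + 1 / M = g" and M: "0 < M" and L: "0 < L" and e: "0 \<le> e"
  shows "excursion_pot L M r (g ^ j * (Y * r / M)\<^sup>2) (Y * r / M) e c 0 0
    \<le> (g ^ Suc j * Y\<^sup>2 - 2 * Y + 1) * e + M / (r * L) + c"
proof -
  let ?b = "Y * r / M" and ?u = "real M / r"
  have bu: "?b * ?u = Y" using r M by simp
  have g0: "0 \<le> g" using g by auto
  have "g ^ j * ?b\<^sup>2 * (?u\<^sup>2 + M * ((1 - r) / r\<^sup>2)) = g ^ j * (Y\<^sup>2 + Y\<^sup>2 * ((1 - r) / M))"
  proof -
    have "?b\<^sup>2 * ?u\<^sup>2 = Y\<^sup>2" using bu by (metis power_mult_distrib)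
    moreover have "?b\<^sup>2 * (M * ((1 - r) / r\<^sup>2)) = Y\<^sup>2 * ((1 - r) / M)"
      using r M by (simp add: power2_eq_square field_simps)
    ultimately show ?thesis by (simp only: distrib_left mult.assoc)
  qed
  also have "\<dots> \<le> g ^ j * (Y\<^sup>2 + Y\<^sup>2 * (1 / M))"
    using r g0 M by (intro mult_left_mono add_left_mono divide_right_mono) auto
  also have "\<dots> = g ^ Suc j * Y\<^sup>2" unfolding g[symmetric] by (simp add: algebra_simps)
  finally have 1: "g ^ j * ?b\<^sup>2 * (?u\<^sup>2 + M * ((1 - r) / r\<^sup>2)) \<le> g ^ Suc j * Y\<^sup>2" .
  have "excursion_pot L M r (g ^ j * ?b\<^sup>2) ?b e c 0 0
      = (g ^ j * ?b\<^sup>2 * (?u\<^sup>2 + M * ((1 - r) / r\<^sup>2)) - 2 * (?b * ?u) + 1) * e + M / (r * L) + c"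
    using L by (simp add: excursion_pot_def quad_pot_def mult.assoc)
  also have "\<dots> \<le> (g ^ Suc j * Y\<^sup>2 - 2 * Y + 1) * e + M / (r * L) + c"
    unfolding bu using 1 e by (intro add_right_mono mult_right_mono) auto
  finally show ?thesis .
qed

locale bicircular_accuracy = bicircular_run +
  fixes \<epsilon> :: real
  assumes eps: "0 < \<epsilon>" "\<epsilon> < 1" "1 / \<epsilon> \<le> real K" "real K \<le> 3 / \<epsilon>"
begin

text \<open>The ratio of \<open>num {0..<n}\<close> to the estimate obtained if the stages after \<open>R\<close> were exact.\<close>

definition Y :: "nat set \<Rightarrow> (nat \<Rightarrow> nat) \<Rightarrow> real" where
  "Y R C = (\<Prod>u\<in>R. real (C u) / (real M * card (nb u))) * num {0..<n} / num ({0..<n} - R)"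

text \<open>Chebyshev's bound for \<open>\<bar>Y - 1\<bar> < \<epsilon> / 3\<close>, with the growth
  \<open>1 + 1 / M\<close> of the second moment allowed for every remaining stage, plus a union
  bound over the remaining stages for reaching \<open>L\<close>. A third of
  \<open>\<epsilon>\<close> leaves room for rounding and for passing from the reciprocal to the
  estimate.\<close>

definition pot :: "nat set \<Rightarrow> (nat \<Rightarrow> nat) \<Rightarrow> real" where
  "pot R C = (if \<exists>u\<in>R. L \<le> C u then 1 else
     ((1 + 1 / real M) ^ (n - card R) * (Y R C)\<^sup>2 - 2 * Y R C + 1) * (9 / \<epsilon>\<^sup>2) + real (n - card R) / (8 * real n))"

lemma num_gt0: "S \<subseteq> {0..<n} \<Longrightarrow> 0 < num S"
  using nE by (auto intro!: num_pos[OF con])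

text \<open>The new factor is 1 when \<open>k\<close> equals its mean \<open>M / r\<close>; this
  makes \<open>Y\<close> a martingale for uncapped counts.\<close>

lemma Y_insert:
  assumes R: "R \<subseteq> {0..<n}" and v: "v \<in> {0..<n} - R"
  shows "Y (insert v R) (C(v := k)) = Y R C * succ_prob ({0..<n} - R) v / M * k"
proof -
  have fin: "finite R" using R finite_subset by blast
  have p: "(\<Prod>u\<in>insert v R. real ((C(v := k)) u) / (real M * card (nb u)))
      = real k / (real M * card (nb v)) * (\<Prod>u\<in>R. real (C u) / (real M * card (nb u)))"
  proof -
    have "(\<Prod>u\<in>R. real ((C(v := k)) u) / (real M * card (nb u))) = (\<Prod>u\<in>R. real (C u) / (real M * card (nb u)))"
      using v by (intro prod.cong) auto
    then show ?thesis using fin v by simp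
  qed
  have d: "{0..<n} - insert v R = {0..<n} - R - {v}" by auto
  have "0 < num ({0..<n} - R)" by (rule num_gt0) auto
  then show ?thesis unfolding Y_def p d succ_prob_def by (simp add: mult.assoc mult.commute mult.left_commute)
qed

lemma pot_stage:
  assumes R: "R \<subseteq> {0..<n}" and v: "admissible_next R v"
  shows "\<exists>\<Psi> :: nat \<Rightarrow> nat \<Rightarrow> ennreal.
       (\<forall>\<rho> k. \<rho> < M \<longrightarrow> k \<le> L \<longrightarrow> ennreal (succ_prob ({0..<n} - R) v) * \<Psi> (Suc \<rho>) (min L (Suc k))
          + ennreal (1 - succ_prob ({0..<n} - R) v) * \<Psi> \<rho> (min L (Suc k)) \<le> \<Psi> \<rho> k)
       \<and> (\<forall>k. ennreal (pot (insert v R) (C(v := k))) \<le> \<Psi> M k)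
       \<and> \<Psi> 0 0 \<le> ennreal (pot R C)"
proof -
  let ?r = "succ_prob ({0..<n} - R) v"
  note pt = stage_potentials(4-6)[OF R v]
  have vS: "v \<in> {0..<n} - R" using v by (simp add: admissible_next_def)
  have fin: "finite R" using R finite_subset by blast
  show ?thesis
  proof (cases "\<exists>u\<in>R. L \<le> C u")
    case True
    then have "pot R C = 1" by (simp add: pot_def)
    moreover have "pot (insert v R) (C(v := k)) = 1" for k
    proof -
      obtain u where "u \<in> R" "L \<le> C u" using True by blast
      then have "\<exists>u\<in>insert v R. L \<le> (C(v := k)) u" using vS by (intro bexI[of _ u]) auto
      then show ?thesis by (simp only: pot_def if_True)
    qed
    moreover have "ennreal ?r * 1 + ennreal (1 - ?r) * 1 \<le> 1"
      using pt by (simp add: ennreal_plus[symmetric] del: ennreal_plus)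
    ultimately show ?thesis by (intro exI[of _ "\<lambda>_ _. 1"]) simp
  next
    case False
    let ?y = "Y R C" and ?g = "1 + 1 / real M" and ?e = "9 / \<epsilon>\<^sup>2"
    define j where "j = n - Suc (card R)"
    have "card R < card {0..<n}" using R vS by (intro psubset_card_mono) auto
    then have j: "n - card R = Suc j" "n - card (insert v R) = j" using fin vS by (auto simp: j_def)
    \<comment> \<open>\<open>?b * k\<close> is the value of \<open>Y\<close> after the stage, so the
      quadratic part at the end of the stage is that of \<open>pot (insert v R)\<close>.\<close>
    let ?b = "?y * ?r / M" and ?c = "real j / (8 * real n)"
    let ?a = "?g ^ j * ?b\<^sup>2"
    let ?P = "excursion_pot L M ?r ?a ?b ?e ?c"
    have e: "0 \<le> ?e" "0 \<le> ?c" by auto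
    have "1 \<le> ?g ^ j" by (rule one_le_power) auto
    then have ab: "?b\<^sup>2 \<le> ?a" using mult_right_mono[of 1 "?g ^ j" "?b\<^sup>2"] by simp
    have nn: "0 \<le> ?P \<rho> k" if "\<rho> \<le> M" for \<rho> k
      by (rule excursion_pot_nonneg[OF pt(1,2) ab e that])
    have "ennreal ?r * ennreal (?P (Suc \<rho>) (min L (Suc k))) + ennreal (1 - ?r) * ennreal (?P \<rho> (min L (Suc k))) \<le> ennreal (?P \<rho> k)"
      if \<rho>: "\<rho> < M" "k \<le> L" for \<rho> k
    proof -
      have "0 \<le> ?P (Suc \<rho>) (min L (Suc k))" "0 \<le> ?P \<rho> (min L (Suc k))" using \<rho> by (auto intro!: nn)
      then have "ennreal ?r * ennreal (?P (Suc \<rho>) (min L (Suc k))) + ennreal (1 - ?r) * ennreal (?P \<rho> (min L (Suc k)))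
          = ennreal (?r * ?P (Suc \<rho>) (min L (Suc k)) + (1 - ?r) * ?P \<rho> (min L (Suc k)))"
        using pt(1,2) by (simp add: ennreal_plus ennreal_mult)
      then show ?thesis
        using ennreal_leI[OF excursion_pot_step[OF pt(1,2) ab e pos(4) \<rho>]] by (simp only:)
    qed
    moreover have "pot (insert v R) (C(v := k)) \<le> ?P M k" for k
    proof (cases "L \<le> k")
      case True
      then have "pot (insert v R) (C(v := k)) = 1" by (simp add: pot_def)
      then show ?thesis using True by (simp add: excursion_pot_def)
    next
      case no: False
      have "\<not> (\<exists>u\<in>insert v R. L \<le> (C(v := k)) u)" using False no vS by auto
      then have "pot (insert v R) (C(v := k)) = (?g ^ j * (?b * k)\<^sup>2 - 2 * (?b * k) + 1) * ?e + ?c"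
        unfolding pot_def j(2) Y_insert[OF R vS] by (simp only: if_False)
      moreover have "?P M k = (?a * (real k)\<^sup>2 - 2 * ?b * k + 1) * ?e + k / L + ?c"
        using no by (simp add: excursion_pot_def quad_pot_def)
      moreover have "?g ^ j * (?b * k)\<^sup>2 = ?a * (real k)\<^sup>2" by (simp only: power_mult_distrib mult.assoc)
      moreover have "0 \<le> real k / L" by simp
      ultimately show ?thesis by (simp only: mult.assoc)
    qed
    moreover have "?P 0 0 \<le> pot R C"
    proof -
      have "?P 0 0 \<le> (?g ^ Suc j * ?y\<^sup>2 - 2 * ?y + 1) * ?e + M / (?r * L) + ?c"
        by (rule excursion_pot_start[OF pt(1,2) refl pos(3,4) e(1)])
      \<comment> \<open>Markov's inequality for one stage; the bound on \<open>1 / ?r\<close> comes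
        from the expected length of the walk.\<close>
      moreover have "M / (?r * L) \<le> 1 / (8 * real n)"
      proof -
        have "M / (?r * L) = (1 / ?r) * (real M / L)" by simp
        also have "\<dots> \<le> 6 * real n ^ 2 * (real M / L)" by (rule mult_right_mono[OF pt(3)]) simp
        also have "\<dots> = 1 / (8 * real n)" unfolding L_def using pos by (simp add: power2_eq_square)
        finally show ?thesis .
      qed
      moreover have "real (Suc j) / (8 * real n) = ?c + 1 / (8 * real n)" by (simp add: add_divide_distrib)
      moreover have "pot R C = (?g ^ Suc j * ?y\<^sup>2 - 2 * ?y + 1) * ?e + real (Suc j) / (8 * real n)"
        unfolding pot_def j(1) using False by (simp only: if_False)
      ultimately show ?thesis by linarith
    qed
    ultimately show ?thesis
      by (intro exI[of _ "\<lambda>\<rho> k. ennreal (?P \<rho> k)"]) (auto intro!: ennreal_leI)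
  qed
qed

lemma wp_stages:
  assumes s: "stage_inv {} s" and F: "\<And>s'. stage_inv {0..<n} s' \<Longrightarrow> F s' \<le> ennreal (pot {0..<n} (s' 9))"
  shows "wp 0 w c_stages F s \<le> ennreal (pot {} (s 9))"
proof -
  \<comment> \<open>The loop bound must be a function of the memory, so \<open>R\<close> is read
    back from the flags in array 6.\<close>
  define \<Phi> where "\<Phi> s = (if \<exists>R. stage_inv R s then ennreal (pot {u. u < n \<and> s 6 u = 1} (s 9)) else \<top>)" for s
  have \<Phi>_eq: "\<Phi> s = ennreal (pot R (s 9))" if inv: "stage_inv R s" for R s
  proof -
    have "{u. u < n \<and> s 6 u = 1} = R" using inv by (auto simp: stage_inv_def of_bool_def split: if_splits)
    then show ?thesis using inv unfolding \<Phi>_def by auto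
  qed
  let ?e = "Less (gv 18) (gv 0)"
  have "0 + (if eval w s ?e \<noteq> 0 then wp 0 w c_stage \<Phi> s else F s) \<le> \<Phi> s" for s
  proof (cases "\<exists>R. stage_inv R s")
    case False
    then have "\<Phi> s = \<top>" unfolding \<Phi>_def by (rule if_not_P)
    then show ?thesis by (simp del: eval.simps)
  next
    case True
    then obtain R where inv: "stage_inv R s" by blast
    have R: "R \<subseteq> {0..<n}" using inv by (simp add: stage_inv_def)
    have test: "eval w s ?e \<noteq> 0 \<longleftrightarrow> card R < n" using inv w_pos by (simp add: stage_inv_def par_def inp_def)
    show ?thesis
    proof (cases "card R < n")
      case False
      then have "R = {0..<n}" using card_seteq[OF _ R] by simp
      then have "F s \<le> \<Phi> s" using F[of s] inv \<Phi>_eq[OF inv] by simp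
      then show ?thesis using False test by (simp del: eval.simps)
    next
      case True
      have "wp 0 w c_stage \<Phi> s \<le> 0 * ennreal (stage_time R) + ennreal (pot R (s 9))"
      proof (rule wp_stage[OF inv])
        show "R \<noteq> {0..<n}" using True by auto
      next
        fix v assume v: "admissible_next R v"
        obtain \<Psi> :: "nat \<Rightarrow> nat \<Rightarrow> ennreal" where
          P: "\<forall>\<rho> k. \<rho> < M \<longrightarrow> k \<le> L \<longrightarrow> ennreal (succ_prob ({0..<n} - R) v) * \<Psi> (Suc \<rho>) (min L (Suc k))
            + ennreal (1 - succ_prob ({0..<n} - R) v) * \<Psi> \<rho> (min L (Suc k)) \<le> \<Psi> \<rho> k"
            "\<forall>k. ennreal (pot (insert v R) ((s 9)(v := k))) \<le> \<Psi> M k" "\<Psi> 0 0 \<le> ennreal (pot R (s 9))"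
          using pot_stage[OF R v, of "s 9"] by (elim exE conjE)
        have "\<forall>s' k. stage_inv (insert v R) s' \<longrightarrow> s' 9 = (s 9)(v := k) \<longrightarrow> M \<le> k \<longrightarrow> k \<le> L \<longrightarrow> \<Phi> s' \<le> \<Psi> M k"
          using P(2) by (simp add: \<Phi>_eq)
        with P(1,3) show "\<exists>\<Psi> :: nat \<Rightarrow> nat \<Rightarrow> ennreal.
           (\<forall>\<rho> k. \<rho> < M \<longrightarrow> k \<le> L \<longrightarrow> ennreal (succ_prob ({0..<n} - R) v) * \<Psi> (Suc \<rho>) (min L (Suc k))
              + ennreal (1 - succ_prob ({0..<n} - R) v) * \<Psi> \<rho> (min L (Suc k)) \<le> \<Psi> \<rho> k)
           \<and> (\<forall>s' k. stage_inv (insert v R) s' \<longrightarrow> s' 9 = (s 9)(v := k) \<longrightarrow> M \<le> k \<longrightarrow> k \<le> L \<longrightarrow> \<Phi> s' \<le> \<Psi> M k)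
           \<and> \<Psi> 0 0 \<le> ennreal (pot R (s 9))"
          by (intro exI[of _ \<Psi>] conjI)
      qed
      then show ?thesis using True test \<Phi>_eq[OF inv] by (simp del: eval.simps)
    qed
  qed
  then have "wp 0 w c_stages F s \<le> \<Phi> s" unfolding c_stages_def by (rule wp_while_le)
  then show ?thesis by (simp only: \<Phi>_eq[OF s])
qed

lemma pot_initial: "pot {} C \<le> 1 / 4"
proof -
  let ?x = "1 / real M"
  have Y1: "Y {} C = 1" using num_gt0[of "{0..<n}"] by (simp add: Y_def)
  have "(1 / \<epsilon>)\<^sup>2 \<le> (real K)\<^sup>2" using eps by (intro power_mono) auto
  then have K2: "1 \<le> (real K)\<^sup>2 * \<epsilon>\<^sup>2" using eps by (simp add: power_divide divide_le_eq)
  \<comment> \<open>\<open>(1 + 1 / M) ^ n\<close> is at most \<open>exp t\<close>, and for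
    \<open>t \<le> 1\<close> this is at most \<open>1 + 2 * t\<close>.\<close>
  define t where "t = real n * ?x"
  have t: "t = 1 / (144 * (real K)\<^sup>2)" unfolding t_def M_def using pos by (simp add: power2_eq_square)
  have K1: "1 \<le> (real K)\<^sup>2" using pos by (simp add: one_le_power)
  have t01: "0 \<le> t" "t \<le> 1" using K1 by (auto simp: t divide_le_eq)
  have "(1 + ?x) ^ n \<le> exp ?x ^ n" by (intro power_mono exp_ge_add_one_self) auto
  also have "\<dots> = exp t" unfolding t_def by (rule exp_of_nat_mult[symmetric])
  also have "\<dots> \<le> 1 + t + t\<^sup>2" using t01 by (rule exp_bound)
  also have "\<dots> \<le> 1 + 2 * t"
    using t01 mult_left_mono[of t 1 t] by (simp add: power2_eq_square)
  finally have "((1 + ?x) ^ n - 1) * (9 / \<epsilon>\<^sup>2) \<le> (2 * t) * (9 / \<epsilon>\<^sup>2)" by (intro mult_right_mono) auto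
  also have "\<dots> = 1 / (8 * ((real K)\<^sup>2 * \<epsilon>\<^sup>2))" by (simp add: t)
  also have "\<dots> \<le> 1 / 8" using K2 by (simp add: divide_le_eq)
  finally have "((1 + ?x) ^ n - 1) * (9 / \<epsilon>\<^sup>2) \<le> 1 / 8" .
  moreover have "real n / (8 * real n) = 1 / 8" using pos by simp
  moreover have "pot {} C = ((1 + ?x) ^ n - 1) * (9 / \<epsilon>\<^sup>2) + real n / (8 * real n)"
    by (simp add: pot_def Y1)
  ultimately show ?thesis by linarith
qed

definition accurate :: "mem \<Rightarrow> bool" where
  "accurate s \<longleftrightarrow> (1 - \<epsilon>) * real (num {0..<n}) \<le> estimate s \<and> estimate s \<le> (1 + \<epsilon>) * real (num {0..<n})"

text \<open>\<open>y\<close> is the true number divided by the exact product, and a potential below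
  1 forces it within \<open>\<epsilon> / 3\<close> of 1 and excludes capped counts. The upper bound
  uses \<open>(1 + \<epsilon>) * (1 - \<epsilon> / 3) \<ge> 1\<close>; in the lower one a factor
  \<open>1 - \<epsilon> / 3\<close> remains for the rounding.\<close>

lemma accurate_final:
  assumes C: "\<And>u. u < n \<Longrightarrow> M \<le> C u \<and> C u \<le> L" and pot: "pot {0..<n} C < 1"
    and est: "(1 - 1 / real Q) ^ n * (\<Prod>u<n. fac C u) \<le> estimate s" "estimate s \<le> (\<Prod>u<n. fac C u)"
  shows "accurate s"
proof -
  define X where "X = (\<Prod>u<n. fac C u)"
  define y where "y = Y {0..<n} C"
  have X0: "0 \<le> X" unfolding X_def by (intro prod_nonneg) (simp add: fac_def)
  have N: "real (num {0..<n}) = X * y"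
  proof -
    have "(\<Prod>u<n. fac C u) * (\<Prod>u\<in>{0..<n}. real (C u) / (real M * card (nb u))) = 1"
    proof -
      have one: "fac C u * (real (C u) / (real M * card (nb u))) = 1" if "u < n" for u
        using C[OF that] nb_nonempty[OF that] pos by (auto simp: fac_def)
      have "(\<Prod>u<n. fac C u * (real (C u) / (real M * card (nb u)))) = 1"
        by (rule prod.neutral, intro ballI, rule one) simp
      then show ?thesis by (simp only: prod.distrib lessThan_atLeast0)
    qed
    then have XP: "X * (\<Prod>u\<in>{0..<n}. real (C u) / (real M * card (nb u))) = 1" by (simp only: X_def)
    have y': "y = (\<Prod>u\<in>{0..<n}. real (C u) / (real M * card (nb u))) * real (num {0..<n})"
      by (simp add: y_def Y_def num_empty)
    have "X * y = X * (\<Prod>u\<in>{0..<n}. real (C u) / (real M * card (nb u))) * real (num {0..<n})"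
      by (simp only: y' mult.assoc)
    then show ?thesis by (simp only: XP mult_1_left)
  qed
  have "\<not> (\<exists>u\<in>{0..<n}. L \<le> C u)"
  proof
    assume "\<exists>u\<in>{0..<n}. L \<le> C u"
    then have "pot {0..<n} C = 1" unfolding pot_def by (rule if_P)
    then show False using pot by simp
  qed
  then have "pot {0..<n} C = (y\<^sup>2 - 2 * y + 1) * (9 / \<epsilon>\<^sup>2)" by (simp add: pot_def y_def)
  also have "y\<^sup>2 - 2 * y + 1 = (y - 1)\<^sup>2" by (simp add: power2_eq_square algebra_simps)
  finally have "(y - 1)\<^sup>2 * (9 / \<epsilon>\<^sup>2) < 1" using pot by simp
  then have "(y - 1)\<^sup>2 < (\<epsilon> / 3)\<^sup>2" using eps by (simp add: power_divide field_simps)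
  then have "\<bar>y - 1\<bar>\<^sup>2 < (\<epsilon> / 3)\<^sup>2" by simp
  then have "\<bar>y - 1\<bar> < \<epsilon> / 3" by (rule power2_less_imp_less) (use eps in simp)
  then have y: "1 - \<epsilon> / 3 \<le> y" "y \<le> 1 + \<epsilon> / 3" by linarith+
  have up: "estimate s \<le> (1 + \<epsilon>) * (X * y)"
  proof -
    have "1 \<le> (1 + \<epsilon>) * (1 - \<epsilon> / 3)"
      using eps mult_left_mono[of \<epsilon> 1 \<epsilon>] by (simp add: algebra_simps)
    also have "\<dots> \<le> (1 + \<epsilon>) * y" using y eps by (intro mult_left_mono) auto
    finally have "X * 1 \<le> X * ((1 + \<epsilon>) * y)" using X0 by (rule mult_left_mono)
    then show ?thesis using est(2) by (simp only: X_def[symmetric] mult_1_right mult.left_commute)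
  qed
  have low: "(1 - \<epsilon>) * (X * y) \<le> estimate s"
  proof -
    \<comment> \<open>\<open>3 * n * K\<close> divides \<open>L\<close>; it is what bounds the
      rounding loss \<open>n / Q\<close> of all factors by \<open>\<epsilon> / 3\<close>.\<close>
    have Q: "3 * n * K \<le> Q"
    proof -
      have "3 * n * K \<le> 3 * n * K * (16 * 144 * (n * n * n) * K)" using pos by simp
      also have "\<dots> = L" unfolding L_def M_def by (algebra | simp add: ac_simps)
      finally show ?thesis using L_le_Q by linarith
    qed
    have Q1: "1 \<le> real Q" by (simp add: Q_def)
    have "real n / real Q \<le> \<epsilon> / 3"
    proof -
      have "1 \<le> \<epsilon> * K" using eps by (simp add: divide_le_eq mult.commute)
      then have "3 * real n * 1 \<le> 3 * real n * (\<epsilon> * K)" by (intro mult_left_mono) auto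
      also have "\<dots> = \<epsilon> * real (3 * n * K)" by simp
      also have "\<dots> \<le> \<epsilon> * real Q" using Q eps by (intro mult_left_mono of_nat_mono) auto
      finally show ?thesis using Q1 by (simp add: divide_le_eq)
    qed
    moreover have "1 + real n * (- (1 / real Q)) \<le> (1 + - (1 / real Q)) ^ n"
      using Q1 by (intro Bernoulli_inequality) (simp add: divide_le_eq)
    moreover have "1 + real n * (- (1 / real Q)) = 1 - real n / real Q" "1 + - (1 / real Q) = 1 - 1 / real Q" by simp_all
    ultimately have q: "1 - \<epsilon> / 3 \<le> (1 - 1 / real Q) ^ n" by (simp only:)
    have "(1 - \<epsilon>) * y \<le> (1 - \<epsilon>) * (1 + \<epsilon> / 3)" using y eps by (intro mult_left_mono) auto
    moreover have "(1 - \<epsilon>) * (1 + \<epsilon> / 3) \<le> 1 - \<epsilon> / 3" using eps by (simp add: algebra_simps)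
    ultimately have "(1 - \<epsilon>) * y \<le> (1 - 1 / real Q) ^ n" using q by linarith
    then have "(1 - \<epsilon>) * y * X \<le> (1 - 1 / real Q) ^ n * X" using X0 by (rule mult_right_mono)
    then show ?thesis using est(1) by (simp only: X_def[symmetric] mult.assoc mult.commute[of X])
  qed
  show ?thesis unfolding accurate_def N using up low by simp
qed

text \<open>By \<open>accurate_final\<close> an inaccurate outcome forces
  \<open>pot \<ge> 1\<close>, so the potential dominates the indicator of failure.\<close>

lemma wp_product:
  assumes s: "stage_inv {0..<n} s"
  shows "wp 0 w c_product (\<lambda>s. of_bool (\<not> accurate s)) s \<le> ennreal (pot {0..<n} (s 9))"
proof -
  have C: "M \<le> s 9 u \<and> s 9 u \<le> L" if "u < n" for u using s that by (simp add: stage_inv_def)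
  have "wp 0 w c_product (\<lambda>s. of_bool (\<not> accurate s)) s
      \<le> 0 * ennreal (4 + (5 + 3 * real H) * real n) + ennreal (pot {0..<n} (s 9))"
  proof (rule htD[OF ht_product[of "s 9", OF C]])
    show "stage_inv {0..<n} s \<and> s 9 = s 9" using s by simp
  next
    show "\<forall>s'. (1 - 1 / real Q) ^ n * (\<Prod>u<n. fac (s 9) u) \<le> estimate s' \<and> estimate s' \<le> (\<Prod>u<n. fac (s 9) u)
        \<longrightarrow> (of_bool (\<not> accurate s') :: ennreal) \<le> ennreal (pot {0..<n} (s 9))"
    proof (intro allI impI)
      fix s' assume est: "(1 - 1 / real Q) ^ n * (\<Prod>u<n. fac (s 9) u) \<le> estimate s' \<and> estimate s' \<le> (\<Prod>u<n. fac (s 9) u)"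
      show "(of_bool (\<not> accurate s') :: ennreal) \<le> ennreal (pot {0..<n} (s 9))"
      proof (cases "pot {0..<n} (s 9) < 1")
        case True
        then have "accurate s'" using accurate_final[of "s 9" s', OF C] est by blast
        then show ?thesis by simp
      next
        case False
        then have "1 \<le> ennreal (pot {0..<n} (s 9))" by (simp add: not_less)
        then show ?thesis by (cases "accurate s'") simp_all
      qed
    qed
  qed
  then show ?thesis by simp
qed

definition total_time :: real where
  "total_time = 4 + ((1 + 3 * real ell) + ((1 + 8 * real (length es))
     + ((1 + real n * (1 + stage_time {0}) + stage_time {}) + (4 + (5 + 3 * real H) * real n))))"

lemma stage_time_nonneg: "0 \<le> stage_time R"
  by (simp add: stage_time_def tau_def)

lemma ht_init:
  "ht a w (\<lambda>s. s = input_mem n es p q) (Seq c_params (Seq c_scale c_adj)) (4 + ((1 + 3 * real ell) + (1 + 8 * real (length es))))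
    (\<lambda>s. stage_inv {} s)"
proof (rule ht_conseq[OF ht_seq[OF ht_params ht_seq[OF ht_scale ht_adj]]])
  fix s assume "par s \<and> adj_upto (length es) s \<and> s 18 0 = 0 \<and> s 6 = (\<lambda>_. 0)"
  then show "stage_inv {} s" by (simp add: stage_inv_def)
qed auto

lemma wp_prog_assoc: "wp a w prog F s = wp a w (Seq c_params (Seq c_scale c_adj)) (wp a w c_stages (wp a w c_product F)) s"
  by (simp only: prog_def wp_Seq)

lemma wp_time: "wp 1 w prog (\<lambda>_. 0) (input_mem n es p q) \<le> ennreal total_time"
proof -
  let ?A = "4 + ((1 + 3 * real ell) + (1 + 8 * real (length es)))" and ?B = "1 + real n * (1 + stage_time {0}) + stage_time {}"
    and ?D = "4 + (5 + 3 * real H) * real n"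
  have nn: "0 \<le> ?A" "0 \<le> ?B" "0 \<le> ?D" using stage_time_nonneg by auto
  have D: "wp 1 w c_product (\<lambda>_. 0) s \<le> ennreal ?D" if s: "stage_inv {0..<n} s" for s
  proof -
    have C: "M \<le> s 9 u \<and> s 9 u \<le> L" if "u < n" for u using s that by (simp add: stage_inv_def)
    have "wp 1 w c_product (\<lambda>_. 0) s \<le> 1 * ennreal ?D + 0"
    proof (rule htD[where F = "\<lambda>_. 0" and G = 0 and s = s and a = 1, OF ht_product[of "s 9", OF C]])
      show "stage_inv {0..<n} s \<and> s 9 = s 9" using s by simp
    qed simp_all
    then show ?thesis by simp
  qed
  have B: "wp 1 w c_stages (wp 1 w c_product (\<lambda>_. 0)) s \<le> 1 * ennreal ?B + ennreal ?D" if s: "stage_inv {} s" for s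
    by (rule htD[where F = "wp 1 w c_product (\<lambda>_. 0)" and G = "ennreal ?D" and s = s and a = 1, OF ht_stages s])
      (intro allI impI, erule D)
  have "wp 1 w prog (\<lambda>_. 0) (input_mem n es p q) \<le> 1 * ennreal ?A + (1 * ennreal ?B + ennreal ?D)"
    unfolding wp_prog_assoc
    by (rule htD[where F = "wp 1 w c_stages (wp 1 w c_product (\<lambda>_. 0))" and G = "1 * ennreal ?B + ennreal ?D" and a = 1,
        OF ht_init refl]) (intro allI impI, erule B)
  moreover have "1 * ennreal ?A + (1 * ennreal ?B + ennreal ?D) = ennreal (?A + (?B + ?D))"
    using nn by (simp only: mult_1_left ennreal_plus add_nonneg_nonneg)
  moreover have "?A + (?B + ?D) = total_time" by (simp add: total_time_def)
  ultimately show ?thesis by (simp only:)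
qed

lemma wp_error: "wp 0 w prog (\<lambda>s. of_bool (\<not> accurate s)) (input_mem n es p q) \<le> ennreal (1 / 4)"
proof -
  let ?F = "\<lambda>s. of_bool (\<not> accurate s) :: ennreal"
  have B: "wp 0 w c_stages (wp 0 w c_product ?F) s \<le> ennreal (1 / 4)" if s: "stage_inv {} s" for s
  proof -
    have "wp 0 w c_stages (wp 0 w c_product ?F) s \<le> ennreal (pot {} (s 9))"
      by (rule wp_stages[OF s]) (rule wp_product)
    then show ?thesis using ennreal_leI[OF pot_initial] by (rule order_trans)
  qed
  have "wp 0 w prog ?F (input_mem n es p q) \<le> 0 * ennreal (4 + ((1 + 3 * real ell) + (1 + 8 * real (length es)))) + ennreal (1 / 4)"
    unfolding wp_prog_assoc
    by (rule htD[where F = "wp 0 w c_stages (wp 0 w c_product ?F)" and G = "ennreal (1 / 4)" and a = 0,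
        OF ht_init refl]) (intro allI impI, erule B)
  then show ?thesis by simp
qed

lemma ell_le_H: "ell \<le> H"
proof -
  have "2 ^ ell < 2 * L" using Q_less by (simp add: Q_def)
  also have "2 * L \<le> 2 * L * (4 * n * M * L)" using pos by simp
  also have "\<dots> = 8 * n * M * (L * L)" by simp
  finally have "2 ^ ell \<le> 8 * n * M * (L * L)" by (rule less_imp_le)
  then have "floor_log (2 ^ ell) \<le> H" unfolding H_def by (rule floor_log_mono[THEN monoD])
  then show ?thesis by simp
qed

text \<open>The argument of the logarithm is a constant times \<open>n ^ 10 * K ^ 6\<close>. The
  linear bound from \<open>n < 2 ^ n\<close> suffices because the product takes only about
  \<open>n * H\<close> steps.\<close>

lemma H_le: "H \<le> 37 + 10 * n + 6 * K"
proof -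
  have "8 * n * M * (L * L) = (2 ^ 3 * 144 * 6912 ^ 2) * n ^ 10 * K ^ 6"
    unfolding M_def L_def by (algebra | simp add: power_numeral_even power_numeral_odd Let_def ac_simps)
  also have "\<dots> \<le> 2 ^ 37 * (2 ^ n) ^ 10 * (2 ^ K) ^ 6"
    by (intro mult_mono power_mono less_imp_le[OF less_exp]) simp_all
  also have "\<dots> = 2 ^ (37 + 10 * n + 6 * K)" by (simp only: power_add power_mult mult.commute[of 10] mult.commute[of 6])
  finally have "H \<le> floor_log (2 ^ (37 + 10 * n + 6 * K))" unfolding H_def by (rule floor_log_mono[THEN monoD])
  then show ?thesis by (simp only: floor_log_power)
qed

lemma length_es: "length es = card E" "card E \<le> n * n"
proof -
  have "distinct (map (\<lambda>(u, v). {u, v}) es)" "set (map (\<lambda>(u, v). {u, v}) es) = E"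
    using el by (simp_all add: edge_list_def)
  then show "length es = card E" using distinct_card[of "map (\<lambda>(u, v). {u, v}) es"] by simp
  have "E \<subseteq> {e. e \<subseteq> {0..<n} \<and> card e = 2}" using graph by (auto simp: simple_graph_def)
  then have "card E \<le> n choose 2" using card_mono[of "{e. e \<subseteq> {0..<n} \<and> card e = 2}" E] n_subsets[of "{0..<n}" 2] by simp
  also have "\<dots> \<le> n * (n - 1)" by (simp add: choose_two)
  also have "\<dots> \<le> n * n" by simp
  finally show "card E \<le> n * n" .
qed

lemma total_time_le: "total_time \<le> 180000 * real n ^ 3 / \<epsilon>\<^sup>2"
proof -
  define x where "x = real n" define y where "y = real K"
  let ?Z = "x ^ 3 * y ^ 2"
  have xy: "1 \<le> x" "1 \<le> y" using pos by (simp_all add: x_def y_def)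
  have le: "x ^ a * y ^ b \<le> ?Z" if "a \<le> 3" "b \<le> 2" for a b
    using that xy by (intro mult_mono power_increasing) auto
  have mono: "1 \<le> ?Z" "x \<le> ?Z" "x ^ 2 \<le> ?Z" "x ^ 3 \<le> ?Z" "y \<le> ?Z" "x * y \<le> ?Z"
    using le[of 0 0] le[of 1 0] le[of 2 0] le[of 3 0] le[of 0 1] le[of 1 1] by simp_all
  have m: "real (length es) \<le> x ^ 2" using length_es of_nat_mono[OF length_es(2), where ?'a = real] by (simp add: x_def power2_eq_square)
  have h: "real H \<le> 37 + 10 * x + 6 * y" using of_nat_mono[OF H_le, where ?'a = real] by (simp add: x_def y_def)
  have l: "real ell \<le> 37 + 10 * x + 6 * y" using h of_nat_mono[OF ell_le_H, where ?'a = real] by linarith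
  have M: "real M = 144 * (x * y ^ 2)" by (simp add: M_def x_def y_def power2_eq_square)
  \<comment> \<open>7488 = 13 * 144 * 4 and, for the first stage, 11232 = 13 * 144 * 6.\<close>
  have s0: "stage_time {0} \<le> 12 + 7 * x ^ 2 + 7488 * (x ^ 2 * y ^ 2)"
    using m unfolding stage_time_def tau_def M by (simp add: x_def[symmetric] power2_eq_square)
  have s1: "stage_time {} \<le> 12 + 7 * x ^ 2 + 11232 * ?Z"
    using m unfolding stage_time_def tau_def M by (simp add: x_def[symmetric] power2_eq_square power3_eq_cube)
  have a: "x * stage_time {0} \<le> 12 * x + 7 * x ^ 3 + 7488 * ?Z"
  proof -
    have "x * stage_time {0} \<le> x * (12 + 7 * x ^ 2 + 7488 * (x ^ 2 * y ^ 2))" using s0 xy by (intro mult_left_mono) auto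
    also have "\<dots> = 12 * x + 7 * x ^ 3 + 7488 * ?Z" by (simp add: algebra_simps power2_eq_square power3_eq_cube)
    finally show ?thesis .
  qed
  have b: "x * real H \<le> 37 * x + 10 * x ^ 2 + 6 * (x * y)"
  proof -
    have "x * real H \<le> x * (37 + 10 * x + 6 * y)" using h xy by (intro mult_left_mono) auto
    also have "\<dots> = 37 * x + 10 * x ^ 2 + 6 * (x * y)" by (simp add: algebra_simps power2_eq_square)
    finally show ?thesis .
  qed
  have "total_time = 11 + 3 * real ell + 8 * real (length es) + x + x * stage_time {0} + stage_time {} + 5 * x + 3 * (x * real H)"
    by (simp add: total_time_def x_def algebra_simps)
  \<comment> \<open>18720 comes from the moves of the walks; the other terms add less than 1000. The
    factor 9 that follows is the square of the 3 in \<open>K \<le> 3 / \<epsilon>\<close>.\<close>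
  then have "total_time \<le> 20000 * ?Z" using mono m l s1 a b by linarith
  also have "\<dots> \<le> 20000 * (x ^ 3 * (3 / \<epsilon>) ^ 2)" using eps xy by (intro mult_left_mono power_mono) (auto simp: y_def)
  also have "\<dots> = 180000 * real n ^ 3 / \<epsilon>\<^sup>2" by (simp add: x_def power_divide)
  finally show ?thesis .
qed

lemma prog_time: "expected_time (exec w prog (input_mem n es p q)) \<le> ennreal (180000 * real n ^ 3 / \<epsilon>\<^sup>2)"
  using expected_time_le_wp[OF wp_time] ennreal_leI[OF total_time_le] by (rule order_trans)

lemma prog_accuracy:
  "3 / 4 \<le> measure (measure_spmf (exec w prog (input_mem n es p q))) {r. accurate (fst r)}"
proof -
  have "wp 1 w prog (\<lambda>_. 0) (input_mem n es p q) < \<infinity>" using wp_time by (rule order.strict_trans1) simp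
  then have "1 - 1 / 4 \<le> measure (measure_spmf (exec w prog (input_mem n es p q))) {r. accurate (fst r)}"
    by (intro prob_ge_wp wp_lossless wp_error) auto
  then show ?thesis by simp
qed

end

section \<open>Word length, input fractions and the final bounds\<close>

section \<open>The approximation scheme\<close>

lemma bicircular_input_ge_3:
  assumes "bicircular_input n E"
  shows "3 \<le> n"
proof (rule ccontr)
  assume "\<not> 3 \<le> n"
  then have "n = 0 \<or> n = 1 \<or> n = 2" by auto
  moreover have "n \<noteq> 0" using assms by (auto simp: bicircular_input_def connected_graph_def)
  moreover have "card E \<le> n choose 2"
  proof -
    have "E \<subseteq> {e. e \<subseteq> {0..<n} \<and> card e = 2}" using assms by (auto simp: bicircular_input_def simple_graph_def)
    then show ?thesis using card_mono[of "{e. e \<subseteq> {0..<n} \<and> card e = 2}" E] n_subsets[of "{0..<n}" 2] by simp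
  qed
  moreover have "n \<le> card E" using assms by (simp add: bicircular_input_def)
  ultimately show False by (auto simp: choose_two)
qed

text \<open>All numbers in the program are polynomial in \<open>n / \<epsilon>\<close>, so a fixed
  power of it bounds them; 50 is ample. The fraction \<open>p / q\<close> is within a factor of two
  of \<open>\<epsilon>\<close>, and rounding up adds at most \<open>1 / \<epsilon>\<close>, whence
  \<open>K \<le> 3 / \<epsilon>\<close>.\<close>

lemma input_accuracy:
  assumes G: "bicircular_input n E" and eps: "0 < \<epsilon>" "\<epsilon> < 1" and rep: "represents 50 w n E \<epsilon> s"
  obtains es p q where "s = input_mem n es p q" "bicircular_accuracy n E es p q w \<epsilon>"
proof -
  obtain es p q where s: "s = input_mem n es p q" "edge_list E es" "0 < q" "real p / real q \<le> \<epsilon>" "\<epsilon> \<le> 2 * (real p / real q)"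
    "n < 2 ^ w" "length es < 2 ^ w" "q < 2 ^ w" "(real n / \<epsilon>) ^ 50 \<le> 2 ^ w"
    using rep unfolding represents_def by blast
  have n3: "3 \<le> n" using bicircular_input_ge_3[OF G] .
  have p0: "0 < p" using s(5) eps by (cases "p = 0") auto
  have "real p < real q"
  proof -
    have "real p / real q < 1" using s(4) eps by linarith
    then show ?thesis using s(3) by (simp add: divide_less_eq)
  qed
  then have pw: "p < 2 ^ w" using s(8) by simp
  interpret I: bicircular_instance n E es p q w
    using G s pw p0 n3 by unfold_locales (auto simp: bicircular_input_def)
  have qp: "1 / \<epsilon> \<le> real q / real p" "real q / real p \<le> 2 / \<epsilon>"
    using s(3,4,5) eps p0 by (auto simp: field_simps)
  have K: "1 / \<epsilon> \<le> real I.K" "real I.K \<le> 3 / \<epsilon>"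
  proof -
    have f: "real (q div p) = of_int \<lfloor>real q / real p\<rfloor>" by (simp add: floor_divide_of_nat_eq)
    have "real q / real p \<le> real I.K" unfolding I.K_def using f by (simp only: of_nat_add of_nat_1) linarith
    then show "1 / \<epsilon> \<le> real I.K" using qp by linarith
    have "real I.K \<le> real q / real p + 1" unfolding I.K_def using f by (simp only: of_nat_add of_nat_1) linarith
    moreover have "1 \<le> 1 / \<epsilon>" using eps by simp
    moreover have "3 / \<epsilon> = 2 / \<epsilon> + 1 / \<epsilon>" by (simp add: add_divide_distrib[symmetric])
    ultimately show "real I.K \<le> 3 / \<epsilon>" using qp by linarith
  qed
  have "8 * n * n * I.M * I.L * I.L < 2 ^ w"
  proof -
    define X where "X = real n / \<epsilon>"
    have nX: "real n \<le> X"
      using eps mult_left_mono[of \<epsilon> 1 "real n"] by (simp add: X_def le_divide_eq)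
    have KX: "real I.K \<le> X"
    proof -
      have "3 / \<epsilon> \<le> X" unfolding X_def using n3 eps by (intro divide_right_mono) auto
      then show ?thesis using K(2) by linarith
    qed
    have X3: "3 \<le> X" using nX n3 by linarith
    \<comment> \<open>The constant is below \<open>3 ^ 23\<close>, and 3, \<open>n\<close> and
      \<open>K\<close> are all at most \<open>X\<close>, so the degree is 23 + 11 + 6 = 40.\<close>
    have "real (8 * n * n * I.M * I.L * I.L) = 55037657088 * (real n ^ 11 * real I.K ^ 6)"
      unfolding I.M_def I.L_def of_nat_mult of_nat_numeral by algebra
    also have "\<dots> \<le> 3 ^ 23 * (X ^ 11 * X ^ 6)"
      using nX KX X3 by (intro mult_mono power_mono) auto
    also have "\<dots> \<le> X ^ 23 * (X ^ 11 * X ^ 6)" using X3 by (intro mult_right_mono power_mono) auto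
    also have "\<dots> = X ^ 40" by (simp flip: power_add)
    also have "\<dots> < X ^ 50" using X3 by (intro power_strict_increasing) auto
    also have "\<dots> \<le> 2 ^ w" using s(9) by (simp add: X_def)
    finally have "real (8 * n * n * I.M * I.L * I.L) < real (2 ^ w)" by simp
    then show ?thesis by (simp only: of_nat_less_iff)
  qed
  then have "bicircular_accuracy n E es p q w \<epsilon>" using eps K by unfold_locales
  with s(1) show ?thesis by (rule that)
qed

lemma polynomial_bound:
  fixes n m :: nat and \<epsilon> :: real
  assumes "3 \<le> n" "n \<le> m" "0 < \<epsilon>" "\<epsilon> < 1"
  shows "180000 * real n ^ 3 / \<epsilon>\<^sup>2 \<le> (real n + real m + 1 / \<epsilon>) ^ 12"
proof -
  let ?b = "real n + real m + 1 / \<epsilon>"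
  have e: "1 < 1 / \<epsilon>" using assms by simp
  then have b: "7 \<le> ?b" "real n \<le> ?b" "1 / \<epsilon> \<le> ?b" using assms by linarith+
  have "180000 * real n ^ 3 / \<epsilon>\<^sup>2 = 180000 * (real n ^ 3 * (1 / \<epsilon>) ^ 2)" by (simp add: power_divide)
  \<comment> \<open>\<open>180000 \<le> 7 ^ 7\<close>, and 7 is a lower bound for the base; this
    gives the exponent 12 = 7 + 3 + 2.\<close>
  also have "\<dots> \<le> 7 ^ 7 * (?b ^ 3 * ?b ^ 2)" using b e assms(3) by (intro mult_mono power_mono) auto
  also have "\<dots> \<le> ?b ^ 7 * (?b ^ 3 * ?b ^ 2)" using b by (intro mult_right_mono power_mono) auto
  also have "\<dots> = ?b ^ 12" by (simp flip: power_add)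
  finally show ?thesis .
qed

theorem theorem6p4:
  "\<exists>(P :: com) (c :: nat) (C :: real).
     fpras c P bicircular_input (\<lambda>n E. card (bicircular_bases {0..<n} E)) \<and>
     runs_in_expected_time c P bicircular_input
       (\<lambda>n E \<epsilon>. C * real n ^ 3 * (ln (real n))\<^sup>2 / \<epsilon>\<^sup>2)"
proof -
  have time: "expected_time (exec w prog s) \<le> ennreal (180000 * real n ^ 3 / \<epsilon>\<^sup>2)"
    if G: "bicircular_input n E" "0 < \<epsilon>" "\<epsilon> < 1" "represents 50 w n E \<epsilon> s" for n E \<epsilon> w s
  proof -
    obtain es p q where s: "s = input_mem n es p q" and A: "bicircular_accuracy n E es p q w \<epsilon>"
      by (rule input_accuracy[OF G])
    interpret bicircular_accuracy n E es p q w \<epsilon> by (rule A)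
    show ?thesis unfolding s by (rule prog_time)
  qed
  have accuracy: "3 / 4 \<le> measure (measure_spmf (exec w prog s))
      {r. (1 - \<epsilon>) * real (card (bicircular_bases {0..<n} E)) \<le> estimate (fst r) \<and>
          estimate (fst r) \<le> (1 + \<epsilon>) * real (card (bicircular_bases {0..<n} E))}"
    if G: "bicircular_input n E" "0 < \<epsilon>" "\<epsilon> < 1" "represents 50 w n E \<epsilon> s" for n E \<epsilon> w s
  proof -
    obtain es p q where s: "s = input_mem n es p q" and A: "bicircular_accuracy n E es p q w \<epsilon>"
      by (rule input_accuracy[OF G])
    interpret bicircular_accuracy n E es p q w \<epsilon> by (rule A)
    show ?thesis using prog_accuracy unfolding s accurate_def card_bicircular_bases .
  qed
  have "runs_in_expected_time 50 prog bicircular_input (\<lambda>n E \<epsilon>. 180000 * real n ^ 3 * (ln (real n))\<^sup>2 / \<epsilon>\<^sup>2)"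
    unfolding runs_in_expected_time_def
  proof (intro allI impI)
    fix n E and \<epsilon> :: real and w s
    assume G: "bicircular_input n E" "0 < \<epsilon>" "\<epsilon> < 1" "represents 50 w n E \<epsilon> s"
    have n3: "3 \<le> n" by (rule bicircular_input_ge_3[OF G(1)])
    \<comment> \<open>\<open>n\<close> is at least 3 and so above e, hence the logarithm is at least
      1 and its square does not lower the bound.\<close>
    then have "exp 1 \<le> real n" using exp_le by linarith
    then have "1 \<le> ln (real n)" using n3 by (simp add: ln_ge_iff)
    then have "1 \<le> (ln (real n))\<^sup>2" by (rule one_le_power)
    then have "180000 * real n ^ 3 * 1 / \<epsilon>\<^sup>2 \<le> 180000 * real n ^ 3 * (ln (real n))\<^sup>2 / \<epsilon>\<^sup>2"
      by (intro divide_right_mono mult_left_mono) auto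
    then have "ennreal (180000 * real n ^ 3 / \<epsilon>\<^sup>2) \<le> ennreal (180000 * real n ^ 3 * (ln (real n))\<^sup>2 / \<epsilon>\<^sup>2)"
      by (intro ennreal_leI) simp
    with time[OF G] show "expected_time (exec w prog s) \<le> ennreal (180000 * real n ^ 3 * (ln (real n))\<^sup>2 / \<epsilon>\<^sup>2)"
      by (rule order_trans)
  qed
  moreover have "runs_in_expected_time 50 prog bicircular_input (\<lambda>n E \<epsilon>. (real n + real (card E) + 1 / \<epsilon>) ^ 12)"
    unfolding runs_in_expected_time_def
  proof (intro allI impI)
    fix n E and \<epsilon> :: real and w s
    assume G: "bicircular_input n E" "0 < \<epsilon>" "\<epsilon> < 1" "represents 50 w n E \<epsilon> s"
    have "n \<le> card E" using G(1) by (simp add: bicircular_input_def)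
    then have "ennreal (180000 * real n ^ 3 / \<epsilon>\<^sup>2) \<le> ennreal ((real n + real (card E) + 1 / \<epsilon>) ^ 12)"
      using polynomial_bound[OF bicircular_input_ge_3[OF G(1)] _ G(2,3)] by (intro ennreal_leI)
    with time[OF G] show "expected_time (exec w prog s) \<le> ennreal ((real n + real (card E) + 1 / \<epsilon>) ^ 12)"
      by (rule order_trans)
  qed
  ultimately show ?thesis
    unfolding fpras_def using accuracy by blast
qed

end
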